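(* $[6]=5$. That is: let $n\ge 5$ and let $\mathcal{F}$ be any neutral fault of mass $6$ in $\mathcal{Q}_n$ (i.e. a set of three red and three green vertices). Then $\mathcal{Q}_n-\mathcal{F}$ is Hamiltonian. The claim is not true if $n=3$ or $n=4$: for each $n\in\{3,4\}$ there is a neutral fault $\mathcal{F}$ of mass $6$ in $\mathcal{Q}_n$ such that $\mathcal{Q}_n-\mathcal{F}$ is not Hamiltonian.
   Context: $\mathcal{Q}_n$ is the $n$-dimensional binary hypercube: its vertices are all binary sequences of length $n$, and two vertices are adjacent iff they differ in exactly one position. A vertex is even or odd according to the parity of its number of 1's; the vertices of one parity are called red and those of the other parity green. A fault $\mathcal{F}$ in $\mathcal{Q}_n$ is a set of deleted vertices; its mass is $|\mathcal{F}|$, its charge is the absolute value of the difference between the numbers of red and green vertices in $\mathcal{F}$, and it is neutral if its charge is $0$. $\mathcal{Q}_n-\mathcal{F}$ is the subgraph induced by the non-deleted vertices. A graph is Hamiltonian if it has a Hamiltonian cycle. For an even integer $M\ge 0$, $[M]$ denotes the smallest positive integer $m$ such that for every $n\ge m$ and every neutral fault $\mathcal{F}$ of mass $M$ in $\mathcal{Q}_n$ the graph $\mathcal{Q}_n-\mathcal{F}$ is Hamiltonian. *)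

theory Defs
  imports Graph_Theory.Graph_Theory
begin

definition hypercube :: "nat \<Rightarrow> bool list pair_pre_digraph" where
  "hypercube n =
     \<lparr> pverts = {x. length x = n},
       parcs = {(x, y). length x = n \<and> length y = n \<and> card {i. i < n \<and> x ! i \<noteq> y ! i} = 1} \<rparr>"

text \<open>Undirected graphs are represented as symmetric digraphs.\<close>

lemma hypercube_pair_graph: "pair_graph (hypercube n)"
proof -
  have V: "pverts (hypercube n) = {x. length x = n}"
    and A: "\<And>x y. (x, y) \<in> parcs (hypercube n) \<longleftrightarrow>
      length x = n \<and> length y = n \<and> card {i. i < n \<and> x ! i \<noteq> y ! i} = 1"
    by (simp_all add: hypercube_def)
  have swap: "{i. i < n \<and> y ! i \<noteq> x ! i} = {i. i < n \<and> x ! i \<noteq> y ! i}" for x y :: "bool list"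
    by blast
  have sym: "sym (parcs (hypercube n))"
    by (rule symI) (simp only: A swap)
  have fin: "finite (pverts (hypercube n))"
    using finite_lists_length_eq[of "UNIV :: bool set" n] by (simp add: V)
  have "parcs (hypercube n) \<subseteq> pverts (hypercube n) \<times> pverts (hypercube n)"
    by (rule subrelI) (simp add: A V)
  then have fin': "finite (parcs (hypercube n))"
    by (rule finite_subset) (simp add: fin)
  have irrefl: "(x, x) \<notin> parcs (hypercube n)" for x
    unfolding A by simp
  have wf: "fst e \<in> pverts (hypercube n)" "snd e \<in> pverts (hypercube n)" "fst e \<noteq> snd e"
    if "e \<in> parcs (hypercube n)" for e
  proof -
    obtain x y where e: "e = (x, y)" by (cases e)
    show "fst e \<in> pverts (hypercube n)" "snd e \<in> pverts (hypercube n)"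
      using that unfolding e A V by simp_all
    show "fst e \<noteq> snd e"
      using that irrefl unfolding e by auto
  qed
  have sym': "symmetric (with_proj (hypercube n))"
    using sym by (simp add: symmetric_def)
  show ?thesis
    by unfold_locales (fact wf fin fin' sym')+
qed

definition red :: "bool list \<Rightarrow> bool" where
  "red x \<longleftrightarrow> even (count_list x True)"

abbreviation green :: "bool list \<Rightarrow> bool" where
  "green x \<equiv> \<not> red x"

definition fault :: "nat \<Rightarrow> bool list set \<Rightarrow> bool" where
  "fault n F \<longleftrightarrow> F \<subseteq> pverts (hypercube n)"

abbreviation mass :: "bool list set \<Rightarrow> nat" where
  "mass F \<equiv> card F"

definition charge :: "bool list set \<Rightarrow> int" where
  "charge F = \<bar>int (card {x \<in> F. red x}) - int (card {x \<in> F. green x})\<bar>"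

definition neutral :: "bool list set \<Rightarrow> bool" where
  "neutral F \<longleftrightarrow> charge F = 0"

definition faulty_cube :: "nat \<Rightarrow> bool list set \<Rightarrow> (bool list, bool list \<times> bool list) pre_digraph" where
  "faulty_cube n F = with_proj (hypercube n) \<restriction> (pverts (hypercube n) - F)"

text \<open>
  In a symmetric digraph the closed walk \<open>a, b, a\<close> counts as a \<^const>\<open>pre_digraph.cycle\<close>; the
  length bound excludes it, so that cycles are those of the underlying simple graph.
\<close>

definition hamiltonian :: "('a, 'b) pre_digraph \<Rightarrow> bool" where
  "hamiltonian G \<longleftrightarrow>
     (\<exists>u p. pre_digraph.awalk G u p u \<and> pre_digraph.cycle G p \<and> 3 \<le> length p \<and>
            set (pre_digraph.awalk_verts G u p) = verts G)"

text \<open>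
  The number \<open>[M]\<close>, for even \<open>M\<close>. The value is meaningful only if some positive \<open>m\<close> satisfies the
  condition, since \<^const>\<open>Least\<close> is unspecified otherwise.
\<close>

definition bracket :: "nat \<Rightarrow> nat" where
  "bracket M =
     (LEAST m. 0 < m \<and>
        (\<forall>n\<ge>m. \<forall>F. fault n F \<and> neutral F \<and> mass F = M \<longrightarrow> hamiltonian (faulty_cube n F)))"

end

theory Submission
  imports Defs
begin

text \<open>
  The proof is by induction on \<open>n\<close>. Split the cube into two halves \<open>A\<close> and \<open>B\<close> along a direction
  separating two red faults, so that \<open>A\<close>, say, contains exactly two red faults. In one half, delete
  additional vertices if necessary to make its fault neutral; what remains of that half has a
  Hamiltonian cycle \<open>C\<close>, by induction or by the analogous theorem for four faults. An edge \<open>cd\<close> of \<open>C\<close>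
  is then replaced by a detour through the other half: from \<open>c\<close> to its neighbour \<open>c'\<close> there, along a
  Hamiltonian path to \<open>d'\<close>, and back to \<open>d\<close>. An additionally deleted vertex \<open>x\<close> adjacent to \<open>c\<close> is
  reinserted by starting the detour with \<open>c, x, x'\<close>. When two detours are needed, a second direction
  keeps them apart. The paths come from three statements: Hamiltonian paths exist between
  vertices of different colour in a full cube (Havel), between vertices of the same colour in a cube
  with one fault of the other colour, and between vertices of different colour in a cube with a neutral pair
  of faults. The base cases in dimensions 4 and 5 are settled by explicit paths and cycles, after
  moving the red faults into a normal position; in dimension 5 the faults that some direction splits
  into neutral parts of mass 2 and 4 are already covered by the detour argument.
\<close>

section \<open>Hamiltonian paths and cycles\<close>

text \<open>Parity decides which detours exist. An alternating path covering equally many vertices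
  of both colours joins different colours; a surplus vertex of one colour forces both ends to have
  that colour. So a half with a single fault has to be crossed between vertices of equal colour,
  which the ends of a cycle edge never are. Entering it through the deleted vertex \<open>x\<close>
  repairs this, since \<open>x\<close> and \<open>d\<close> are both neighbours of \<open>c\<close>.
  A half that has lost two red vertices and no green one has a surplus of two and is covered by no
  single path; it is cut once more into quarters with surplus one. Every landing point must also
  avoid the faults opposite. This is arranged by counting, against the 2^(n-1) vertices of each
  colour, the n neighbours of a vertex, and the two cycle edges at a vertex. The path statement with
  two faults is available from dimension 4 on, but a neutral fault of mass 6 can take three of the
  four neighbours of a vertex in the 4-cube, so the induction for six faults cannot start before
  dimension 5.\<close>

text \<open>
  Finite sets of coordinates serve as vertices, so that cubes of all dimensions, and all their
  subcubes, live in one type.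
\<close>

typedef vertex = "{x :: nat set. finite x}"
  morphisms supp Vertex
  by auto

lemma finite_supp [simp]: "finite (supp x)"
  using supp by auto

lemma vertex_eqI: "(\<And>i. i \<in> supp x \<longleftrightarrow> i \<in> supp y) \<Longrightarrow> x = y"
  by (metis subsetI subset_antisym supp_inject)

section \<open>Flips, colour and adjacency\<close>

definition flip :: "nat \<Rightarrow> vertex \<Rightarrow> vertex" where
  "flip i x = Vertex (if i \<in> supp x then supp x - {i} else insert i (supp x))"

definition col :: "vertex \<Rightarrow> bool" where
  "col x \<longleftrightarrow> even (card (supp x))"

definition adj :: "vertex \<Rightarrow> vertex \<Rightarrow> bool" where
  "adj x y \<longleftrightarrow> (\<exists>i. y = flip i x)"

lemma supp_flip: "supp (flip i x) = (if i \<in> supp x then supp x - {i} else insert i (supp x))"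
  by (simp add: flip_def Vertex_inverse)

text \<open>The inequality of truth values is an exclusive or. In this form identities between flips
  reduce to propositional reasoning about single coordinates.\<close>

lemma mem_flip: "j \<in> supp (flip i x) \<longleftrightarrow> (j \<in> supp x) \<noteq> (j = i)"
  by (auto simp: supp_flip)

lemma flip_flip [simp]: "flip i (flip i x) = x"
  by (rule vertex_eqI) (auto simp: mem_flip)

lemma flip_neq [simp]: "flip i x \<noteq> x" "x \<noteq> flip i x"
  using mem_flip[of i i x] by auto

lemma col_flip [simp]: "col (flip i x) = (\<not> col x)"
  by (cases "i \<in> supp x") (auto simp: col_def supp_flip card_Diff_singleton card_gt_0_iff)

lemma flip_inj [simp]: "flip i x = flip i y \<longleftrightarrow> x = y"
  by (metis flip_flip)

lemma flip_dir_inj [simp]: "flip i x = flip j x \<longleftrightarrow> i = j"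
  by (metis mem_flip)

lemma adj_flip [simp]: "adj x (flip i x)" "adj (flip i x) x"
  unfolding adj_def by (blast, metis flip_flip)

lemma adj_col: "adj x y \<Longrightarrow> col y = (\<not> col x)"
  by (auto simp: adj_def)

lemma adj_sym: "adj x y \<longleftrightarrow> adj y x"
  unfolding adj_def by (metis flip_flip)

lemma adj_irrefl [simp]: "\<not> adj x x"
  by (auto simp: adj_def)

text \<open>Edges are unordered pairs, so that a list and its reversal have the same edges and a
  detour can be made at an edge whose direction of travel is unknown.\<close>

fun edges :: "'a list \<Rightarrow> 'a set set" where
  "edges (x # y # p) = insert {x, y} (edges (y # p))"
| "edges _ = {}"

lemma edges_append:
  "p \<noteq> [] \<Longrightarrow> q \<noteq> [] \<Longrightarrow> edges (p @ q) = insert {last p, hd q} (edges p \<union> edges q)"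
proof (induction p rule: edges.induct)
  case ("2_2" v)
  then show ?case by (cases q) auto
qed auto

lemma edges_Cons: "edges (x # p) = (if p = [] then {} else insert {x, hd p} (edges p))"
  by (cases p) auto

lemma edges_rev [simp]: "edges (rev p) = edges p"
proof (induction p)
  case (Cons x p)
  then show ?case
    by (cases "p = []") (auto simp: edges_append edges_Cons last_rev insert_commute)
qed simp

lemma edges_subset: "e \<in> edges p \<Longrightarrow> e \<subseteq> set p"
  by (induction p rule: edges.induct) auto

lemma edges_split:
  "e \<in> edges p \<Longrightarrow> \<exists>u v. p = u @ v \<and> u \<noteq> [] \<and> v \<noteq> [] \<and> e = {last u, hd v}"
proof (induction p rule: edges.induct)
  case (1 x y p)
  show ?case
  proof (cases "e = {x, y}")
    case True
    then show ?thesis by (intro exI[of _ "[x]"] exI[of _ "y # p"]) simp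
  next
    case False
    then obtain u v where "y # p = u @ v" "u \<noteq> []" "v \<noteq> []" "e = {last u, hd v}"
      using 1 by auto
    then show ?thesis by (intro exI[of _ "x # u"] exI[of _ v]) simp
  qed
qed auto

text \<open>A vertex that occurs once lies on no edge inside \<open>u\<close> or \<open>v\<close>,
  so only the junctions remain. The degree statements for paths and cycles come down to
  this.\<close>

lemma edges_at:
  assumes "y \<notin> set u" "y \<notin> set v"
  shows "{z. {y, z} \<in> edges (u @ y # v)} =
    (if u = [] then {} else {last u}) \<union> (if v = [] then {} else {hd v})"
proof -
  have 1: "{y, z} \<notin> edges u" "{y, z} \<notin> edges v" for z
    using assms edges_subset by blast+
  have "last u \<noteq> y" if "u \<noteq> []" using that assms by auto
  moreover have "hd v \<noteq> y" if "v \<noteq> []" using that assms by auto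
  ultimately show ?thesis
    using 1 by (auto simp: edges_append edges_Cons doubleton_eq_iff)
qed

text \<open>The edge set is a parameter because a second detour has to know that its edge survived
  the first one.\<close>

definition ham_path :: "vertex set \<Rightarrow> vertex set set \<Rightarrow> vertex \<Rightarrow> vertex \<Rightarrow> bool" where
  "ham_path S E a b \<longleftrightarrow> (\<exists>p. p \<noteq> [] \<and> distinct p \<and> set p = S \<and> hd p = a \<and> last p = b \<and>
     successively adj p \<and> edges p = E)"

text \<open>A path whose ends are adjacent, together with the closing edge. The bound 3 excludes a
  single edge walked back and forth.\<close>

definition ham_cycle :: "vertex set \<Rightarrow> vertex set set \<Rightarrow> bool" where
  "ham_cycle S E \<longleftrightarrow> (\<exists>a b E'. ham_path S E' a b \<and> adj a b \<and> 3 \<le> card S \<and> E = insert {a, b} E')"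

section \<open>Cutting, joining and detours\<close>

lemma ham_path_single: "ham_path {a} {} a a"
  unfolding ham_path_def by (rule exI[of _ "[a]"]) simp

lemma ham_path_ends: "ham_path S E a b \<Longrightarrow> a \<in> S \<and> b \<in> S"
  unfolding ham_path_def by auto

lemma ham_path_rev:
  assumes "ham_path S E a b"
  shows "ham_path S E b a"
proof -
  obtain p where p: "p \<noteq> []" "distinct p" "set p = S" "hd p = a" "last p = b"
    "successively adj p" "edges p = E"
    using assms unfolding ham_path_def by auto
  have "(\<lambda>x y. adj y x) = adj" using adj_sym by blast
  then have "successively adj (rev p)" using p(6) by (metis successively_rev)
  then show ?thesis
    unfolding ham_path_def using p by (intro exI[of _ "rev p"]) (simp add: hd_rev last_rev)
qed

lemma ham_path_join:
  assumes "ham_path S E a c" "ham_path T E' d b" "adj c d" "S \<inter> T = {}"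
  shows "ham_path (S \<union> T) (insert {c, d} (E \<union> E')) a b"
proof -
  obtain p where "p \<noteq> []" "distinct p" "set p = S" "hd p = a" "last p = c"
    "successively adj p" "edges p = E"
    using assms(1) unfolding ham_path_def by auto
  moreover obtain q where "q \<noteq> []" "distinct q" "set q = T" "hd q = d" "last q = b"
    "successively adj q" "edges q = E'"
    using assms(2) unfolding ham_path_def by auto
  ultimately show ?thesis
    unfolding ham_path_def using assms(3,4)
    by (intro exI[of _ "p @ q"]) (simp add: successively_append_iff edges_append)
qed

text \<open>Which end of \<open>e\<close> the path meets first is only known after cutting; hence
  \<open>c\<close> and \<open>d\<close> are obtained and not given.\<close>

lemma ham_path_split:
  assumes "ham_path S E a b" "e \<in> E"
  obtains S1 S2 E1 E2 c d where "e = {c, d}" "ham_path S1 E1 a c" "ham_path S2 E2 d b"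
    "adj c d" "S = S1 \<union> S2" "S1 \<inter> S2 = {}" "E = insert e (E1 \<union> E2)"
proof -
  obtain p where p: "p \<noteq> []" "distinct p" "set p = S" "hd p = a" "last p = b"
    "successively adj p" "edges p = E"
    using assms(1) unfolding ham_path_def by auto
  then obtain u v where uv: "p = u @ v" "u \<noteq> []" "v \<noteq> []" "e = {last u, hd v}"
    using edges_split assms(2) by metis
  have "ham_path (set u) (edges u) a (last u)" "ham_path (set v) (edges v) (hd v) b"
    unfolding ham_path_def using p uv by (auto simp: successively_append_iff)
  then show ?thesis
    using that p uv by (auto simp: successively_append_iff edges_append)
qed

lemma ham_path_edge:
  assumes "ham_path S E a b" "{x, y} \<in> E"
  shows "adj x y" "x \<in> S" "y \<in> S"
proof -
  obtain S1 S2 E1 E2 c d where *: "{x, y} = {c, d}" "ham_path S1 E1 a c" "ham_path S2 E2 d b"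
    "adj c d" "S = S1 \<union> S2"
    using ham_path_split[OF assms] by metis
  then show "adj x y" "x \<in> S" "y \<in> S"
    using ham_path_ends[OF *(2)] ham_path_ends[OF *(3)]
    by (auto simp: doubleton_eq_iff adj_sym)
qed

lemma ham_path_detour:
  assumes "ham_path S E a b" "{c, d} \<in> E" "ham_path T E' c' d'" "adj c c'" "adj d d'" "S \<inter> T = {}"
  shows "\<exists>E''. ham_path (S \<union> T) E'' a b \<and> E - {{c, d}} \<subseteq> E''"
proof -
  obtain S1 S2 E1 E2 x y where *: "{c, d} = {x, y}" "ham_path S1 E1 a x" "ham_path S2 E2 y b"
    "adj x y" "S = S1 \<union> S2" "S1 \<inter> S2 = {}" "E = insert {c, d} (E1 \<union> E2)"
    using ham_path_split[OF assms(1,2)] by metis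
  \<comment> \<open>\<open>x\<close> and \<open>y\<close> are \<open>c\<close> and \<open>d\<close>
    in the order of the path; in the opposite order the path through \<open>T\<close> is
    reversed.\<close>
  obtain x' y' where "ham_path T E' x' y'" "adj x x'" "adj y y'"
    using * assms ham_path_rev by (metis doubleton_eq_iff)
  then have "ham_path ((S1 \<union> T) \<union> S2) (insert {y', y} (insert {x, x'} (E1 \<union> E') \<union> E2)) a b"
    using * assms(6) by (intro ham_path_join) (auto simp: adj_sym)
  then show ?thesis
    using * by (intro exI[of _ "insert {y', y} (insert {x, x'} (E1 \<union> E') \<union> E2)"]) (auto simp: Un_ac)
qed

lemma ham_path_end_nbr:
  assumes "ham_path S E a b" "a \<noteq> b"
  shows "\<exists>z. {a, z} \<in> E"
proof -
  obtain p where p: "p \<noteq> []" "hd p = a" "last p = b" "edges p = E"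
    using assms(1) unfolding ham_path_def by auto
  with assms(2) have "{a, hd (tl p)} \<in> edges p"
    by (cases p) (auto simp: edges_Cons split: if_splits)
  with p show ?thesis by blast
qed

text \<open>Of two different neighbours at least one avoids a forbidden vertex; the exits of detours
  avoid a fault in this way.\<close>

lemma ham_path_nbrs:
  assumes "ham_path S E a b" "y \<in> S" "y \<noteq> a" "y \<noteq> b"
  obtains z w where "z \<noteq> w" "{y, z} \<in> E" "{y, w} \<in> E"
proof -
  obtain p where p: "p \<noteq> []" "distinct p" "set p = S" "hd p = a" "last p = b" "edges p = E"
    using assms(1) unfolding ham_path_def by auto
  then obtain u v where uv: "p = u @ y # v"
    using assms(2) by (meson split_list)
  then have "u \<noteq> []" "v \<noteq> []" "y \<notin> set u" "y \<notin> set v"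
    using p assms by auto
  then have "{z. {y, z} \<in> E} = {last u, hd v}"
    using edges_at[of y u v] p(6) uv by (simp add: insert_commute)
  moreover have "last u \<noteq> hd v"
    using p uv \<open>u \<noteq> []\<close> \<open>v \<noteq> []\<close> by auto (metis disjoint_iff hd_in_set last_in_set)
  ultimately show ?thesis using that by blast
qed

text \<open>The first part allows a choice between two edges at a vertex. The bound in the second
  part serves where no such choice is left: the few vertices whose cycle edges lead to a forbidden
  vertex can be excluded in advance.\<close>

lemma ham_cycle_nbrs:
  assumes "ham_cycle S E"
  shows "y \<in> S \<Longrightarrow> \<exists>z w. z \<noteq> w \<and> {y, z} \<in> E \<and> {y, w} \<in> E"
    and "\<exists>z w. {x. {y, x} \<in> E} \<subseteq> {z, w}"
proof -
  obtain a b E' where ab: "ham_path S E' a b" "adj a b" "3 \<le> card S" "E = insert {a, b} E'"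
    using assms unfolding ham_cycle_def by auto
  obtain p where p: "p \<noteq> []" "distinct p" "set p = S" "hd p = a" "last p = b" "edges p = E'"
    using ab(1) unfolding ham_path_def by auto
  have peq: "{x. {y, x} \<in> edges p} = (if u = [] then {} else {last u}) \<union> (if v = [] then {} else {hd
      v})"
    if "p = u @ y # v" for u y v
    using edges_at[of y u v] p(2) that by simp
  \<comment> \<open>With at least three vertices, the neighbour of one end along the path differs
    from the other end, so the closing edge contributes a second neighbour.\<close>
  have len: "3 \<le> length p" using p ab(3) distinct_card by metis
  have "a \<noteq> b" using ab(2) by auto
  have at: "{x. {y, x} \<in> E} = {x. {y, x} \<in> edges p} \<union> (if y = a then {b} else {}) \<union> (if y = b then
      {a} else {})"
    for y using ab(4) p(6) by (auto simp: doubleton_eq_iff)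
  have main: "y \<in> S \<Longrightarrow> \<exists>z w. z \<noteq> w \<and> {x. {y, x} \<in> E} = {z, w}"
  proof -
    assume "y \<in> S"
    then obtain u v where uv: "p = u @ y # v" using p by (metis split_list)
    then have y: "y \<notin> set u" "y \<notin> set v" using p by auto
    have disj: "set u \<inter> set v = {}" using p uv by auto
    show ?thesis
    proof (cases "u = []")
      case True
      then have v: "y = a" "v \<noteq> []" "b = last v" "tl v \<noteq> []" using uv p len
        by (cases v; auto)+
      then have "hd v \<noteq> b" using p uv by (cases v) auto
      then show ?thesis
        using at[of y] peq[OF uv] v True \<open>a \<noteq> b\<close> by (intro exI[of _ "hd v"] exI[of _ b]) auto
    next
      case u: False
      show ?thesis
      proof (cases "v = []")
        case True
        then have v: "y = b" "a = hd u" "tl u \<noteq> []" using uv p len u by (cases u; auto)+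
        then have "last u \<noteq> a" using p uv u by (cases u) auto
        then show ?thesis
          using at[of y] peq[OF uv] v True u \<open>a \<noteq> b\<close> by (intro exI[of _ "last u"] exI[of _ a]) auto
      next
        case False
        then have "y \<noteq> a" "y \<noteq> b" using u p uv y by auto
        moreover have "last u \<noteq> hd v" using disj u False
          by (metis disjoint_iff hd_in_set last_in_set)
        ultimately show ?thesis
          using at[of y] peq[OF uv] u False by (intro exI[of _ "last u"] exI[of _ "hd v"]) auto
      qed
    qed
  qed
  show "\<exists>z w. z \<noteq> w \<and> {y, z} \<in> E \<and> {y, w} \<in> E" if y: "y \<in> S"
  proof -
    obtain z w where zw: "z \<noteq> w" "{x. {y, x} \<in> E} = {z, w}" using main[OF y] by metis
    then have "z \<in> {x. {y, x} \<in> E}" "w \<in> {x. {y, x} \<in> E}" by simp_all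
    with zw(1) show ?thesis by blast
  qed
  show "\<exists>z w. {x. {y, x} \<in> E} \<subseteq> {z, w}"
  proof (cases "y \<in> S")
    case False
    then have "{x. {y, x} \<in> E} = {}"
      using at[of y] edges_subset[of _ p] ham_path_ends[OF ab(1)] p(3) by auto
    then show ?thesis by auto
  next
    case True
    then obtain z w where "{x. {y, x} \<in> E} = {z, w}" using main by metis
    then show ?thesis by (intro exI[of _ z] exI[of _ w]) simp
  qed
qed

lemma ham_cycle_edge:
  assumes "ham_cycle S E" "{x, y} \<in> E"
  shows "adj x y" "x \<in> S" "y \<in> S"
  using assms unfolding ham_cycle_def
  by (auto simp: doubleton_eq_iff adj_sym dest: ham_path_edge ham_path_ends)

lemma ham_cycle_detour:
  assumes "ham_cycle S E" "{c, d} \<in> E" "ham_path T E' c' d'" "adj c c'" "adj d d'" "S \<inter> T = {}"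
    "finite T"
  shows "\<exists>E''. ham_cycle (S \<union> T) E'' \<and> E - {{c, d}} \<subseteq> E''"
proof -
  obtain a b E1 where ab: "ham_path S E1 a b" "adj a b" "3 \<le> card S" "E = insert {a, b} E1"
    using assms(1) unfolding ham_cycle_def by auto
  have "finite S" using ab(3) card.infinite by fastforce
  then have card: "3 \<le> card (S \<union> T)"
    using ab(3) assms(7) by (metis Un_upper1 card_mono finite_UnI le_trans)
  show ?thesis
  proof (cases "{c, d} = {a, b}")
    case True
    \<comment> \<open>The edge to be replaced closes the cycle. The path through \<open>T\<close> is
      appended behind \<open>b\<close>, and its far end \<open>a'\<close> becomes the new end,
      joined to \<open>a\<close>.\<close>
    then obtain a' b' where "ham_path T E' b' a'" "adj a a'" "adj b b'"
      using assms(3-5) ham_path_rev by (metis doubleton_eq_iff)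
    then have "ham_path (S \<union> T) (insert {b, b'} (E1 \<union> E')) a a'" "adj a a'"
      using ham_path_join[OF ab(1)] assms(6) by auto
    then show ?thesis
      using card ab(4) True unfolding ham_cycle_def by (intro exI conjI) (auto)
  next
    case False
    then obtain E2 where "ham_path (S \<union> T) E2 a b" "E1 - {{c, d}} \<subseteq> E2"
      using ham_path_detour[OF ab(1) _ assms(3-6)] assms(2) ab(4) by auto
    then show ?thesis
      using card ab(2,4) unfolding ham_cycle_def by (intro exI[of _ "insert {a, b} E2"]) blast
  qed
qed

text \<open>In the cube \<open>x\<close> and \<open>z\<close> have the same colour, both being
  neighbours of \<open>y\<close>. So \<open>x'\<close> and \<open>z'\<close> have the same colour
  too, as a path through a half with one fault requires.\<close>

lemma ham_cycle_detour_via: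
  assumes "ham_cycle S E" "{y, z} \<in> E" "adj y x" "ham_path T E' x' z'" "adj x x'" "adj z z'"
    "x \<notin> S" "x \<notin> T" "S \<inter> T = {}" "finite T"
  shows "\<exists>E''. ham_cycle (S \<union> insert x T) E'' \<and> E - {{y, z}} \<subseteq> E''"
proof -
  have "ham_path (insert x T) (insert {x, x'} E') x z'"
    using ham_path_join[OF ham_path_single assms(4,5)] assms(8) by simp
  from ham_cycle_detour[OF assms(1,2) this] assms show ?thesis by simp
qed

section \<open>Subcubes\<close>

text \<open>A base point \<open>b\<close> and a set \<open>I\<close> of free coordinates.
  Coordinates keep their names in halves and quarters, so one direction can be used on both sides of
  a split without renumbering.\<close>

definition subcube :: "nat \<Rightarrow> vertex set \<Rightarrow> bool" where
  "subcube n Q \<longleftrightarrow> (\<exists>b I. finite I \<and> card I = n \<and>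
     Q = {x. \<forall>j. j \<notin> I \<longrightarrow> (j \<in> supp x) = (j \<in> supp b)})"

definition dir :: "vertex set \<Rightarrow> nat \<Rightarrow> bool" where
  "dir Q i \<longleftrightarrow> (\<forall>x\<in>Q. flip i x \<in> Q)"

definition half :: "vertex set \<Rightarrow> nat \<Rightarrow> bool \<Rightarrow> vertex set" where
  "half Q i s = {x \<in> Q. (i \<in> supp x) = s}"

lemma subcubeE:
  assumes "subcube n Q"
  obtains b I where "finite I" "card I = n" "b \<in> Q"
    "Q = {x. \<forall>j. j \<notin> I \<longrightarrow> (j \<in> supp x) = (j \<in> supp b)}" "\<And>i. dir Q i \<longleftrightarrow> i \<in> I"
proof -
  obtain b I where *: "finite I" "card I = n"
    "Q = {x. \<forall>j. j \<notin> I \<longrightarrow> (j \<in> supp x) = (j \<in> supp b)}"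
    using assms unfolding subcube_def by auto
  have "dir Q i \<longleftrightarrow> i \<in> I" for i
  proof
    assume "dir Q i"
    then have "flip i b \<in> Q" using * by (auto simp: dir_def)
    then show "i \<in> I" using * by (auto simp: mem_flip)
  qed (auto simp: dir_def * mem_flip)
  then show ?thesis using * that by auto
qed

lemma dir_flip: "dir Q i \<Longrightarrow> flip i x \<in> Q \<longleftrightarrow> x \<in> Q"
  unfolding dir_def by (metis flip_flip)

lemma subcube_dirs: "subcube n Q \<Longrightarrow> finite {i. dir Q i} \<and> card {i. dir Q i} = n"
  by (erule subcubeE) simp

text \<open>Supplies the directions of splits: coordinates that are not free are constant on
  \<open>Q\<close>, so whatever tells two faults apart can halve the cube.\<close>

lemma subcube_sep:
  "subcube n Q \<Longrightarrow> x \<in> Q \<Longrightarrow> y \<in> Q \<Longrightarrow> (i \<in> supp x) \<noteq> (i \<in> supp y) \<Longrightarrow> dir Q i"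
  by (erule subcubeE) auto

lemma subcube_eqI:
  "x \<noteq> y \<Longrightarrow> subcube n Q \<Longrightarrow> x \<in> Q \<Longrightarrow> y \<in> Q \<Longrightarrow> \<exists>i. dir Q i \<and> (i \<in> supp x) \<noteq> (i \<in> supp y)"
  using subcube_sep vertex_eqI by blast

lemma subcube_half:
  assumes "subcube (Suc n) Q" "dir Q i"
  shows "subcube n (half Q i s)"
proof -
  obtain b I where *: "finite I" "card I = Suc n" "b \<in> Q" "i \<in> I"
    "Q = {x. \<forall>j. j \<notin> I \<longrightarrow> (j \<in> supp x) = (j \<in> supp b)}"
    using assms by (elim subcubeE) blast
  \<comment> \<open>The base point has to lie in the chosen half.\<close>
  define b' where "b' = (if (i \<in> supp b) = s then b else flip i b)"
  have "half Q i s = {x. \<forall>j. j \<notin> I - {i} \<longrightarrow> (j \<in> supp x) = (j \<in> supp b')}"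
    unfolding half_def *(5) b'_def using *(4) by (auto simp: mem_flip)
  then show ?thesis
    unfolding subcube_def using * by (intro exI[of _ b'] exI[of _ "I - {i}"]) simp
qed

lemma dir_half: "dir Q j \<Longrightarrow> j \<noteq> i \<Longrightarrow> dir (half Q i s) j"
  by (auto simp: dir_def half_def mem_flip)

lemma half_Un: "half Q i s \<union> half Q i (\<not> s) = Q" "half Q i s \<inter> half Q i (\<not> s) = {}"
  by (auto simp: half_def)

lemma mem_half: "x \<in> half Q i s \<longleftrightarrow> x \<in> Q \<and> (i \<in> supp x) = s"
  by (auto simp: half_def)

lemma subcube_0: "subcube 0 Q \<Longrightarrow> \<exists>b. Q = {b}"
proof -
  assume "subcube 0 Q"
  then obtain b where "Q = {x. \<forall>j. (j \<in> supp x) = (j \<in> supp b)}"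
    by (auto elim: subcubeE)
  moreover have "(\<forall>j. (j \<in> supp x) = (j \<in> supp b)) \<longleftrightarrow> x = b" for x
    using vertex_eqI by blast
  ultimately show ?thesis by auto
qed

lemma card_subcube: "subcube n Q \<Longrightarrow> finite Q \<and> card Q = 2 ^ n"
proof (induction n arbitrary: Q)
  case 0
  then show ?case using subcube_0 by fastforce
next
  case (Suc n)
  then obtain i where i: "dir Q i"
    by (metis Collect_empty_eq card.empty nat.distinct(1) subcube_dirs)
  note h = Suc.IH[OF subcube_half[OF Suc.prems i]]
  have "card (half Q i True \<union> half Q i False) = 2 ^ Suc n"
    using h[of True] h[of False] half_Un(2)[of Q i True] by (simp add: card_Un_disjoint)
  then show ?case
    using h[of True] h[of False] half_Un(1)[of Q i True] by (metis finite_UnI)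
qed

lemma card_subcube_col:
  assumes "subcube (Suc n) Q"
  shows "card {x \<in> Q. col x = k} = 2 ^ n"
proof -
  obtain i where i: "dir Q i" using assms
    by (metis Collect_empty_eq card.empty nat.distinct(1) subcube_dirs)
  have fin: "finite Q" and "card Q = 2 ^ Suc n" using card_subcube[OF assms] by auto
  \<comment> \<open>A flip in a free direction exchanges the colour classes.\<close>
  moreover have "bij_betw (flip i) {x \<in> Q. col x = k} {x \<in> Q. col x = (\<not> k)}"
    using i
    by (intro bij_betwI[where g = "flip i"]) (auto simp: dir_def)
  then have "card {x \<in> Q. col x = k} = card {x \<in> Q. col x = (\<not> k)}"
    by (rule bij_betw_same_card)
  moreover have "card Q = card {x \<in> Q. col x = k} + card {x \<in> Q. col x = (\<not> k)}"
    using fin by (subst card_Un_disjoint[symmetric]) (auto intro!: arg_cong[of _ _ card])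
  ultimately show ?thesis by simp
qed

text \<open>Each colour class has \<open>2 ^ (n - 1)\<close> vertices, more than are forbidden. Most
  later calls forbid at most four vertices in a cube of dimension at least 4, whence the recurring
  bound 8.\<close>

lemma pick_col:
  assumes "subcube n Q" "finite X" "card X < 2 ^ (n - 1)" "0 < n"
  shows "\<exists>c\<in>Q. col c = k \<and> c \<notin> X"
proof (rule ccontr)
  assume "\<not> ?thesis"
  then have "{x \<in> Q. col x = k} \<subseteq> X" by auto
  then have "card {x \<in> Q. col x = k} \<le> card X" using assms(2) card_mono by auto
  moreover have "card {x \<in> Q. col x = k} = 2 ^ (n - 1)"
    using card_subcube_col[of "n - 1"] assms(1,4) by simp
  ultimately show False using assms(3) by simp
qed

lemma pick_nbr:
  assumes "subcube n Q" "x \<in> Q" "finite X" "card X < n"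
  shows "\<exists>i. dir Q i \<and> flip i x \<in> Q \<and> flip i x \<notin> X"
proof (rule ccontr)
  assume "\<not> ?thesis"
  then have "(\<lambda>i. flip i x) ` {i. dir Q i} \<subseteq> X" using assms(2) by (auto simp: dir_def)
  then have "card ((\<lambda>i. flip i x) ` {i. dir Q i}) \<le> card X" using assms(3) card_mono by auto
  moreover have "card ((\<lambda>i. flip i x) ` {i. dir Q i}) = n"
    using subcube_dirs[OF assms(1)] by (simp add: card_image inj_on_def)
  ultimately show False using assms(4) by simp
qed

text \<open>A direction \<open>i\<close> separates the ends. The path goes through the half of
  \<open>a\<close> to a neighbour of \<open>a\<close> and crosses; the landing point has the colour
  of \<open>a\<close> again, so the induction hypothesis also covers the other half.\<close>

lemma havel:
  assumes "subcube n Q" "a \<in> Q" "b \<in> Q" "col a \<noteq> col b"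
  shows "\<exists>E. ham_path Q E a b"
  using assms
proof (induction n arbitrary: Q a b)
  case 0
  then show ?case using subcube_0 by fastforce
next
  case (Suc n)
  then obtain i where i: "dir Q i" "(i \<in> supp a) \<noteq> (i \<in> supp b)"
    using subcube_eqI by metis
  define A where "A = half Q i (i \<in> supp a)"
  define B where "B = half Q i (i \<notin> supp a)"
  have sub: "subcube n A" "subcube n B" unfolding A_def B_def using subcube_half Suc.prems i by auto
  have ab: "a \<in> A" "b \<in> B" using Suc.prems i by (auto simp: A_def B_def half_def)
  have Q: "Q = A \<union> B" "A \<inter> B = {}" using half_Un[of Q i "i \<in> supp a"] by (auto simp: A_def B_def)
  show ?case
  proof (cases "n = 0")
    case True
    \<comment> \<open>The halves are single vertices, and \<open>a\<close> has no neighbour in its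
      half to leave from.\<close>
    then have "A = {a}" "B = {b}" using sub ab card_subcube[OF sub(1)] card_subcube[OF sub(2)]
      by (auto simp: card_1_singleton_iff)
    moreover have "flip i a \<in> B" using i Suc.prems
      by (auto simp: B_def half_def dir_flip mem_flip)
    ultimately have "b = flip i a" by simp
    then have "ham_path Q (insert {a, b} ({} \<union> {})) a b"
      using ham_path_join[OF ham_path_single ham_path_single, of a b] Q \<open>A = {a}\<close> \<open>B = {b}\<close>
        by (simp add: insert_commute)
    then show ?thesis by blast
  next
    case False
    then obtain j where j: "dir A j" "flip j a \<in> A" using pick_nbr[OF sub(1) ab(1), of "{}"] by auto
    then have c: "flip i (flip j a) \<in> B" "col (flip j a) \<noteq> col a" "col (flip i (flip j a)) = col a"
      using j i by (auto simp: A_def B_def half_def dir_flip mem_flip)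
    obtain E where "ham_path A E a (flip j a)" using Suc.IH[OF sub(1) ab(1) j(2)] c by auto
    moreover obtain E' where "ham_path B E' (flip i (flip j a)) b"
      using Suc.IH[OF sub(2) c(1) ab(2)] c Suc.prems by auto
    ultimately show ?thesis using ham_path_join Q by (metis adj_flip(1))
  qed
qed

section \<open>Certificates for small cubes\<close>

fun flip_code :: "nat \<Rightarrow> bool list \<Rightarrow> bool list" where
  "flip_code k [] = []"
| "flip_code 0 (x # c) = (\<not> x) # c"
| "flip_code (Suc k) (x # c) = x # flip_code k c"

fun walk :: "bool list \<Rightarrow> nat list \<Rightarrow> bool list list" where
  "walk c [] = [c]"
| "walk c (k # ks) = c # walk (flip_code k c) ks"

text \<open>
  A certificate lists the directions of the successive steps. A direction outside the cube leaves a
  code unchanged, which is excluded by distinctness.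
\<close>

definition path_cert :: "nat \<Rightarrow> bool list list \<Rightarrow> bool list \<Rightarrow> bool list \<Rightarrow> nat list \<Rightarrow> bool" where
  "path_cert d F a b ks \<longleftrightarrow> (let w = walk a ks in
     last w = b \<and> length w + length F = 2 ^ d \<and> distinct (w @ F))"

text \<open>The first step of a closed walk is split off; the rest is a path back to the start.\<close>

fun cycle_cert :: "nat \<Rightarrow> bool list list \<Rightarrow> bool list \<Rightarrow> nat list \<Rightarrow> bool" where
  "cycle_cert d F a (k # ks) \<longleftrightarrow> 3 \<le> Suc (length ks) \<and> path_cert d F (flip_code k a) a ks"
| "cycle_cert d F a [] \<longleftrightarrow> False"

definition odd_codes :: "nat \<Rightarrow> bool list list" where
  "odd_codes d = filter (\<lambda>c. odd (length (filter id c))) (List.n_lists d [False, True])"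

definition even_codes :: "nat \<Rightarrow> bool list list" where
  "even_codes d = filter (\<lambda>c. even (length (filter id c))) (List.n_lists d [False, True])"

text \<open>Only sublists in the order of \<open>xs\<close> are formed, so that a set of green
  faults is tested once and not in all its orders.\<close>

fun combs :: "nat \<Rightarrow> 'a list \<Rightarrow> 'a list list" where
  "combs 0 xs = [[]]"
| "combs (Suc k) [] = []"
| "combs (Suc k) (x # xs) = map ((#) x) (combs k xs) @ combs (Suc k) xs"

lemma combs_subset:
  "A \<subseteq> set xs \<Longrightarrow> finite A \<Longrightarrow> card A = k \<Longrightarrow> \<exists>ys \<in> set (combs k xs). set ys = A \<and> length ys = k"
proof (induction k xs arbitrary: A rule: combs.induct)
  case (3 k x xs)
  show ?case
  proof (cases "x \<in> A")
    case True
    then have "A - {x} \<subseteq> set xs" "card (A - {x}) = k" using 3 by auto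
    then obtain ys where "ys \<in> set (combs k xs)" "set ys = A - {x}" "length ys = k"
      using "3.IH"(1) "3.prems"(2) by (metis finite_Diff)
    then show ?thesis using True by (intro bexI[of _ "x # ys"]) auto
  next
    case False
    then have "A \<subseteq> set xs" using 3 by auto
    then obtain ys where "ys \<in> set (combs (Suc k) xs)" "set ys = A" "length ys = Suc k"
      using "3.IH"(2) "3.prems"(2,3) by metis
    then show ?thesis by (intro bexI[of _ ys]) auto
  qed
qed auto

lemma length_flip_code [simp]: "length (flip_code k c) = length c"
  by (induction k c rule: flip_code.induct) auto

lemma flip_code_nth:
  "j < length c \<Longrightarrow> flip_code k c ! j = ((c ! j) \<noteq> (j = k))"
  by (induction k c arbitrary: j rule: flip_code.induct) (auto simp: nth_Cons split: nat.splits)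

lemma flip_code_id: "length c \<le> k \<Longrightarrow> flip_code k c = c"
  by (induction k c rule: flip_code.induct) auto

lemma walk_facts: "walk c ks \<noteq> [] \<and> hd (walk c ks) = c \<and> (\<forall>x \<in> set (walk c ks). length x = length
    c)"
  by (induction c ks rule: walk.induct) auto

lemma walk_successively: "successively (\<lambda>x y. \<exists>k. y = flip_code k x) (walk c ks)"
proof (induction c ks rule: walk.induct)
  case (2 c k ks)
  then show ?case using walk_facts[of "flip_code k c" ks] by (auto simp: successively_Cons)
qed simp

text \<open>Coordinates relative to a base vertex \<open>v\<close>, in the order \<open>ds\<close>.
  Choosing \<open>v\<close> and \<open>ds\<close> is the whole passage to a normal position; no
  automorphism of the cube has to be formed.\<close>

definition code :: "vertex \<Rightarrow> nat list \<Rightarrow> vertex \<Rightarrow> bool list" where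
  "code v ds x = map (\<lambda>i. (i \<in> supp x) \<noteq> (i \<in> supp v)) ds"

lemma code_bij:
  assumes "subcube d Q" "distinct ds" "set ds = {i. dir Q i}"
  shows "bij_betw (code v ds) Q {c. length c = d}"
proof -
  have len: "length ds = d" using assms subcube_dirs[OF assms(1)] by (metis distinct_card)
  have inj: "inj_on (code v ds) Q"
  proof
    fix x y assume xy: "x \<in> Q" "y \<in> Q" "code v ds x = code v ds y"
    then have "\<forall>i. dir Q i \<longrightarrow> (i \<in> supp x) = (i \<in> supp y)" using assms(3) by (auto simp: code_def)
    then show "x = y" using subcube_eqI[OF _ assms(1) xy(1,2)] by blast
  qed
  have fin: "finite {c :: bool list. length c = d}" "card {c :: bool list. length c = d} = 2 ^ d"
    using finite_lists_length_eq[of "UNIV :: bool set" d] card_lists_length_eq[of "UNIV :: bool set"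
      d] by auto
  moreover have "code v ds ` Q \<subseteq> {c. length c = d}" using len by (auto simp: code_def)
  moreover have "card (code v ds ` Q) = 2 ^ d" using card_image[OF inj] card_subcube[OF assms(1)]
    by simp
  ultimately show ?thesis using inj by (simp add: bij_betw_def card_subset_eq)
qed

lemma code_flip:
  assumes "distinct ds" "k < length ds"
  shows "code v ds (flip (ds ! k) x) = flip_code k (code v ds x)"
proof (rule nth_equalityI)
  fix j assume "j < length (code v ds (flip (ds ! k) x))"
  then have "j < length ds" by (simp add: code_def)
  then show "code v ds (flip (ds ! k) x) ! j = flip_code k (code v ds x) ! j"
    using assms by (subst flip_code_nth) (auto simp: code_def mem_flip nth_eq_iff_index_eq)
qed (simp add: code_def)

text \<open>The size of a symmetric difference is congruent modulo 2 to the sum of both sizes; equal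
  colour thus means even distance.\<close>

lemma col_symdiff:
  assumes "finite D" "\<And>i. i \<in> D \<longleftrightarrow> (i \<in> supp x) \<noteq> (i \<in> supp v)"
  shows "col x = (col v = even (card D))"
proof -
  have D: "D = (supp x - supp v) \<union> (supp v - supp x)" using assms(2) by auto
  have x: "card (supp x) = card (supp x - supp v) + card (supp x \<inter> supp v)"
    by (subst card_Un_disjoint[symmetric]) (auto intro: arg_cong[of _ _ card])
  have v: "card (supp v) = card (supp v - supp x) + card (supp x \<inter> supp v)"
    by (subst card_Un_disjoint[symmetric]) (auto intro: arg_cong[of _ _ card])
  have "card D = card (supp x - supp v) + card (supp v - supp x)"
    unfolding D by (intro card_Un_disjoint) auto
  then show ?thesis unfolding col_def x v by presburger
qed

lemma code_col:
  assumes "subcube d Q" "distinct ds" "set ds = {i. dir Q i}" "x \<in> Q" "v \<in> Q"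
  shows "col x = (col v = even (length (filter id (code v ds x))))"
proof -
  define D where "D = {i \<in> set ds. (i \<in> supp x) \<noteq> (i \<in> supp v)}"
  have "i \<in> D \<longleftrightarrow> (i \<in> supp x) \<noteq> (i \<in> supp v)" for i
    using subcube_sep[OF assms(1,4,5), of i] assms(3) by (auto simp: D_def)
  moreover have "length (filter id (code v ds x)) = card D"
  proof -
    have "length (filter id (code v ds x)) = length (filter (\<lambda>i. (i \<in> supp x) \<noteq> (i \<in> supp v)) ds)"
      by (simp add: code_def filter_map comp_def)
    also have "\<dots> = card (set (filter (\<lambda>i. (i \<in> supp x) \<noteq> (i \<in> supp v)) ds))"
      using assms(2) by (intro distinct_card[symmetric]) simp
    also have "\<dots> = card D" by (simp add: D_def)
    finally show ?thesis .
  qed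
  moreover have "finite D" by (simp add: D_def)
  ultimately show ?thesis using col_symdiff[of D x v] by presburger
qed

lemma code_mem:
  assumes "subcube d Q" "distinct ds" "set ds = {i. dir Q i}" "x \<in> Q" "v \<in> Q"
  shows "col x = col v \<Longrightarrow> code v ds x \<in> set (even_codes d)"
    and "col x \<noteq> col v \<Longrightarrow> code v ds x \<in> set (odd_codes d)"
proof -
  have "code v ds x \<in> set (List.n_lists d [False, True])"
    using bij_betw_apply[OF code_bij[OF assms(1-3)] assms(4), of v] by (auto simp: set_n_lists)
  then show "col x = col v \<Longrightarrow> code v ds x \<in> set (even_codes d)"
    and "col x \<noteq> col v \<Longrightarrow> code v ds x \<in> set (odd_codes d)"
    using code_col[OF assms] by (auto simp: even_codes_def odd_codes_def)
qed

text \<open>Walk and faults are disjoint, free of repetitions, and together as numerous as the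
  vertices of the cube. Hence the walk covers exactly the remaining vertices, and no coverage test
  is evaluated.\<close>

lemma path_cert_sound:
  assumes Q: "subcube d Q" "distinct ds" "set ds = {i. dir Q i}"
    and "set fs \<subseteq> Q" "a \<in> Q" "b \<in> Q"
      "path_cert d (map (code v ds) fs) (code v ds a) (code v ds b) ks"
  shows "\<exists>E. ham_path (Q - set fs) E a b"
proof -
  let ?C = "{c :: bool list. length c = d}"
  define f where "f = code v ds"
  define g where "g = inv_into Q f"
  define w where "w = walk (f a) ks"
  have bij: "bij_betw f Q ?C" using code_bij[OF Q] by (simp add: f_def)
  have fin: "finite ?C" "card ?C = 2 ^ d"
    using finite_lists_length_eq[of "UNIV :: bool set" d] card_lists_length_eq[of "UNIV :: bool set"
      d] by auto
  have gf: "x \<in> Q \<Longrightarrow> g (f x) = x" for x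
    unfolding g_def using bij bij_betw_inv_into_left by metis
  have fg: "c \<in> ?C \<Longrightarrow> f (g c) = c \<and> g c \<in> Q" for c
    unfolding g_def using bij by (metis bij_betw_inv_into_right bij_betw_inv_into bij_betw_apply)
  have len: "length (f x) = d" if "x \<in> Q" for x using bij that bij_betw_apply by fastforce
  have cert: "last w = f b" "length w + length fs = 2 ^ d" "distinct (w @ map f fs)"
    using assms(7) by (simp_all add: path_cert_def f_def w_def Let_def)
  have w: "w \<noteq> []" "hd w = f a" "set w \<subseteq> ?C"
    using walk_facts[of "f a" ks] len[OF assms(5)] by (auto simp: w_def)
  have fC: "set (map f fs) \<subseteq> ?C" using assms(4) len by auto
  have "card (set (w @ map f fs)) = card ?C" using cert(2,3) fin(2)
    by (metis distinct_card length_append length_map)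
  then have all: "set (w @ map f fs) = ?C"
    using fC w(3) fin(1) by (intro card_subset_eq) auto
  have "set (map g w) = Q - set fs"
  proof (intro equalityI subsetI)
    fix x assume "x \<in> set (map g w)"
    then obtain c where c: "c \<in> set w" "x = g c" by auto
    then have "f x = c" "x \<in> Q" using fg w(3) by auto
    moreover have "c \<notin> f ` set fs" using cert(3) c(1) by auto
    ultimately show "x \<in> Q - set fs" by auto
  next
    fix x assume x: "x \<in> Q - set fs"
    then have "f x \<in> set (w @ map f fs)" using all len by auto
    moreover have "f x \<notin> f ` set fs" using x assms(4) bij
      by (metis Diff_iff bij_betw_def inj_on_image_mem_iff)
    ultimately show "x \<in> set (map g w)" using gf x by force
  qed
  moreover have "inj_on g (set w)" using fg w(3) by (intro inj_on_inverseI[of _ f]) auto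
  then have "distinct (map g w)" using cert(3) by (simp add: distinct_map)
  moreover have "successively adj (map g w)"
  proof -
    have "successively (\<lambda>x y. \<exists>k. y = flip_code k x) w" by (simp add: w_def walk_successively)
    moreover have "distinct w" using cert(3) by simp
    ultimately have "successively (\<lambda>x y. adj (g x) (g y)) w" using w(3)
    proof (induction w)
      case (Cons x w)
      show ?case
      proof (cases "w = []")
        case False
        then obtain k where k: "hd w = flip_code k x" using Cons.prems
          by (auto simp: successively_Cons)
        have x: "x \<in> ?C" "hd w \<in> ?C" "hd w \<noteq> x" using Cons.prems hd_in_set[OF False] by auto
        have "length ds = d" using Q subcube_dirs[OF Q(1)] by (metis distinct_card)
        \<comment> \<open>A direction beyond the cube would repeat the current vertex, against
          distinctness.\<close>
        have "k < d" using k x flip_code_id[of x k] by (cases "k < d") auto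
        then have "f (flip (ds ! k) (g x)) = hd w"
          using code_flip[OF Q(2), of k v "g x"] fg[OF x(1)] \<open>length ds = d\<close> k by (simp add: f_def)
        moreover have "flip (ds ! k) (g x) \<in> Q"
          using Q(3) fg[OF x(1)] \<open>k < d\<close> \<open>length ds = d\<close> by (metis dir_flip mem_Collect_eq nth_mem)
        ultimately have "g (hd w) = flip (ds ! k) (g x)" using gf by metis
        then have "adj (g x) (g (hd w))" by simp
        then show ?thesis using Cons False by (auto simp: successively_Cons)
      qed simp
    qed simp
    then show ?thesis by (simp add: successively_map)
  qed
  ultimately show ?thesis
    unfolding ham_path_def using w cert(1) gf assms(5,6)
    by (intro exI[of _ "edges (map g w)"] exI[of _ "map g w"]) (simp add: hd_map last_map)
qed

lemma cycle_cert_sound: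
  assumes Q: "subcube d Q" "distinct ds" "set ds = {i. dir Q i}"
    and "set fs \<subseteq> Q" "length c = d" "cycle_cert d (map (code v ds) fs) c ks"
  shows "\<exists>E. ham_cycle (Q - set fs) E"
proof -
  obtain k ks' where ks: "ks = k # ks'" "2 \<le> length ks'"
    "path_cert d (map (code v ds) fs) (flip_code k c) c ks'"
    using assms(6) by (cases ks) auto
  have surj: "\<exists>x\<in>Q. code v ds x = c" if "length c = d" for c
  proof -
    have "c \<in> code v ds ` Q" using bij_betw_imp_surj_on[OF code_bij[OF Q, of v]] that by simp
    then show ?thesis by auto
  qed
  obtain a where a: "a \<in> Q" "code v ds a = c" using surj assms(5) by auto
  obtain b where b: "b \<in> Q" "code v ds b = flip_code k c" using surj[of "flip_code k c"] assms(5)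
    by auto
  obtain E where E: "ham_path (Q - set fs) E b a"
    using path_cert_sound[OF Q assms(4) b(1) a(1), of v ks'] ks a b by auto
  define w where "w = walk (flip_code k c) ks'"
  have len: "length (walk c ks) = Suc (length ks)" for c ks
    by (induction c ks rule: walk.induct) auto
  have w: "last w = c" "hd w = flip_code k c" "distinct w" "3 \<le> length w"
    "length w + length fs = 2 ^ d"
    using ks len[of "flip_code k c" ks'] walk_facts[of "flip_code k c" ks']
    by (auto simp: path_cert_def w_def Let_def)
  \<comment> \<open>\<open>w\<close> is distinct, has at least three entries and leads from
    \<open>flip_code k c\<close> to \<open>c\<close>; so the step that was split off is a genuine
    one.\<close>
  have "flip_code k c \<noteq> c" using w by (cases w) (auto split: if_splits)
  then have "k < d" using flip_code_id assms(5) leI by metis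
  have "length ds = d" using Q subcube_dirs[OF Q(1)] by (metis distinct_card)
  then have "code v ds (flip (ds ! k) a) = code v ds b" "flip (ds ! k) a \<in> Q"
    using code_flip[OF Q(2), of k v a] a b \<open>k < d\<close> Q(3)
    by (auto simp: dir_flip) (metis dir_flip mem_Collect_eq nth_mem)
  then have "b = flip (ds ! k) a"
    using code_bij[OF Q, of v] b(1) by (metis bij_betw_def inj_onD)
  then have "adj b a" by simp
  moreover have "3 \<le> card (Q - set fs)"
  proof -
    have "card (Q - set fs) \<ge> card Q - card (set fs)" by (rule diff_card_le_card_Diff) simp
    then show ?thesis using card_length[of fs] w(4,5) card_subcube[OF Q(1)] by linarith
  qed
  ultimately show ?thesis using E unfolding ham_cycle_def by blast
qed

lemma code_append: "code v (xs @ ys) x = code v xs x @ code v ys x"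
  by (simp add: code_def)

lemma code_replicate:
  "(\<And>i. i \<in> set xs \<Longrightarrow> ((i \<in> supp x) \<noteq> (i \<in> supp v)) = t) \<Longrightarrow> code v xs x = replicate (length xs) t"
  by (rule nth_equalityI) (auto simp: code_def)

lemma code_inj:
  assumes "subcube d Q" "distinct ds" "set ds = {i. dir Q i}" "x \<in> Q" "y \<in> Q" "x \<noteq> y"
  shows "code v ds x \<noteq> code v ds y"
  using code_bij[OF assms(1-3), of v] assms(4-6) by (metis bij_betw_def inj_onD)

text \<open>Faults are given as a set, but a table is searched by lists; \<open>hs\<close> arranges
  \<open>G\<close> in the order used by the enumeration.\<close>

lemma code_combs:
  assumes Q: "subcube d Q" "distinct ds" "set ds = {i. dir Q i}" "v \<in> Q"
    and G: "finite G" "G \<subseteq> Q" "\<And>g. g \<in> G \<Longrightarrow> col g \<noteq> col v"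
  shows "\<exists>hs. set hs = G \<and> length hs = card G \<and>
    map (code v ds) hs \<in> set (combs (card G) (odd_codes d))"
proof -
  have inj: "inj_on (code v ds) G"
    using code_bij[OF Q(1-3), of v] G(2) by (metis bij_betw_def inj_on_subset)
  have "code v ds ` G \<subseteq> set (odd_codes d)" using code_mem(2)[OF Q(1-3) _ Q(4)] G(2,3) by blast
  then obtain ys where ys: "ys \<in> set (combs (card G) (odd_codes d))" "set ys = code v ds ` G"
    "length ys = card G"
    using combs_subset[of "code v ds ` G"] G(1) card_image[OF inj] by (metis finite_imageI)
  define hs where "hs = map (inv_into G (code v ds)) ys"
  have "map (code v ds) hs = ys" unfolding hs_def map_map
    by (rule map_idI) (use ys(2) in \<open>auto simp: f_inv_into_f\<close>)
  moreover have "set hs = G" unfolding hs_def using ys(2) inj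
    by (auto simp: inv_into_f_f image_image)
  ultimately show ?thesis using ys by (metis length_map)
qed

lemma list_all2_cert: "list_all2 P xs ys \<Longrightarrow> x \<in> set xs \<Longrightarrow> \<exists>y. P x y"
  by (metis in_set_conv_nth list_all2_nthD)

text \<open>
  The fault sets that are \<open>balanced\<close> in this sense are those with a direction splitting them into
  neutral parts of mass 2 and 4; they need no certificate. The entries of the tables below follow the
  order of the enumeration in front of them.
\<close>

definition balanced :: "nat \<Rightarrow> bool list list \<Rightarrow> bool list list \<Rightarrow> bool" where
  "balanced d R G \<longleftrightarrow> (\<exists>k\<in>set [0..<d]. let m = length (filter (\<lambda>c. c ! k) R) in
     m \<in> {1, 2} \<and> length (filter (\<lambda>c. c ! k) G) = m)"

text \<open>Faults of different colour in dimension 4 are at distance 1 or 3. One is the base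
  vertex, the directions in which they differ come first, and \<open>a\<close> has the colour of the
  base, hence an even code. The numerals in the names of the tables are the codes of the normalised
  faults other than the base, read in binary with the first entry lowest.\<close>

lemma two_fault_certs_1:
  "list_all2 (\<lambda>(a, b). path_cert 4 [[False, False, False, False], [True, False, False, False]] a b)
    (List.product (filter (\<lambda>c. c \<noteq> [False, False, False, False]) (even_codes 4)) (filter (\<lambda>c. c \<noteq>
      [True, False, False, False]) (odd_codes 4)))
  [
   [2,1,0,1,3,0,1,0,2,0,1,0,3],[0,2,0,1,3,1,0,2,0,1,0,2,3],[0,2,1,0,3,0,1,2,1,0,1,2,3],
   [0,2,0,1,0,3,0,1,0,2,0,1,0],[0,2,0,1,0,3,0,1,0,2,1,0,1],[0,2,0,1,0,3,1,0,2,0,1,0,2],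
   [0,2,0,1,0,3,0,1,2,1,0,1,2],[0,1,0,2,3,1,0,2,0,1,0,2,3],[1,2,0,2,3,0,1,2,1,0,1,2,3],
   [0,1,2,0,3,0,1,0,2,0,1,0,3],[0,1,0,2,0,3,0,1,2,1,0,1,2],[0,1,0,2,0,3,1,0,2,0,1,0,2],
   [0,1,0,2,0,3,0,1,0,2,1,0,1],[0,1,0,2,0,3,0,1,0,2,0,1,0],[1,0,1,2,3,1,0,2,0,1,0,2,3],
   [2,0,2,1,3,1,0,2,0,1,0,2,3],[1,0,3,0,1,0,2,1,0,1,3,0,2],[1,0,1,2,0,3,0,1,2,1,0,1,2],
   [1,0,1,2,0,3,1,0,2,0,1,0,2],[1,0,1,2,0,3,0,1,0,2,1,0,1],[1,0,1,2,0,3,0,1,0,2,0,1,0],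
   [0,1,0,3,2,1,0,3,0,1,0,3,2],[0,1,0,3,0,2,0,1,3,1,0,1,3],[0,1,0,3,0,2,1,0,3,0,1,0,3],
   [1,3,0,3,2,0,1,3,1,0,1,3,2],[0,1,3,0,2,0,1,0,3,0,1,0,2],[0,1,0,3,0,2,0,1,0,3,1,0,1],
   [0,1,0,3,0,2,0,1,0,3,0,1,0],[1,0,1,3,2,1,0,3,0,1,0,3,2],[1,0,1,3,0,2,0,1,3,1,0,1,3],
   [1,0,1,3,0,2,1,0,3,0,1,0,3],[3,0,3,1,2,1,0,3,0,1,0,3,2],[1,0,2,0,1,0,3,1,0,1,2,0,3],
   [1,0,1,3,0,2,0,1,0,3,1,0,1],[1,0,1,3,0,2,0,1,0,3,0,1,0],[2,0,2,3,0,1,0,2,3,2,0,2,3],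
   [2,0,2,3,1,2,0,3,0,2,0,3,1],[2,0,2,3,0,1,2,0,3,0,2,0,3],[3,0,3,2,1,2,0,3,0,2,0,3,1],
   [2,0,2,3,0,1,0,2,0,3,2,0,2],[2,0,1,0,2,0,3,2,0,2,1,0,3],[2,0,2,3,0,1,0,2,0,3,0,2,0],
   [0,1,0,2,0,1,0,3,2,1,0,1,2],[0,1,0,2,0,1,0,3,0,2,0,1,0],[0,1,0,2,0,1,0,3,0,2,1,0,1],
   [0,1,0,2,1,3,2,1,0,1,2,3,1],[0,1,0,2,0,1,3,2,1,0,1,2,3],[0,1,2,0,1,0,3,0,2,0,1,0,3],
   [1,2,0,2,3,0,1,0,2,0,3,0,2]
  ]"
  by code_simp

lemma two_fault_certs_7:
  "list_all2 (\<lambda>(a, b). path_cert 4 [[False, False, False, False], [True, True, True, False]] a b)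
    (List.product (filter (\<lambda>c. c \<noteq> [False, False, False, False]) (even_codes 4)) (filter (\<lambda>c. c \<noteq>
      [True, True, True, False]) (odd_codes 4)))
  [
   [0,2,1,0,3,0,1,0,2,0,1,0,3],[1,2,0,1,3,0,1,0,2,0,1,0,3],[0,2,3,0,2,0,1,0,3,2,3,0,3],
   [0,2,1,0,2,3,1,0,2,0,1,0,2],[0,2,1,0,2,3,0,1,2,1,0,1,2],[0,2,1,0,2,3,0,1,0,2,0,1,0],
   [0,2,1,0,2,3,0,1,0,2,1,0,1],[0,1,2,0,3,0,1,2,1,0,1,2,3],[0,1,3,0,1,0,2,0,3,1,3,0,3],
   [2,1,0,2,3,0,1,2,1,0,1,2,3],[0,1,2,0,1,3,1,0,2,0,1,0,2],[0,1,2,0,1,3,0,1,2,1,0,1,2],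
   [0,1,2,0,1,3,0,1,0,2,0,1,0],[0,1,2,0,1,3,0,1,0,2,1,0,1],[1,0,3,0,1,0,2,1,0,1,3,0,1],
   [1,0,2,1,3,1,0,2,0,1,0,2,3],[2,0,1,2,3,1,0,2,0,1,0,2,3],[1,0,2,1,0,3,0,1,2,1,0,1,2],
   [1,0,2,1,0,3,1,0,2,0,1,0,2],[1,0,2,1,0,3,0,1,0,2,1,0,1],[1,0,2,1,0,3,0,1,0,2,0,1,0],
   [0,1,0,2,0,1,0,3,0,1,2,0,1],[0,1,0,2,0,3,1,3,0,3,2,1,0],[0,1,0,2,0,1,0,3,2,1,0,2,1],
   [3,1,0,2,1,0,3,0,1,0,2,0,1],[0,1,3,0,1,2,0,1,3,1,0,1,2],[0,1,0,2,0,1,3,1,2,0,1,2,3],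
   [0,1,0,2,1,0,3,0,2,1,0,2,3],[1,0,1,2,0,1,0,3,0,1,2,0,1],[1,0,1,2,0,3,1,3,0,3,2,1,0],
   [1,0,1,2,0,1,0,3,2,1,0,2,1],[3,0,1,2,0,1,3,0,2,1,2,0,2],[1,0,3,1,0,2,1,0,3,0,1,0,2],
   [1,0,1,2,0,1,3,1,2,0,1,2,3],[1,0,1,2,1,0,3,0,2,1,0,2,3],[2,0,2,1,0,2,0,3,0,2,1,0,2],
   [2,0,2,1,0,2,0,3,1,2,0,1,2],[2,0,2,1,0,3,2,3,0,3,1,2,0],[3,0,2,1,0,2,3,0,1,2,1,0,1],
   [2,0,2,1,0,2,3,2,1,0,2,1,3],[2,0,3,1,0,3,0,2,0,3,1,0,3],[2,0,2,1,2,0,3,0,1,2,0,1,3],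
   [0,3,1,0,3,0,2,0,1,0,3,0,1],[0,3,1,0,2,1,3,1,2,0,2,1,3],[0,3,2,0,1,2,3,2,1,0,1,2,3],
   [0,3,1,0,2,1,0,3,0,1,2,0,2],[0,3,1,0,2,1,0,3,1,2,0,2,1],[0,3,1,0,2,1,0,3,0,1,0,2,0],
   [1,3,0,1,2,0,1,3,1,0,1,2,1]
  ]"
  by code_simp

text \<open>Different faults of equal colour in dimension 4 are at distance 2 or 4. The start has an
  even code and is not one of the two red faults, so it is never a green fault either and serves all
  entries.\<close>

lemma four_fault_certs_3:
  "list_all2 (\<lambda>G. cycle_cert 4 ([[False, False, False, False], [True, True, False, False]] @ G)
      [True, False, True, False])
    (combs 2 (odd_codes 4))
  [
   [0,1,0,3,0,1,2,1,0,1,2,3],[1,0,2,3,0,1,0,2,1,0,1,3],[0,1,2,3,0,1,0,2,1,0,1,3],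
   [0,3,0,2,1,0,3,2,3,0,3,1],[0,1,2,3,1,0,2,0,1,0,3,1],[0,3,2,0,1,0,3,2,3,0,3,1],
   [0,1,2,3,0,1,0,2,0,1,3,1],[1,0,3,0,2,0,1,2,0,2,3,2],[0,1,3,0,2,0,1,2,0,2,3,2],
   [0,1,0,3,2,0,2,1,0,2,3,2],[0,1,0,3,0,2,1,2,0,2,3,2],[0,1,0,3,0,1,2,1,0,1,3,2],
   [0,1,0,3,2,0,1,2,0,2,3,2],[2,3,0,2,1,3,2,3,0,2,1,3],[1,0,2,3,0,2,0,1,0,2,3,2],
   [1,0,2,3,1,2,1,0,1,2,3,2],[1,0,2,3,0,2,0,1,2,0,3,2],[1,0,2,3,0,2,1,0,2,0,3,2],
   [0,1,2,3,0,2,0,1,0,2,3,2],[0,1,2,3,1,2,1,0,1,2,3,2],[0,1,2,3,0,2,0,1,2,0,3,2],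
   [0,1,2,3,0,2,1,0,2,0,3,2],[0,3,1,2,3,2,0,3,1,2,3,2],[0,3,1,0,3,0,2,3,0,1,3,2],
   [0,3,0,1,3,0,2,3,0,1,3,2],[0,3,1,0,3,0,2,3,1,0,3,2],[0,3,2,1,3,2,0,3,1,2,3,2],
   [0,3,2,1,3,2,0,3,2,1,3,2]
  ]"
  by code_simp

lemma four_fault_certs_15:
  "list_all2 (\<lambda>G. cycle_cert 4 ([[False, False, False, False], [True, True, True, True]] @ G) [True,
      True, False, False])
    (combs 2 (odd_codes 4))
  [
   [2,0,1,0,3,0,1,2,1,0,1,3],[0,2,0,1,3,0,1,2,1,0,1,3],[0,2,1,0,3,0,1,2,1,0,1,3],
   [0,3,0,1,2,0,1,3,1,0,1,2],[0,3,1,0,2,0,1,3,1,0,1,2],[0,2,0,1,0,3,1,2,1,0,1,3],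
   [0,2,0,1,0,3,0,2,0,1,0,3],[1,2,1,0,3,1,0,2,0,1,0,3],[1,2,0,1,3,1,0,2,0,1,0,3],
   [1,3,1,0,2,1,0,3,0,1,0,2],[1,3,0,1,2,1,0,3,0,1,0,2],[1,2,0,3,2,0,1,0,2,3,0,2],
   [1,2,1,0,1,3,0,2,0,1,0,3],[0,2,3,1,0,3,2,3,0,1,0,3],[0,2,0,1,2,3,2,0,1,2,0,3],
   [0,2,0,1,3,0,1,2,1,0,3,1],[0,2,0,1,2,3,0,2,1,2,0,3],[0,2,0,1,2,3,2,0,2,1,0,3],
   [0,2,1,0,2,3,2,0,1,2,0,3],[0,2,1,0,3,0,1,2,1,0,3,1],[0,2,1,0,2,3,0,2,1,2,0,3],
   [0,2,1,0,2,3,2,0,2,1,0,3],[0,3,2,1,0,2,3,2,0,1,0,2],[0,3,0,1,3,2,0,3,1,3,0,2],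
   [0,3,0,1,2,0,3,1,0,1,2,1],[0,3,1,0,3,2,0,3,1,3,0,2],[0,3,1,0,2,0,3,1,0,1,2,1],
   [0,2,0,1,0,3,2,1,0,1,3,1]
  ]"
  by code_simp

text \<open>Each red fault is isolated by exactly one direction; the last two directions isolate
  none.\<close>

lemma six_fault_certs_3_5:
  "list_all2 (\<lambda>G. cycle_cert 5 ([[False, False, False, False, False], [True, True, False, False,
      False], [True, False, True, False, False]] @ G) [False, True, True, False, False])
    (filter (\<lambda>G. \<not> balanced 5 [[False, False, False, False, False], [True, True, False, False,
      False], [True, False, True, False, False]] G) (combs 3 (odd_codes 5)))
  [
   [0,3,1,2,1,0,1,2,1,4,0,2,1,0,2,0,3,1,2,1,0,1,2,1,4,1],
   [0,3,1,0,1,4,0,1,3,0,1,0,2,1,0,1,3,0,1,0,4,0,1,0,3,2],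
   [1,3,0,1,0,4,1,0,3,0,1,0,2,1,0,1,3,0,1,0,4,0,1,0,3,2],
   [0,3,1,2,1,0,3,4,0,1,2,1,0,1,4,3,4,0,1,2,1,0,1,2,4,3],
   [0,3,1,2,0,1,3,4,1,0,2,1,0,1,4,3,4,0,1,2,1,0,1,2,4,3],
   [0,3,2,1,0,1,3,4,0,1,0,2,4,3,1,4,1,0,2,0,1,0,2,3,0,4],
   [0,3,1,0,3,4,0,1,2,1,0,1,3,2,0,1,0,2,0,1,4,1,0,1,3,2],
   [3,0,1,0,2,1,0,1,3,4,0,1,0,2,1,0,3,0,1,2,1,0,1,2,3,4],
   [0,3,1,0,2,1,0,1,3,4,0,1,0,2,1,0,3,0,1,2,1,0,1,2,3,4],
   [0,4,1,0,2,1,0,1,4,3,0,1,0,2,1,0,4,0,1,2,1,0,1,2,4,3],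
   [0,3,1,0,1,2,0,4,0,2,1,0,2,0,4,0,3,4,0,1,0,2,1,0,1,4],
   [1,3,0,1,2,0,1,0,3,4,0,1,0,2,1,0,3,0,1,2,1,0,1,2,3,4],
   [1,4,0,1,2,0,1,0,4,3,0,1,0,2,1,0,4,0,1,2,1,0,1,2,4,3],
   [1,3,0,1,0,2,0,4,0,2,0,1,2,0,4,0,3,4,0,1,0,2,1,0,1,4],
   [0,3,1,2,3,4,0,1,0,2,1,0,1,3,0,1,0,2,0,1,0,4,2,1,3,1],
   [0,4,1,2,4,3,1,0,2,0,1,0,3,4,2,1,3,0,1,0,2,0,1,0,3,4],
   [0,3,1,0,3,4,0,1,0,2,0,3,2,0,1,0,2,0,3,0,4,3,1,0,2,3],
   [0,3,1,2,3,4,1,0,2,0,1,0,4,3,2,1,4,0,1,0,2,0,1,0,4,3],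
   [0,3,1,2,3,4,0,1,0,3,1,0,4,1,2,1,3,4,0,1,3,1,0,1,3,4],
   [0,3,2,0,1,0,3,4,0,1,0,2,1,0,1,3,0,1,2,1,0,1,2,4,3,1],
   [0,3,2,0,1,0,3,4,0,1,0,2,1,0,4,3,4,0,1,2,1,0,1,2,4,3],
   [0,3,1,0,3,4,2,0,4,3,0,1,0,4,1,0,1,3,0,2,3,1,0,1,3,4],
   [0,3,1,0,2,1,0,1,3,4,0,1,0,2,1,3,1,0,2,0,1,0,2,3,4,1],
   [0,3,1,0,3,4,0,3,1,0,2,4,0,4,1,0,4,0,3,4,0,1,0,2,0,4],
   [0,3,1,0,3,4,0,1,2,0,1,0,4,3,0,1,0,4,0,1,0,2,0,1,3,4],
   [0,4,1,2,4,3,0,1,0,2,1,0,1,4,0,1,0,2,0,1,0,3,2,1,4,1],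
   [0,3,1,0,3,4,0,1,0,2,0,1,4,3,0,1,0,4,1,0,2,0,1,0,4,3],
   [0,4,1,2,4,3,0,1,0,4,1,0,3,1,2,1,4,3,0,1,4,1,0,1,4,3],
   [0,4,2,0,1,0,4,3,0,1,0,2,1,0,1,4,0,1,2,1,0,1,2,3,4,1],
   [0,4,1,0,4,3,0,4,1,0,2,3,0,3,1,0,3,0,4,3,0,1,0,2,0,3],
   [0,4,1,0,4,3,0,1,2,0,1,0,3,4,0,1,0,3,0,1,0,2,0,1,4,3],
   [0,3,1,2,3,4,0,1,0,3,4,0,1,4,2,0,1,0,4,1,3,4,0,1,0,4],
   [0,3,1,4,3,1,2,0,1,0,4,3,1,4,1,0,1,2,3,1,4,3,2,1,2,3],
   [2,3,0,2,1,0,2,0,3,4,0,1,0,2,1,0,3,0,1,2,1,0,1,2,3,4],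
   [2,4,0,2,1,0,2,0,4,3,0,1,0,2,1,0,4,0,1,2,1,0,1,2,4,3],
   [2,3,0,2,0,1,0,4,0,1,0,2,1,0,4,0,3,4,0,1,0,2,1,0,1,4],
   [0,3,2,1,3,4,0,2,0,1,2,0,2,3,0,1,2,1,0,1,2,4,1,2,3,2],
   [0,4,2,1,4,3,1,0,3,4,1,2,1,3,2,0,1,0,2,0,1,4,1,0,1,3],
   [0,3,1,0,1,2,0,1,3,4,0,2,0,3,2,0,1,0,2,0,3,0,2,0,4,2],
   [0,3,1,0,2,0,3,4,0,2,0,1,2,0,2,3,0,1,0,2,0,1,0,4,3,2],
   [0,3,1,0,1,2,1,0,3,4,0,2,0,1,2,3,1,0,2,0,1,0,2,3,4,2],
   [0,3,2,1,3,4,1,0,4,3,1,2,1,4,2,0,1,0,2,0,1,3,1,0,1,4],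
   [0,3,2,1,3,4,0,2,0,3,2,0,4,2,1,2,3,4,0,2,3,2,0,2,3,4],
   [0,3,1,0,2,0,3,4,0,1,4,3,0,4,0,1,0,2,0,1,0,3,1,0,1,4],
   [0,3,1,0,2,0,3,4,0,2,0,1,2,0,3,1,0,2,0,1,0,2,4,0,3,2],
   [0,3,1,0,2,1,0,1,3,4,0,3,0,1,3,2,1,0,3,0,1,0,3,2,4,2],
   [0,3,1,0,2,0,3,4,0,2,0,1,2,0,2,3,1,0,2,0,1,0,4,0,3,2],
   [0,4,2,1,4,3,0,2,0,1,2,0,2,4,0,1,2,1,0,1,2,3,1,2,4,2],
   [0,3,1,0,1,4,0,1,3,0,1,0,2,0,3,0,4,1,3,4,3,0,4,1,3,2],
   [0,4,1,0,2,0,4,3,0,2,0,1,2,0,2,4,0,1,0,2,0,1,0,3,4,2],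
   [0,4,2,1,4,3,0,2,0,4,2,0,3,2,1,2,4,3,0,2,4,2,0,2,4,3],
   [0,4,1,0,2,1,0,1,4,3,0,4,0,1,4,2,1,0,4,0,1,0,4,2,3,2],
   [0,4,1,0,2,0,4,3,0,2,0,1,2,0,2,4,1,0,2,0,1,0,3,0,4,2],
   [0,3,1,0,1,4,0,1,3,0,1,0,2,1,4,3,0,4,3,1,3,0,4,0,3,2],
   [0,3,1,0,1,4,1,0,3,0,1,0,2,0,1,0,4,3,0,4,0,1,4,0,3,2],
   [1,3,0,1,2,0,3,4,0,2,1,0,2,0,4,3,4,0,1,0,2,1,0,1,3,4],
   [1,3,0,1,0,2,0,1,3,4,0,2,0,1,2,3,1,0,2,0,1,0,2,3,4,2],
   [1,3,2,0,3,4,0,2,0,1,2,0,2,3,1,0,2,0,1,0,2,4,0,2,3,2],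
   [1,4,2,0,4,3,0,1,3,4,0,2,0,3,2,0,1,0,2,0,1,4,1,0,1,3],
   [1,3,0,1,0,2,1,0,3,4,0,2,0,1,2,3,1,2,0,2,1,2,3,2,4,2],
   [1,3,2,0,3,4,0,1,4,3,0,2,0,4,2,0,1,0,2,0,1,3,1,0,1,4],
   [1,3,2,0,3,4,0,2,0,1,2,0,2,3,1,0,2,0,1,0,4,2,0,2,3,2],
   [1,3,0,1,2,0,1,0,3,4,1,2,1,0,1,3,0,1,0,2,0,1,0,3,4,2],
   [1,3,0,1,2,0,1,0,3,4,0,2,0,1,2,3,1,0,2,0,1,0,2,3,4,2],
   [1,3,0,1,2,0,1,0,3,4,0,3,0,1,3,2,1,0,3,0,1,0,3,2,4,2],
   [1,3,0,1,2,0,1,0,3,4,0,2,0,3,2,0,1,0,2,0,3,0,2,0,4,2],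
   [1,4,0,1,2,0,4,3,0,2,1,0,2,0,3,4,3,0,1,0,2,1,0,1,4,3],
   [1,4,2,0,4,3,0,2,0,1,2,0,2,4,1,0,2,0,1,0,2,3,0,2,4,2],
   [1,3,0,1,0,4,1,0,3,1,0,1,2,0,4,3,0,4,0,1,4,0,4,3,4,2],
   [1,4,2,0,4,3,0,2,0,1,2,0,2,4,1,0,2,0,1,0,3,2,0,2,4,2],
   [1,4,0,1,2,0,1,0,4,3,0,4,0,1,4,2,1,0,4,0,1,0,4,2,3,2],
   [1,4,0,1,2,0,1,0,4,3,0,2,0,4,2,0,1,0,2,0,4,0,2,0,3,2],
   [1,3,0,1,0,4,1,0,3,0,1,0,2,1,4,3,0,4,3,1,3,0,4,0,3,2],
   [1,3,0,1,0,4,0,1,3,0,1,0,2,0,1,0,4,3,0,4,0,1,4,0,3,2],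
   [0,3,1,2,3,4,0,3,0,1,3,0,4,3,2,1,3,4,0,1,3,1,0,1,3,4],
   [0,3,2,1,3,4,0,3,0,2,3,0,4,3,1,2,3,4,0,2,3,2,0,2,3,4],
   [0,3,1,0,3,4,0,1,2,0,1,0,4,3,1,4,1,0,2,0,1,0,2,4,3,2],
   [0,3,1,0,3,4,0,1,0,3,1,0,2,0,3,0,4,3,1,0,4,0,3,0,4,2],
   [0,3,1,2,3,4,1,0,4,3,0,4,0,1,2,0,1,0,4,1,3,4,0,1,0,4],
   [0,4,1,2,4,3,1,0,3,4,1,3,0,1,2,1,4,1,0,1,3,4,3,1,3,4],
   [0,4,2,1,4,3,1,0,3,4,1,2,1,3,2,1,0,1,2,1,4,1,0,1,3,1],
   [0,4,1,0,4,3,0,1,0,4,1,0,2,0,3,0,4,3,1,0,4,0,3,0,4,2],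
   [0,3,0,1,3,4,0,1,0,3,1,0,2,1,3,1,4,3,0,1,4,1,3,1,4,2],
   [0,3,1,0,3,4,0,1,2,0,1,0,4,3,0,4,0,1,2,1,0,1,2,4,3,2],
   [0,3,1,0,3,4,0,3,1,0,3,0,2,3,0,3,1,0,4,3,4,0,4,1,3,2],
   [0,3,1,2,3,4,1,0,4,3,1,4,0,1,2,1,3,1,0,1,3,1,4,1,3,1],
   [0,3,1,2,3,4,0,1,4,3,1,4,1,0,2,1,3,1,0,1,3,1,4,1,3,1],
   [0,3,1,4,0,1,4,1,3,4,1,0,2,3,0,3,1,0,4,3,4,0,4,1,3,2],
   [0,3,1,0,3,4,0,1,2,0,1,0,4,3,0,4,0,2,1,2,0,2,4,2,3,2],
   [0,3,2,0,3,4,0,2,1,0,2,0,4,3,0,4,0,1,0,2,0,1,0,4,3,1],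
   [0,3,2,0,3,4,0,3,2,0,3,0,1,3,0,3,2,0,4,3,4,0,4,2,3,1],
   [0,3,2,1,3,4,1,0,4,3,1,2,1,4,2,1,0,1,2,1,3,1,0,1,4,1],
   [0,3,2,4,0,2,4,2,3,4,1,0,4,3,0,2,3,4,3,2,0,2,3,1,0,4],
   [0,3,2,1,3,4,0,2,4,3,2,4,2,0,1,2,3,2,0,2,3,2,4,2,3,2],
   [0,3,2,0,3,4,0,2,1,0,2,0,4,3,0,4,0,1,2,1,0,1,4,1,3,1],
   [0,3,1,0,3,4,0,1,2,0,3,2,0,1,0,2,4,0,3,4,3,1,4,0,3,2],
   [0,3,1,0,3,4,0,1,0,3,1,0,2,0,4,0,3,4,1,0,3,0,4,0,3,2],
   [0,4,1,0,4,3,0,1,2,0,1,0,3,4,0,3,0,1,2,1,0,1,2,3,4,2],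
   [0,3,1,0,3,4,0,1,0,3,0,1,2,1,4,1,3,4,0,1,3,1,4,1,3,2],
   [0,4,2,0,4,3,0,2,1,0,2,0,3,4,0,3,0,1,0,2,0,1,0,3,4,1],
   [0,3,1,0,3,4,2,0,4,3,0,1,0,4,1,0,2,0,1,0,3,0,2,0,4,2],
   [0,3,1,0,3,4,0,1,2,1,4,3,0,1,0,4,2,1,0,1,2,1,3,1,4,2],
   [0,3,1,0,3,4,0,1,2,0,1,0,4,3,0,4,0,2,0,1,0,2,4,0,3,2],
   [0,3,1,0,3,4,0,1,2,0,1,0,4,3,0,4,0,2,1,0,2,0,4,0,3,2],
   [0,3,1,0,3,4,0,1,2,0,1,0,4,3,0,4,0,2,0,1,2,0,4,0,3,2],
   [0,3,1,0,3,4,0,3,1,0,3,0,2,0,1,0,4,3,0,4,0,1,4,0,3,2],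
   [0,3,1,0,3,4,0,1,0,3,1,0,2,0,3,0,4,3,0,1,0,4,3,0,4,2],
   [0,3,1,0,3,4,0,3,2,0,3,0,4,3,0,1,0,4,0,2,3,0,2,0,4,2],
   [0,4,1,2,4,3,0,4,0,1,4,0,3,4,2,1,4,3,0,1,4,1,0,1,4,3],
   [0,4,2,1,4,3,0,4,0,2,4,0,3,4,1,2,4,3,0,2,4,2,0,2,4,3],
   [0,4,1,0,4,3,0,1,0,4,1,0,2,0,4,0,3,4,1,0,3,0,4,0,3,2],
   [0,4,0,1,4,3,0,1,0,4,1,0,2,1,4,1,3,4,0,1,3,1,4,1,3,2],
   [0,4,1,0,4,3,0,4,1,0,4,0,2,4,0,3,1,0,4,3,4,0,4,1,3,2],
   [0,4,2,0,4,3,0,4,2,0,4,0,1,4,0,3,2,0,4,3,4,0,4,2,3,1],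
   [0,4,1,0,4,3,0,4,1,0,4,0,2,0,1,0,3,4,0,3,0,1,3,0,4,2],
   [0,4,1,0,4,3,0,1,0,4,1,0,2,0,3,0,4,3,0,1,0,4,3,0,4,2],
   [0,4,1,0,4,3,0,4,2,0,3,0,4,3,0,1,0,2,0,4,2,0,3,0,4,2],
   [0,3,1,4,3,1,2,3,4,0,3,4,1,0,4,3,4,0,4,2,1,4,3,1,4,1]
  ]"
  by code_simp

text \<open>The first two red faults are at distance 4 and the third lies halfway between them,
  isolated by no direction.\<close>

lemma six_fault_certs_15_3:
  "list_all2 (\<lambda>G. cycle_cert 5 ([[False, False, False, False, False], [True, True, True, True,
      False], [True, True, False, False, False]] @ G) [True, False, True, False, False])
    (filter (\<lambda>G. \<not> balanced 5 [[False, False, False, False, False], [True, True, True, True, False],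
      [True, True, False, False, False]] G) (combs 3 (odd_codes 5)))
  [
   [0,1,0,4,0,1,0,2,1,0,3,0,2,0,4,2,0,1,0,2,4,2,0,2,4,3],
   [1,0,2,4,0,2,3,0,4,1,0,2,0,1,0,4,0,1,0,2,0,3,2,0,2,4],
   [0,1,2,3,0,1,0,2,1,4,0,3,0,1,3,2,1,0,3,0,1,0,3,2,4,3],
   [0,3,0,2,1,0,2,3,2,4,0,3,1,0,3,0,2,0,1,3,1,0,1,3,4,1],
   [0,1,0,4,0,1,0,2,0,3,2,0,1,0,2,0,3,0,4,3,2,1,2,0,2,3],
   [0,3,1,3,0,4,0,3,1,0,2,4,0,4,1,0,4,0,3,4,0,1,0,2,0,4],
   [0,3,0,2,0,1,0,4,0,1,0,2,1,0,3,1,2,0,1,0,4,2,0,4,1,4],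
   [1,0,3,1,0,4,0,3,1,0,3,0,2,3,0,3,4,0,1,0,4,0,3,0,4,2],
   [0,1,3,1,0,2,0,1,0,4,0,2,0,3,2,0,1,2,3,2,0,2,3,2,4,2],
   [0,1,0,4,0,1,0,2,0,1,0,3,2,1,4,0,1,4,1,2,1,4,0,1,3,2],
   [0,1,0,4,0,2,0,3,2,0,4,2,1,2,0,2,3,4,0,2,3,2,0,2,3,4],
   [0,3,1,3,0,4,0,1,0,3,1,0,2,3,0,3,4,0,1,0,4,0,3,0,4,2],
   [0,1,0,4,0,3,1,3,0,3,4,0,2,1,0,1,4,0,1,0,3,0,1,0,4,2],
   [2,4,1,0,4,2,3,1,0,2,0,1,0,4,0,1,0,2,0,1,0,3,0,1,0,4],
   [1,0,2,3,0,1,3,4,0,1,0,2,0,1,3,4,1,4,0,2,0,1,0,2,3,4],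
   [1,0,2,3,0,1,3,4,0,1,0,2,0,1,0,3,1,0,2,0,1,0,2,4,0,3],
   [1,0,2,3,0,1,3,4,0,2,0,1,0,2,0,3,0,1,0,2,1,0,4,1,0,3],
   [1,0,2,3,0,1,3,4,0,1,0,2,0,1,0,3,2,1,0,1,2,1,4,1,0,3],
   [1,0,2,3,2,1,2,0,2,4,1,0,2,0,1,0,3,1,0,2,0,1,0,2,4,2],
   [1,0,2,3,0,1,0,2,4,0,1,0,2,0,1,0,3,1,0,2,0,1,0,2,4,2],
   [1,0,2,3,0,1,0,2,1,4,0,2,1,0,2,0,3,0,1,0,2,0,1,0,4,2],
   [1,0,2,3,0,1,0,2,1,4,0,1,2,0,1,0,3,0,1,2,1,0,1,2,4,2],
   [1,0,2,3,0,1,0,2,0,4,0,2,1,0,2,0,3,0,2,0,1,2,0,2,4,2],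
   [1,0,2,3,0,1,0,2,0,4,1,0,2,0,1,0,3,1,0,2,0,1,0,2,4,2],
   [1,0,2,4,0,1,4,3,1,0,1,2,1,4,2,0,1,0,2,3,1,0,3,1,4,3],
   [1,0,2,4,0,2,3,0,4,1,0,4,0,3,0,2,3,0,1,0,4,0,1,0,3,2],
   [1,0,2,4,0,2,3,0,4,1,0,4,0,3,2,0,3,0,1,0,4,0,1,0,3,2],
   [1,0,2,3,0,1,0,4,1,0,2,0,4,1,0,4,3,0,1,0,2,0,1,0,4,2],
   [1,0,2,3,0,4,2,0,4,1,2,4,0,2,4,2,3,4,0,1,0,2,0,1,0,4],
   [1,0,2,3,0,4,0,2,4,1,2,4,0,2,4,2,3,4,0,1,0,2,0,1,0,4],
   [0,3,0,2,1,0,2,3,2,4,0,2,0,1,2,3,1,2,0,2,1,2,3,2,4,2],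
   [0,1,2,3,2,1,2,0,2,4,0,1,2,0,1,0,3,1,0,2,0,1,0,2,4,2],
   [0,1,2,3,0,1,0,2,1,4,0,1,0,2,1,0,3,0,1,2,1,0,1,2,4,2],
   [0,1,2,3,0,4,2,0,3,0,2,0,1,2,0,2,4,3,0,2,4,2,0,2,4,3],
   [0,3,0,2,3,4,1,0,4,3,2,3,0,4,0,1,3,1,0,2,0,1,0,2,3,4],
   [0,3,4,0,1,0,2,1,0,1,3,0,1,0,4,3,1,0,3,2,0,4,0,1,0,4],
   [0,3,1,3,0,4,2,0,4,3,0,1,3,4,0,2,3,1,0,2,0,1,0,2,3,4],
   [0,3,1,2,0,1,3,4,0,2,0,3,2,0,1,0,2,0,3,0,2,0,4,2,0,1],
   [0,3,0,2,1,0,3,2,0,4,0,1,2,1,0,3,0,1,2,1,0,1,2,3,4,2],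
   [0,3,0,2,1,0,3,2,0,4,0,1,0,3,1,0,2,0,1,0,3,1,0,1,4,2],
   [0,3,0,2,1,0,2,4,0,1,0,2,1,0,3,0,4,2,0,4,0,1,0,2,4,2],
   [0,3,0,2,1,0,2,4,0,2,1,0,2,0,3,0,1,0,4,0,2,4,0,1,4,2],
   [0,3,0,4,1,0,4,2,0,1,3,4,3,0,1,0,3,2,0,1,2,1,4,2,0,1],
   [0,3,0,2,1,0,2,4,0,1,2,0,1,0,3,0,4,2,0,4,1,0,2,0,4,2],
   [0,3,0,2,1,0,2,4,0,2,3,0,4,2,0,4,0,1,2,3,2,0,3,2,4,2],
   [0,3,0,4,2,0,3,2,0,2,4,3,1,4,3,2,0,2,3,2,4,2,3,2,0,1],
   [0,3,1,2,1,0,3,4,0,2,3,0,2,0,1,0,2,0,3,0,2,0,4,2,0,1],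
   [0,1,0,4,2,0,4,3,1,2,0,2,3,4,0,2,3,1,0,2,0,1,0,2,3,4],
   [0,3,2,0,1,0,3,2,0,4,0,1,0,3,0,1,0,2,1,0,1,3,0,1,4,2],
   [0,3,2,0,1,0,3,2,0,4,0,1,0,3,1,0,2,0,1,0,3,1,0,1,4,2],
   [0,3,1,3,0,4,0,1,0,3,1,0,2,1,4,1,3,4,0,1,3,1,4,1,3,2],
   [0,3,1,3,0,4,0,1,2,0,1,0,4,3,0,4,0,2,0,1,0,2,4,0,3,2],
   [0,3,1,3,0,4,0,1,2,0,1,0,4,3,0,4,0,2,1,0,2,0,4,0,3,2],
   [0,3,1,3,0,4,2,0,4,3,0,1,0,4,1,2,0,2,1,2,3,0,2,0,4,2],
   [0,3,1,3,0,4,0,3,1,0,3,0,2,0,1,0,4,3,0,4,0,1,4,0,3,2],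
   [0,3,1,4,0,1,2,0,4,0,3,4,0,2,0,1,0,2,0,3,4,0,3,2,0,1],
   [0,3,0,4,1,0,2,1,4,1,0,1,3,4,3,1,3,0,4,2,0,4,0,1,0,4],
   [0,3,0,4,1,0,2,0,4,0,1,0,3,4,3,0,3,2,1,0,2,0,4,2,0,1],
   [0,1,0,4,2,0,4,3,0,4,2,0,1,3,2,3,4,2,0,2,3,4,3,2,3,4],
   [0,1,0,4,2,0,4,3,0,4,0,2,1,3,2,3,4,2,0,2,3,4,3,2,3,4],
   [0,3,0,4,1,0,2,0,4,0,3,2,0,4,0,1,0,2,1,0,1,3,4,0,3,2],
   [0,1,0,4,0,3,1,3,0,3,4,0,2,1,3,4,0,3,4,1,4,0,3,0,4,2],
   [0,4,3,0,1,0,4,1,0,2,0,4,0,1,4,0,4,3,4,2,0,4,2,1,4,2],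
   [0,4,0,2,4,3,1,4,3,0,4,3,1,4,2,0,1,0,3,0,4,0,3,1,0,3],
   [0,4,0,3,4,0,1,4,3,0,4,0,2,4,0,1,3,0,1,0,4,0,1,0,3,2],
   [0,4,2,0,4,3,1,4,3,2,4,0,2,4,2,3,2,1,4,1,2,1,4,0,4,3],
   [0,4,2,3,4,2,0,4,1,0,4,2,0,1,3,4,3,1,3,0,4,2,4,0,4,1],
   [0,4,2,3,4,2,0,2,1,0,2,4,2,0,2,1,3,1,4,0,2,4,0,1,4,2],
   [0,1,0,4,2,0,4,3,0,4,1,0,3,0,4,3,0,2,1,4,1,3,0,3,4,3]
  ]"
  by code_simp

text \<open>Three directions isolate the first red fault and one each the others, so that every
  direction separates two red faults.\<close>

lemma six_fault_certs_15_23: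
  "list_all2 (\<lambda>G. cycle_cert 5 ([[False, False, False, False, False], [True, True, True, True,
      False], [True, True, True, False, True]] @ G) [True, True, False, False, False])
    (filter (\<lambda>G. \<not> balanced 5 [[False, False, False, False, False], [True, True, True, True, False],
      [True, True, True, False, True]] G) (combs 3 (odd_codes 5)))
  [
   [2,0,3,1,0,3,4,0,1,2,1,0,1,3,2,0,1,0,2,0,1,4,1,0,1,3],
   [0,3,0,1,2,0,3,0,1,0,4,1,0,2,0,1,3,1,0,2,0,1,0,2,3,4],
   [0,3,1,0,4,0,1,0,2,1,0,1,4,1,3,0,1,0,4,1,0,2,0,1,0,4],
   [0,4,0,1,2,0,4,0,1,0,3,1,0,2,0,1,4,1,0,2,0,1,0,2,4,3],
   [0,4,1,0,3,0,1,0,2,1,0,1,3,1,4,0,1,0,3,1,0,2,0,1,0,3],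
   [0,2,0,1,0,3,0,2,0,1,2,4,3,1,0,3,0,2,1,3,1,0,1,3,4,3],
   [0,3,0,1,0,4,0,1,2,0,4,1,0,4,3,2,0,2,4,0,1,0,4,2,0,4],
   [1,3,1,0,2,1,3,0,1,0,4,1,0,2,0,1,3,1,0,2,0,1,0,2,3,4],
   [1,3,0,1,4,0,2,0,3,2,0,1,0,3,0,2,0,3,0,4,3,0,3,1,0,2],
   [1,4,1,0,2,1,4,0,1,0,3,1,0,2,0,1,4,1,0,2,0,1,0,2,4,3],
   [1,4,0,1,3,0,2,0,4,2,0,1,0,4,0,2,0,3,0,4,3,0,3,1,0,2],
   [1,3,0,4,3,0,1,0,2,1,0,3,1,0,2,0,4,0,2,1,0,3,0,1,0,2],
   [1,2,1,0,1,3,0,2,0,1,2,4,3,2,0,1,0,2,0,3,0,2,0,1,4,3],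
   [0,3,2,1,0,2,3,2,1,0,4,1,0,2,0,1,3,1,0,2,0,1,0,2,3,4],
   [0,2,0,1,2,3,0,2,4,0,1,0,3,1,0,2,0,1,0,3,1,0,1,4,0,3],
   [0,4,2,1,0,2,4,2,1,0,3,1,0,2,0,1,4,1,0,2,0,1,0,2,4,3],
   [0,2,0,1,2,4,0,2,3,0,1,0,4,1,0,2,0,1,0,4,1,0,1,3,0,4],
   [0,2,0,1,2,3,2,0,1,2,1,4,2,0,1,0,3,1,0,2,0,1,0,3,4,3],
   [0,2,0,1,2,3,2,0,1,4,3,1,0,3,2,3,0,1,0,3,0,1,4,1,0,3],
   [0,3,0,1,2,0,1,3,0,1,0,4,0,3,0,2,1,0,2,0,3,2,0,1,4,1],
   [0,3,0,1,2,0,1,3,0,1,0,4,0,3,0,2,0,1,2,0,3,2,0,1,4,1],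
   [0,3,0,1,2,0,1,3,0,1,0,4,0,3,1,0,3,2,3,1,0,1,3,1,4,1],
   [0,3,0,1,2,0,1,3,0,1,0,4,0,3,0,1,3,2,3,1,0,1,3,1,4,1],
   [0,3,0,1,2,0,1,3,0,1,0,4,0,3,1,0,3,2,1,3,1,0,1,3,4,1],
   [0,3,0,1,2,0,1,3,0,1,0,4,1,2,1,3,2,1,0,1,2,1,3,1,4,1],
   [0,2,0,1,0,3,0,2,3,4,2,0,2,1,0,3,2,1,0,2,1,2,4,2,0,3],
   [0,3,0,1,2,0,1,3,0,1,0,4,0,3,0,2,3,1,2,3,0,2,3,1,4,1],
   [0,3,0,1,2,0,1,3,0,1,0,4,0,3,1,0,3,2,1,3,1,0,3,1,4,1],
   [0,3,0,1,2,0,1,4,0,1,3,0,1,2,1,3,0,1,3,1,4,2,0,1,0,2],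
   [0,3,1,4,1,3,0,3,2,0,3,1,0,2,3,2,4,2,3,2,0,3,1,3,0,2],
   [0,3,1,0,2,0,1,3,0,1,0,4,0,3,0,1,3,2,1,3,1,0,1,3,4,1],
   [0,3,1,0,2,4,1,2,0,1,2,1,4,1,3,0,1,0,4,1,2,1,0,1,4,1],
   [0,3,1,0,2,0,1,3,0,1,0,4,0,3,0,1,0,2,1,0,3,1,0,1,4,1],
   [0,4,0,1,2,0,1,3,0,1,0,2,0,1,4,0,1,0,3,2,0,3,1,3,0,2],
   [0,4,1,0,2,3,1,2,0,1,2,1,3,1,4,0,1,0,3,1,2,1,0,1,3,1],
   [0,2,0,1,0,3,1,2,1,0,1,4,0,2,3,1,3,0,2,0,3,1,0,1,4,1],
   [0,2,0,1,0,3,1,4,0,1,3,0,2,1,0,1,4,3,0,1,4,1,0,1,4,3],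
   [0,2,0,1,0,3,0,2,0,1,0,4,2,1,3,0,1,3,1,2,1,3,0,1,4,1],
   [0,3,0,4,2,0,3,2,1,0,2,0,3,0,2,0,4,0,2,0,3,1,0,1,2,1],
   [0,2,0,1,0,3,0,4,1,0,3,1,2,1,0,1,4,3,0,1,4,1,0,1,4,3],
   [0,2,0,1,0,3,0,4,3,0,3,1,2,3,1,3,4,1,0,1,3,4,3,1,3,4],
   [0,4,0,1,2,0,1,3,0,2,4,0,2,3,0,1,0,3,0,4,0,2,4,0,3,1],
   [0,4,0,1,2,0,1,3,0,1,4,0,1,2,1,4,1,0,4,1,3,2,0,1,0,2],
   [0,4,0,1,2,0,1,3,0,1,4,0,1,2,1,4,0,1,4,1,3,2,0,1,0,2],
   [0,3,0,4,2,0,4,1,2,4,3,1,0,1,2,3,4,2,3,2,0,4,1,4,0,2]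
  ]"
  by code_simp

section \<open>Cubes with one and two faults\<close>

lemma flip_half: "dir Q i \<Longrightarrow> x \<in> half Q i s \<Longrightarrow> flip i x \<in> half Q i (\<not> s)"
  "dir Q i \<Longrightarrow> x \<in> half Q i (\<not> s) \<Longrightarrow> flip i x \<in> half Q i s"
  by (auto simp: half_def dir_flip mem_flip)

text \<open>The facts needed after every split, cited by position below: (5) and (6) are the
  crossing, (7) and (8) decide in which half a vertex lies.\<close>

lemma halves:
  assumes "subcube (Suc n) Q" "dir Q i" "A = half Q i s" "B = half Q i (\<not> s)"
  shows "subcube n A" "subcube n B" "Q = A \<union> B" "A \<inter> B = {}"
    "x \<in> A \<Longrightarrow> flip i x \<in> B" "x \<in> B \<Longrightarrow> flip i x \<in> A"
    "x \<in> A \<longleftrightarrow> x \<in> Q \<and> (i \<in> supp x) = s" "x \<in> B \<longleftrightarrow> x \<in> Q \<and> (i \<in> supp x) \<noteq> s"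
    "finite A" "finite B"
proof -
  show "subcube n A" "subcube n B"
    using subcube_half assms by auto
  then show "finite A" "finite B"
    using card_subcube by blast+
  show "Q = A \<union> B" "A \<inter> B = {}"
    unfolding assms(3,4) by (rule half_Un(1)[symmetric], rule half_Un(2))
  show "x \<in> A \<Longrightarrow> flip i x \<in> B" "x \<in> B \<Longrightarrow> flip i x \<in> A"
    using flip_half[OF assms(2)] assms(3,4) by blast+
qed (simp_all add: assms(3,4) mem_half)

text \<open>A direction separates \<open>a\<close> from \<open>b\<close>. On the side of
  \<open>v\<close> the induction hypothesis leads from \<open>a\<close> to some \<open>c\<close> of
  its colour; crossing changes the colour, so the other half is finished by
  \<open>havel\<close>.\<close>

lemma one_fault:
  assumes "subcube n Q" "2 \<le> n" "a \<in> Q" "b \<in> Q" "v \<in> Q" "a \<noteq> b" "col a = col b" "col v \<noteq> col a"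
  shows "\<exists>E. ham_path (Q - {v}) E a b"
  using assms
proof (induction n arbitrary: Q a b v)
  case (Suc n)
  \<comment> \<open>The ends are arbitrary here, so that reversing the path covers the case of
    \<open>v\<close> on the side of \<open>b\<close>.\<close>
  have step: "\<exists>E. ham_path (Q - {v}) E a b"
    if i: "dir Q i" "(i \<in> supp a) \<noteq> (i \<in> supp b)" "(i \<in> supp v) = (i \<in> supp a)"
      and ab: "a \<in> Q" "b \<in> Q" "a \<noteq> b" "col a = col b" "col v \<noteq> col a" for i a b
  proof -
    define A where "A = half Q i (i \<in> supp a)"
      define B where "B = half Q i (\<not> (i \<in> supp a))"
      note AB = halves[OF Suc.prems(1) i(1) A_def B_def]
    have mem: "a \<in> A" "b \<in> B" "v \<in> A" "v \<notin> B"
      using AB(7)[of a] AB(7)[of v] AB(8)[of b] AB(8)[of v] i(2,3) ab(1,2) Suc.prems(5) by simp_all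
    have "\<exists>c E. ham_path (A - {v}) E a c \<and> c \<in> A \<and> col c = col a"
    proof (cases "n = 1")
      case True
      \<comment> \<open>The half is a single edge, and deleting \<open>v\<close> leaves the trivial
        path at \<open>a\<close>.\<close>
      have "a \<noteq> v" using ab(5) by auto
      then have "finite A" "card A = card {a, v}" using card_subcube[OF AB(1)] True by auto
      then have "A = {a, v}" using mem by (metis card_subset_eq empty_subsetI insert_subset)
      then have "A - {v} = {a}" using ab by auto
      then show ?thesis using ham_path_single mem by metis
    next
      case False
      then have n: "2 \<le> n" using Suc.prems by auto
      then have "(2::nat) ^ 1 \<le> 2 ^ (n - 1)" by (intro power_increasing) auto
      then obtain c where c: "c \<in> A" "col c = col a" "c \<noteq> a"
        using pick_col[OF AB(1), of "{a}" "col a"] n by auto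
      then show ?thesis using Suc.IH[OF AB(1) n mem(1) c(1) mem(3)] ab by metis
    qed
    then obtain c E where c: "ham_path (A - {v}) E a c" "c \<in> A" "col c = col a" by blast
    then obtain E' where "ham_path B E' (flip i c) b"
      using havel[OF AB(2) AB(5)[OF c(2)] mem(2)] ab by auto
    from ham_path_join[OF c(1) this] AB(4) have "ham_path (A - {v} \<union> B) (insert {c, flip i c} (E \<union>
        E')) a b"
      by auto
    moreover have "A - {v} \<union> B = Q - {v}" using AB(3) mem by (intro equalityI) auto
    ultimately show ?thesis by metis
  qed
  obtain i where i: "dir Q i" "(i \<in> supp a) \<noteq> (i \<in> supp b)" using subcube_eqI Suc.prems by metis
  show ?case
  proof (cases "(i \<in> supp v) = (i \<in> supp a)")
    case True
    then show ?thesis using step i Suc.prems by blast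
  next
    case False
    then have "\<exists>E. ham_path (Q - {v}) E b a" using step[of i b a] i Suc.prems by metis
    then show ?thesis using ham_path_rev by blast
  qed
qed simp

text \<open>The names of the faults are chosen so that \<open>r\<close> has the colour of
  \<open>a\<close>. With base vertex \<open>r\<close> the directions separating the faults are odd
  in number, which leaves two normal positions.\<close>

lemma two_faults_4:
  assumes "subcube 4 Q" "{a, b, r, g} \<subseteq> Q" "col a \<noteq> col b" "col r \<noteq> col g" "{a, b} \<inter> {r, g} = {}"
  shows "\<exists>E. ham_path (Q - {r, g}) E a b"
proof -
  have "\<exists>E. ham_path (Q - {r, g}) E a b"
    if rg: "{r, g} \<subseteq> Q" "{a, b} \<inter> {r, g} = {}" and col: "col r = col a" "col g \<noteq> col a" for r g
  proof -
    define D where "D = {i. dir Q i \<and> (i \<in> supp g) \<noteq> (i \<in> supp r)}"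
    define D' where "D' = {i. dir Q i \<and> (i \<in> supp g) = (i \<in> supp r)}"
    have I: "finite {i. dir Q i}" "card {i. dir Q i} = 4" using subcube_dirs[OF assms(1)] by auto
    have DD: "D \<union> D' = {i. dir Q i}" "D \<inter> D' = {}" by (auto simp: D_def D'_def)
    then have fin: "finite D" "finite D'" using I by (metis finite_Un)+
    obtain xs ys where xs: "set xs = D" "distinct xs" and ys: "set ys = D'" "distinct ys"
      using fin finite_distinct_list by metis
    define ds where "ds = xs @ ys"
    have ds: "distinct ds" "set ds = {i. dir Q i}" using xs ys DD by (auto simp: ds_def)
    have len: "length xs + length ys = 4"
      using I(2) ds distinct_card[OF ds(1)] by (simp add: ds_def)
    have "i \<in> D \<longleftrightarrow> (i \<in> supp g) \<noteq> (i \<in> supp r)" for i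
      using subcube_sep[OF assms(1), of g r i] rg(1) by (auto simp: D_def)
    then have "odd (length xs)"
      using col_symdiff[OF fin(1), of g r] col distinct_card[OF xs(2)] xs(1) by auto
    with len have cases: "length xs = 1 \<and> length ys = 3 \<or> length xs = 3 \<and> length ys = 1"
      by presburger
    have cr: "code r ds r = replicate 4 False"
      using code_replicate[of ds r r False] len by (simp add: ds_def)
    have cg: "code r ds g = replicate (length xs) True @ replicate (length ys) False"
      unfolding ds_def code_append
      by (intro arg_cong2[of _ _ _ _ "(@)"] code_replicate) (auto simp: xs(1) ys(1) D_def D'_def)
    have mem: "a \<in> Q" "b \<in> Q" "r \<in> Q" "g \<in> Q" using assms(2) rg by auto
    have ne: "code r ds a \<noteq> code r ds r" "code r ds b \<noteq> code r ds g"
      using code_inj[OF assms(1) ds] mem rg(2) by auto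
    have co: "code r ds a \<in> set (even_codes 4)" "code r ds b \<in> set (odd_codes 4)"
      using code_mem[OF assms(1) ds _ mem(3)] mem col assms(3) by auto
    have "\<exists>ks. path_cert 4 [code r ds r, code r ds g] (code r ds a) (code r ds b) ks"
    proof (cases "length xs = 1")
      case True
      then have g: "code r ds g = [True, False, False, False]" using cg cases
        by (simp add: numeral_eq_Suc)
      show ?thesis using list_all2_cert[OF two_fault_certs_1, of "(code r ds a, code r ds b)"] ne co
        unfolding cr g by (simp add: numeral_eq_Suc)
    next
      case False
      then have g: "code r ds g = [True, True, True, False]" using cg cases
        by (simp add: numeral_eq_Suc)
      show ?thesis using list_all2_cert[OF two_fault_certs_7, of "(code r ds a, code r ds b)"] ne co
        unfolding cr g by (simp add: numeral_eq_Suc)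
    qed
    then show ?thesis
      using path_cert_sound[OF assms(1) ds, of "[r, g]" a b r] mem by auto
  qed
  note * = this
  show ?thesis
  proof (cases "col r = col a")
    case True
    then show ?thesis using *[of r g] assms by auto
  next
    case False
    then show ?thesis using *[of g r] assms by (auto simp: insert_commute)
  qed
qed

lemma pow_ge: "k \<le> n \<Longrightarrow> (2::nat) ^ k \<le> 2 ^ n"
  by (rule power_increasing) auto

text \<open>If some direction keeps \<open>a\<close> and \<open>b\<close> in one half, a path there
  is extended by a detour, whatever the position of the faults. Otherwise \<open>a\<close> and
  \<open>b\<close> are antipodal in \<open>Q\<close>, and two paths are joined across a
  split.\<close>

lemma two_faults:
  assumes "subcube n Q" "4 \<le> n" "{a, b, r, g} \<subseteq> Q" "col a \<noteq> col b" "col r \<noteq> col g"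
    "{a, b} \<inter> {r, g} = {}"
  shows "\<exists>E. ham_path (Q - {r, g}) E a b"
proof -
  have "4 \<le> n \<Longrightarrow> subcube n Q \<Longrightarrow> {a, b, r, g} \<subseteq> Q \<Longrightarrow> col a \<noteq> col b \<Longrightarrow> col r = col a \<Longrightarrow> col g = col b
    \<Longrightarrow> {a, b} \<inter> {r, g} = {} \<Longrightarrow> \<exists>E. ham_path (Q - {r, g}) E a b" for a b r g
  proof (induction n arbitrary: Q a b r g rule: dec_induct)
    case base
    then show ?case using two_faults_4[of Q a b r g] by auto
  next
    case (step n)
    have n4: "4 \<le> n" and n1: "n \<noteq> 0" using step.hyps by auto
    have p8: "8 \<le> (2::nat) ^ (n - 1)" using pow_ge[of 3 "n - 1"] n4 by auto
    \<comment> \<open>The induction fixes which fault has the colour of \<open>a\<close>; here the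
      symmetric form is recovered.\<close>
    have IH: "\<exists>E. ham_path (A - {p, q}) E x y" if "subcube n A" "{x, y, p, q} \<subseteq> A"
       "col x \<noteq> col y" "col p \<noteq> col q" "{x, y} \<inter> {p, q} = {}" for A x y p q
    proof (cases "col p = col x")
      case True
      then show ?thesis using step.IH[of A x y p q] that by auto
    next
      case False
      then show ?thesis using step.IH[of A x y q p] that by (auto simp: insert_commute)
    qed
    have ne: "a \<noteq> b" "r \<noteq> g" using step.prems by auto
    have flips: "flip i x \<noteq> y \<longleftrightarrow> x \<noteq> flip i y" for i x y by (metis flip_flip)
    show ?case
    proof (cases "\<exists>i. dir Q i \<and> (i \<in> supp a) = (i \<in> supp b)")
      case True
      then obtain i where i: "dir Q i" "(i \<in> supp a) = (i \<in> supp b)" by blast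
      define A where "A = half Q i (i \<in> supp a)"
      define B where "B = half Q i (\<not> (i \<in> supp a))"
      note AB = halves[OF step.prems(1) i(1) A_def B_def]
      have aA: "a \<in> A" using AB(7)[of a] step.prems(2) by simp
      have bA: "b \<in> A" using AB(7)[of b] i(2) step.prems(2) by simp
      \<comment> \<open>One fault in each half. Deleting \<open>c\<close> makes \<open>A\<close>
        neutral. The detour returns \<open>c\<close>, and since \<open>c\<close> and
        \<open>z\<close> have the colour of \<open>q\<close>, their opposite vertices are suitable
        ends for \<open>one_fault\<close>.\<close>
      have mixed: "\<exists>E. ham_path (Q - {p, q}) E a b"
        if pq: "p \<in> A" "q \<in> B" "col p \<noteq> col q" "p \<notin> {a, b}" for p q
      proof -
        obtain c where c: "c \<in> A" "col c \<noteq> col p" "c \<notin> {a, b}"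
          using pick_col[OF AB(1), of "{a, b}" "\<not> col p"] p8 n1 ne by auto
        have "c \<noteq> p" using c by auto
        obtain E where E: "ham_path (A - {p, c}) E a b"
          using IH[OF AB(1), of a b p c] c pq aA bA step.prems(3) by auto
        have "card {p, a, b} < n" using card_length[of "[p, a, b]"] n4 by simp
        then obtain y where y: "y \<in> A" "y \<notin> {p, a, b}" "adj c y"
          using pick_nbr[OF AB(1) c(1), of "{p, a, b}"] by auto
        have "y \<noteq> c" using y(3) by auto
        then obtain z where z: "{y, z} \<in> E" using ham_path_nbrs[OF E, of y] y by auto
        note ed = ham_path_edge[OF E z]
        have "col z = col c" using adj_col y c(1) ed by blast
        then obtain E' where "ham_path (B - {q}) E' (flip i c) (flip i z)"
          using one_fault[OF AB(2), of "flip i c" "flip i z" q] AB(5) c(1) ed n4 pq c(2)  by auto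
        then have T: "ham_path ({c} \<union> (B - {q})) (insert {c, flip i c} ({} \<union> E')) c (flip i z)"
          using AB(4) c(1) by (intro ham_path_join ham_path_single) auto
        have "(A - {p, c}) \<inter> ({c} \<union> (B - {q})) = {}" using AB(4) by (auto simp: disjoint_iff)
        from ham_path_detour[OF E z T _ _ this]
        have "\<exists>E. ham_path ((A - {p, c}) \<union> ({c} \<union> (B - {q}))) E a b" using y(3) adj_sym by auto
        moreover have "(A - {p, c}) \<union> ({c} \<union> (B - {q})) = Q - {p, q}"
          using AB(3,4) c \<open>c \<noteq> p\<close> pq by (intro equalityI) auto
        ultimately show ?thesis by metis
      qed
      consider "r \<in> A" "g \<in> A" | "r \<in> B" "g \<in> B" | "r \<in> A" "g \<in> B" | "r \<in> B" "g \<in> A"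
        using AB(3) step.prems(2) by auto
      then show ?thesis
      proof cases
        case 1
        obtain E where E: "ham_path (A - {r, g}) E a b"
          using IH[OF AB(1), of a b r g] 1 aA bA step.prems by auto
        \<comment> \<open>\<open>B\<close> is free of faults, so any edge can carry the detour; at
          the end \<open>a\<close> one certainly exists.\<close>
        then obtain z where z: "{a, z} \<in> E" using ham_path_end_nbr ne by metis
        note ed = ham_path_edge[OF E z]
        have "col z \<noteq> col a" using adj_col ed by blast
        then obtain E' where E': "ham_path B E' (flip i a) (flip i z)"
          using havel[OF AB(2), of "flip i a" "flip i z"] AB(5) ed  by auto
        have "(A - {r, g}) \<inter> B = {}" using AB(4) by (auto simp: disjoint_iff)
        from ham_path_detour[OF E z E' _ _ this]
        have "\<exists>E. ham_path ((A - {r, g}) \<union> B) E a b" by auto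
        moreover have "(A - {r, g}) \<union> B = Q - {r, g}" using AB(3,4) 1 by (intro equalityI) auto
        ultimately show ?thesis by metis
      next
        case 2
        obtain E where E: "ham_path A E a b" using havel[OF AB(1)] aA bA step.prems by metis
        have "card {a, b, flip i r} < 8" using card_length[of "[a, b, flip i r]"] by simp
        \<comment> \<open>An inner vertex has two neighbours on the path, and one of them is not
          opposite \<open>g\<close>. The colour of \<open>c\<close> excludes the remaining
          coincidences with faults.\<close>
        then obtain c where c: "c \<in> A" "c \<notin> {a, b, flip i r}" "col c = (\<not> col r)"
          using pick_col[OF AB(1), of "{a, b, flip i r}" "\<not> col r"] p8 n1 by auto
        then obtain d where d: "d \<noteq> flip i g" "{c, d} \<in> E"
          using ham_path_nbrs[OF E, of c] by (metis insertCI)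
        note ed = ham_path_edge[OF E d(2)]
        have "col d = col r" using adj_col ed c(3) by blast
        then have cd: "col (flip i c) = col r" "col (flip i d) = (\<not> col r)" using  ed c by auto
        have "flip i d \<noteq> g" "flip i c \<noteq> r" using d c(2) flips by blast+
        moreover have "flip i d \<noteq> r" "flip i c \<noteq> g" using cd step.prems by auto
        ultimately obtain E' where E': "ham_path (B - {r, g}) E' (flip i c) (flip i d)"
          using IH[OF AB(2), of "flip i c" "flip i d" r g] AB(5) ed 2 cd step.prems by auto
        have "A \<inter> (B - {r, g}) = {}" using AB(4) by (auto simp: disjoint_iff)
        from ham_path_detour[OF E d(2) E' _ _ this]
        have "\<exists>E. ham_path (A \<union> (B - {r, g})) E a b" by auto
        moreover have "A \<union> (B - {r, g}) = Q - {r, g}" using AB(3,4) 2 by (intro equalityI) auto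
        ultimately show ?thesis by metis
      next
        case 3
        then show ?thesis using mixed[of r g] step.prems by auto
      next
        case 4
        then show ?thesis using mixed[of g r] step.prems by (auto simp: insert_commute)
      qed
    next
      case False
      \<comment> \<open>Every direction now separates \<open>a\<close> from \<open>b\<close>, so one
        that separates \<open>a\<close> from \<open>r\<close> puts \<open>b\<close> on the side of
        \<open>r\<close>.\<close>
      have "a \<noteq> r" using step.prems by auto
      then obtain i where i: "dir Q i" "(i \<in> supp a) \<noteq> (i \<in> supp r)"
        using subcube_eqI step.prems by (metis insert_subset)
      define A where "A = half Q i (i \<in> supp a)"
      define B where "B = half Q i (\<not> (i \<in> supp a))"
      note AB = halves[OF step.prems(1) i(1) A_def B_def]
      have aA: "a \<in> A" using AB(7)[of a] step.prems(2) by simp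
      have bB: "b \<in> B" "r \<in> B" using AB(8)[of b] AB(8)[of r] i step.prems(2) False by auto
      show ?thesis
      proof (cases "g \<in> A")
        case True
        have "card {a, flip i b} < 8" by (auto simp: card_insert_if)
        then obtain c where c: "c \<in> A" "c \<notin> {a, flip i b}" "col c = col a"
          using pick_col[OF AB(1), of "{a, flip i b}" "col a"] p8 n1 by auto
        obtain E where E: "ham_path (A - {g}) E a c"
          using one_fault[OF AB(1), of a c g] c aA True n4 step.prems by auto
        have "flip i c \<noteq> b" using c(2) flips by blast
        then obtain E' where E': "ham_path (B - {r}) E' (flip i c) b"
          using one_fault[OF AB(2), of "flip i c" b r] c AB(5) bB n4 step.prems  by auto
        have "(A - {g}) \<inter> (B - {r}) = {}" using AB(4) by (auto simp: disjoint_iff)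
        from ham_path_join[OF E E' _ this]
        have "\<exists>E. ham_path ((A - {g}) \<union> (B - {r})) E a b" by auto
        moreover have "(A - {g}) \<union> (B - {r}) = Q - {r, g}" using AB(3,4) True bB
          by (intro equalityI) auto
        ultimately show ?thesis by metis
      next
        case gA: False
        then have gB: "g \<in> B" using AB(3) step.prems by auto
        have "card {flip i r} < 8" by auto
        then obtain c where c: "c \<in> A" "c \<notin> {flip i r}" "col c = col b"
          using pick_col[OF AB(1), of "{flip i r}" "col b"] p8 n1 by auto
        obtain E where E: "ham_path A E a c"
          using havel[OF AB(1), of a c] c aA step.prems by auto
        have "flip i c \<noteq> r" using c(2) flips by blast
        moreover have "flip i c \<noteq> g" using c(3) col_flip step.prems by metis
        ultimately obtain E' where E': "ham_path (B - {r, g}) E' (flip i c) b"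
          using IH[OF AB(2), of "flip i c" b r g] c AB(5) bB gB step.prems  by auto
        have "A \<inter> (B - {r, g}) = {}" using AB(4) by (auto simp: disjoint_iff)
        from ham_path_join[OF E E' _ this]
        have "\<exists>E. ham_path (A \<union> (B - {r, g})) E a b" by auto
        moreover have "A \<union> (B - {r, g}) = Q - {r, g}" using AB(3,4) gB bB by (intro equalityI) auto
        ultimately show ?thesis by metis
      qed
    qed
  qed
  note * = this
  show ?thesis
  proof (cases "col r = col a")
    case True
    then show ?thesis using *[of a b r g] assms by auto
  next
    case False
    then show ?thesis using *[of a b g r] assms by (auto simp: insert_commute)
  qed
qed

section \<open>Cubes with four faults\<close>

lemma four_faults_4:
  assumes "subcube 4 Q" "{r1, r2, g1, g2} \<subseteq> Q" "r1 \<noteq> r2" "g1 \<noteq> g2"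
    "col r2 = col r1" "col g1 \<noteq> col r1" "col g2 \<noteq> col r1"
  shows "\<exists>E. ham_cycle (Q - {r1, r2, g1, g2}) E"
proof -
  define D where "D = {i. dir Q i \<and> (i \<in> supp r2) \<noteq> (i \<in> supp r1)}"
  define D' where "D' = {i. dir Q i \<and> (i \<in> supp r2) = (i \<in> supp r1)}"
  have I: "finite {i. dir Q i}" "card {i. dir Q i} = 4" using subcube_dirs[OF assms(1)] by auto
  have DD: "D \<union> D' = {i. dir Q i}" "D \<inter> D' = {}" by (auto simp: D_def D'_def)
  then have fin: "finite D" "finite D'" using I by (metis finite_Un)+
  obtain xs ys where xs: "set xs = D" "distinct xs" and ys: "set ys = D'" "distinct ys"
    using fin finite_distinct_list by metis
  define ds where "ds = xs @ ys"
  have ds: "distinct ds" "set ds = {i. dir Q i}" using xs ys DD by (auto simp: ds_def)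
  have len: "length xs + length ys = 4"
    using I(2) ds distinct_card[OF ds(1)] by (simp add: ds_def)
  have "i \<in> D \<longleftrightarrow> (i \<in> supp r2) \<noteq> (i \<in> supp r1)" for i
    using subcube_sep[OF assms(1), of r2 r1 i] assms(2) by (auto simp: D_def)
  then have "even (length xs)"
    using col_symdiff[OF fin(1), of r2 r1] assms(5) distinct_card[OF xs(2)] xs(1) by auto
  moreover have "length xs \<noteq> 0"
  proof -
    obtain i where "dir Q i" "(i \<in> supp r1) \<noteq> (i \<in> supp r2)"
      using subcube_eqI[OF assms(3,1)] assms(2) by auto
    then have "i \<in> set xs" by (simp add: xs(1) D_def)
    then show ?thesis by auto
  qed
  ultimately have cases: "length xs = 2 \<and> length ys = 2 \<or> length xs = 4 \<and> length ys = 0"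
    using len by presburger
  have cr: "code r1 ds r1 = replicate 4 False"
    using code_replicate[of ds r1 r1 False] len by (simp add: ds_def)
  have cr2: "code r1 ds r2 = replicate (length xs) True @ replicate (length ys) False"
    unfolding ds_def code_append
    by (intro arg_cong2[of _ _ _ _ "(@)"] code_replicate) (auto simp: xs(1) ys(1) D_def D'_def)
  have "\<exists>hs. set hs = {g1, g2} \<and> length hs = card {g1, g2} \<and>
    map (code r1 ds) hs \<in> set (combs (card {g1, g2}) (odd_codes 4))"
    by (rule code_combs[OF assms(1) ds]) (use assms in auto)
  then obtain hs where hs: "set hs = {g1, g2}" "map (code r1 ds) hs \<in> set (combs 2 (odd_codes 4))"
    using assms(4) by (auto simp: numeral_eq_Suc)
  have "\<exists>c ks. length c = 4 \<and> cycle_cert 4 (map (code r1 ds) ([r1, r2] @ hs)) c ks"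
  proof (cases "length xs = 2")
    case True
    then have g: "code r1 ds r2 = [True, True, False, False]" using cr2 cases
      by (simp add: numeral_eq_Suc)
    show ?thesis using list_all2_cert[OF four_fault_certs_3 hs(2)]
      by (intro exI[of _ "[True, False, True, False]"]) (simp add: cr g numeral_eq_Suc)
  next
    case False
    then have g: "code r1 ds r2 = [True, True, True, True]" using cr2 cases
      by (simp add: numeral_eq_Suc)
    show ?thesis using list_all2_cert[OF four_fault_certs_15 hs(2)]
      by (intro exI[of _ "[True, True, False, False]"]) (simp add: cr g numeral_eq_Suc)
  qed
  then have "\<exists>E. ham_cycle (Q - set ([r1, r2] @ hs)) E"
    using cycle_cert_sound[OF assms(1) ds, of "[r1, r2] @ hs"] assms(2) hs(1) by auto
  then show ?thesis using hs(1) by (simp add: insert_commute)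
qed

text \<open>A Hamiltonian path between adjacent vertices is closed by the edge between them.\<close>

lemma two_faults_cycle:
  assumes "subcube n Q" "4 \<le> n" "{r, g} \<subseteq> Q" "col r \<noteq> col g"
  shows "\<exists>E. ham_cycle (Q - {r, g}) E"
proof -
  have n0: "n \<noteq> 0" and p8: "8 \<le> (2::nat) ^ (n - 1)" using pow_ge[of 3 "n - 1"] assms(2) by auto
  have "card {r, g} < 8" using card_length[of "[r, g]"] by simp
  then obtain a where a: "a \<in> Q" "col a = col r" "a \<notin> {r, g}"
    using pick_col[OF assms(1), of "{r, g}" "col r"] p8 n0 by auto
  have "card {r, g} < n" using card_length[of "[r, g]"] assms(2) by simp
  then obtain i where i: "flip i a \<in> Q" "flip i a \<notin> {r, g}"
    using pick_nbr[OF assms(1) a(1), of "{r, g}"] by auto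
  obtain E where E: "ham_path (Q - {r, g}) E a (flip i a)"
    using two_faults[OF assms(1,2), of a "flip i a" r g] a i assms(3,4) by auto
  have "card Q \<ge> 16" using card_subcube[OF assms(1)] pow_ge[of 4 n] assms(2) by simp
  moreover have "card (Q - {r, g}) \<ge> card Q - card {r, g}" by (rule diff_card_le_card_Diff) simp
  moreover have "card {r, g} \<le> 2" using card_length[of "[r, g]"] by simp
  ultimately show ?thesis using E unfolding ham_cycle_def by force
qed

text \<open>The split separates the red faults, so only the green ones can be distributed in
  different ways: both in one half, or one in each.\<close>

lemma four_faults:
  assumes "subcube n Q" "4 \<le> n" "{r1, r2, g1, g2} \<subseteq> Q" "r1 \<noteq> r2" "g1 \<noteq> g2"
    "col r2 = col r1" "col g1 \<noteq> col r1" "col g2 \<noteq> col r1"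
  shows "\<exists>E. ham_cycle (Q - {r1, r2, g1, g2}) E"
  using assms(2,1,3-)
proof (induction n arbitrary: Q r1 r2 g1 g2 rule: dec_induct)
  case base
  then show ?case using four_faults_4 by simp
next
  case (step n)
  have n4: "4 \<le> n" and n0: "n \<noteq> 0" using step.hyps by auto
  have p8: "8 \<le> (2::nat) ^ (n - 1)" using pow_ge[of 3 "n - 1"] n4 by auto
  obtain i where i: "dir Q i" "(i \<in> supp r1) \<noteq> (i \<in> supp r2)"
    using subcube_eqI[OF step.prems(3,1)] step.prems(2) by auto
  \<comment> \<open>Both green faults are with \<open>r1\<close>. The extra deletion
    \<open>x\<close> makes this half neutral of mass 4, and the other half has only the fault
    \<open>r2\<close>.\<close>
  have unbalanced: "\<exists>E. ham_cycle (Q - {r1, r2, g1, g2}) E"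
    if "{r1, r2} \<subseteq> Q" "(i \<in> supp r1) \<noteq> (i \<in> supp r2)" "col r2 = col r1" "col g1 \<noteq> col r1"
      "col g2 \<noteq> col r1"
      "(i \<in> supp g1) = (i \<in> supp r1)" "(i \<in> supp g2) = (i \<in> supp r1)" for r1 r2
  proof -
    note prm = that
    define A where "A = half Q i (i \<in> supp r1)"
    define B where "B = half Q i (\<not> (i \<in> supp r1))"
    note AB = halves[OF step.prems(1) i(1) A_def B_def]
    have mem: "r1 \<in> A" "g1 \<in> A" "g2 \<in> A" "r2 \<in> B"
      using AB(7)[of r1] AB(7)[of g1] AB(7)[of g2] AB(8)[of r2] prm step.prems(2) by auto
    have "card {r1} < 8" by simp
    then obtain x where x: "x \<in> A" "col x = col r1" "x \<noteq> r1"
      using pick_col[OF AB(1), of "{r1}" "col r1"] p8 n0 by auto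
    have "card {g1, g2} < n" using card_length[of "[g1, g2]"] n4 by simp
    then obtain y where y: "y \<in> A" "y \<notin> {g1, g2}" "adj x y"
      using pick_nbr[OF AB(1) x(1), of "{g1, g2}"] by auto
    obtain E where E: "ham_cycle (A - {r1, x, g1, g2}) E"
      using step.IH[OF AB(1), of r1 x g1 g2] mem x prm(4,5) step.prems(4) by auto
    have cy: "col y \<noteq> col r1" using adj_col[OF y(3)] x by auto
    then have "y \<noteq> x" "y \<noteq> r1" using x by auto
    then have "y \<in> A - {r1, x, g1, g2}" using y by auto
    then obtain z where z: "{y, z} \<in> E" using ham_cycle_nbrs(1)[OF E] by blast
    note ed = ham_cycle_edge[OF E z]
    have "col z = col r1" using adj_col[OF ed(1)] cy by simp
    then obtain E' where E': "ham_path (B - {r2}) E' (flip i x) (flip i z)"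
      using one_fault[OF AB(2), of "flip i x" "flip i z" r2] AB(5) x ed mem n4 prm by auto
    have "\<exists>E. ham_cycle (A - {r1, x, g1, g2} \<union> insert x (B - {r2})) E"
      using ham_cycle_detour_via[OF E z _ E'] y(3) adj_sym x AB(4) AB(10)
        by (fastforce simp: disjoint_iff)
    moreover have "A - {r1, x, g1, g2} \<union> insert x (B - {r2}) = Q - {r1, r2, g1, g2}"
      using AB(3,4) mem x prm by auto
    ultimately show ?thesis by metis
  qed
  \<comment> \<open>Each half has a neutral pair, so an edge of a cycle in one half is replaced
    directly by a path in the other.\<close>
  have balanced: "\<exists>E. ham_cycle (Q - {r1, r2, g1, g2}) E"
    if "{g1, g2} \<subseteq> Q" "col g1 \<noteq> col r1" "col g2 \<noteq> col r1"
      "(i \<in> supp g1) = (i \<in> supp r1)" "(i \<in> supp g2) = (i \<in> supp r2)" for g1 g2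
  proof -
    note prm = that
    define A where "A = half Q i (i \<in> supp r1)"
    define B where "B = half Q i (\<not> (i \<in> supp r1))"
    note AB = halves[OF step.prems(1) i(1) A_def B_def]
    have mem: "r1 \<in> A" "g1 \<in> A" "g2 \<in> B" "r2 \<in> B"
      using AB(7)[of r1] AB(7)[of g1] AB(8)[of g2] AB(8)[of r2] prm i step.prems(2) by auto
    obtain E where E: "ham_cycle (A - {r1, g1}) E"
      using two_faults_cycle[OF AB(1) n4, of r1 g1] mem prm by auto
    have "card {g1, flip i r2} < 8" using card_length[of "[g1, flip i r2]"] by simp
    then obtain c where c: "c \<in> A" "c \<notin> {g1, flip i r2}" "col c \<noteq> col r1"
      using pick_col[OF AB(1), of "{g1, flip i r2}" "\<not> col r1"] p8 n0 by auto
    then have "c \<in> A - {r1, g1}" by auto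
    then obtain d where d: "d \<noteq> flip i g2" "{c, d} \<in> E"
      using ham_cycle_nbrs(1)[OF E] by metis
    note ed = ham_cycle_edge[OF E d(2)]
    have cd: "col d = col r1" using adj_col[OF ed(1)] c(3) by blast
    have "flip i d \<noteq> g2" "flip i c \<noteq> r2" using d c(2) by auto
    moreover have "flip i d \<noteq> r2" "flip i c \<noteq> g2" using c(3) cd prm step.prems(5) by auto
    ultimately obtain E' where E': "ham_path (B - {r2, g2}) E' (flip i c) (flip i d)"
      using two_faults[OF AB(2) n4, of "flip i c"
        "flip i d" r2 g2] AB(5) ed mem cd c prm step.prems(5) by auto
    have "(A - {r1, g1}) \<inter> (B - {r2, g2}) = {}" using AB(4) by auto
    from ham_cycle_detour[OF E d(2) E' _ _ this] AB(10)
    have "\<exists>E. ham_cycle ((A - {r1, g1}) \<union> (B - {r2, g2})) E" by auto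
    moreover have "(A - {r1, g1}) \<union> (B - {r2, g2}) = Q - {r1, r2, g1, g2}"
      using AB(3,4) mem by auto
    ultimately show ?thesis by metis
  qed
  consider "(i \<in> supp g1) = (i \<in> supp r1)" "(i \<in> supp g2) = (i \<in> supp r1)"
    | "(i \<in> supp g1) = (i \<in> supp r2)" "(i \<in> supp g2) = (i \<in> supp r2)"
    | "(i \<in> supp g1) = (i \<in> supp r1)" "(i \<in> supp g2) = (i \<in> supp r2)"
    | "(i \<in> supp g1) = (i \<in> supp r2)" "(i \<in> supp g2) = (i \<in> supp r1)"
    using i(2) by blast
  then show ?case
  proof cases
    case 1
    then show ?thesis using unbalanced[of r1 r2] i step.prems by auto
  next
    case 2
    then have "\<exists>E. ham_cycle (Q - {r2, r1, g1, g2}) E"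
      using unbalanced[of r2 r1] i step.prems by auto
    then show ?thesis by (simp add: insert_commute)
  next
    case 3
    then show ?thesis using balanced[of g1 g2] step.prems by auto
  next
    case 4
    then have "\<exists>E. ham_cycle (Q - {r1, r2, g2, g1}) E"
      using balanced[of g2 g1] step.prems by auto
    then show ?thesis by (simp add: insert_commute)
  qed
qed

text \<open>The halves have neutral faults of mass 4 and 2, for which dimension 4 suffices. This is
  why it already applies in dimension 5 and spares the corresponding certificates.\<close>

lemma six_faults_balanced:
  assumes Q: "subcube (Suc n) Q" "4 \<le> n" "{r1, r2, r3, g1, g2, g3} \<subseteq> Q" "r2 \<noteq> r3" "g2 \<noteq> g3"
    and c: "col r2 = col r1" "col r3 = col r1" "col g1 \<noteq> col r1" "col g2 \<noteq> col r1" "col g3 \<noteq> col r1"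
    and i: "dir Q i" "(i \<in> supp r2) \<noteq> (i \<in> supp r1)" "(i \<in> supp r3) \<noteq> (i \<in> supp r1)"
      "(i \<in> supp g1) = (i \<in> supp r1)" "(i \<in> supp g2) \<noteq> (i \<in> supp r1)"
        "(i \<in> supp g3) \<noteq> (i \<in> supp r1)"
  shows "\<exists>E. ham_cycle (Q - {r1, r2, r3, g1, g2, g3}) E"
proof -
  have n0: "n \<noteq> 0" and p8: "8 \<le> (2::nat) ^ (n - 1)" using pow_ge[of 3 "n - 1"] assms(2) by auto
  define A where "A = half Q i (i \<in> supp r2)"
  define B where "B = half Q i (\<not> (i \<in> supp r2))"
  note AB = halves[OF Q(1) i(1) A_def B_def]
  have mem: "r2 \<in> A" "r3 \<in> A" "g2 \<in> A" "g3 \<in> A" "r1 \<in> B" "g1 \<in> B"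
    using AB(7)[of r2] AB(7)[of r3] AB(7)[of g2] AB(7)[of g3] AB(8)[of r1] AB(8)[of g1] Q(3) i
      by auto
  obtain E where E: "ham_cycle (A - {r2, r3, g2, g3}) E"
    using four_faults[OF AB(1) Q(2), of r2 r3 g2 g3] mem Q c by auto
  have "card {g2, g3, flip i r1} < 8" using card_length[of "[g2, g3, flip i r1]"] by simp
  then obtain x where x: "x \<in> A" "x \<notin> {g2, g3, flip i r1}" "col x \<noteq> col r1"
    using pick_col[OF AB(1), of "{g2, g3, flip i r1}" "\<not> col r1"] p8 n0 by auto
  then have "x \<in> A - {r2, r3, g2, g3}" using c by auto
  then obtain d where d: "d \<noteq> flip i g1" "{x, d} \<in> E"
    using ham_cycle_nbrs(1)[OF E] by metis
  note ed = ham_cycle_edge[OF E d(2)]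
  have cd: "col d = col r1" using adj_col[OF ed(1)] x(3) by blast
  have "flip i d \<noteq> g1" "flip i x \<noteq> r1" using d x(2) by auto
  moreover have "flip i d \<noteq> r1" "flip i x \<noteq> g1" using x(3) cd c by auto
  ultimately obtain E' where E': "ham_path (B - {r1, g1}) E' (flip i x) (flip i d)"
    using two_faults[OF AB(2) Q(2), of "flip i x" "flip i d" r1 g1] AB(5) ed mem cd x c by auto
  have "(A - {r2, r3, g2, g3}) \<inter> (B - {r1, g1}) = {}" using AB(4) by auto
  from ham_cycle_detour[OF E d(2) E' _ _ this] AB(10)
  have "\<exists>E. ham_cycle ((A - {r2, r3, g2, g3}) \<union> (B - {r1, g1})) E" by auto
  moreover have "(A - {r2, r3, g2, g3}) \<union> (B - {r1, g1}) = Q - {r1, r2, r3, g1, g2, g3}"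
    using AB(3,4) mem by auto
  ultimately show ?thesis by metis
qed

section \<open>Cubes with six faults\<close>

text \<open>The two cycle edges at \<open>y\<close> have different directions, so at most one has
  direction \<open>j\<close>. The other stays on the same side, which confines a detour to one
  quarter.\<close>

lemma ham_cycle_half_nbr:
  assumes "ham_cycle S E" "y \<in> S"
  shows "\<exists>z. {y, z} \<in> E \<and> (j \<in> supp z) = (j \<in> supp y)"
proof -
  obtain z w where zw: "z \<noteq> w" "{y, z} \<in> E" "{y, w} \<in> E"
    using ham_cycle_nbrs(1)[OF assms] by blast
  then obtain k l where "z = flip k y" "w = flip l y"
    using ham_cycle_edge(1)[OF assms(1)] unfolding adj_def by metis
  then show ?thesis using zw by (metis mem_flip)
qed

text \<open>A predicate of the dimension alone, so that the cases of the inductive step can take the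
  induction hypothesis as an assumption.\<close>

definition six_ok :: "nat \<Rightarrow> bool" where
  "six_ok n \<longleftrightarrow> (\<forall>Q r1 r2 r3 g1 g2 g3. subcube n Q \<longrightarrow> {r1, r2, r3, g1, g2, g3} \<subseteq> Q \<longrightarrow>
     distinct [r1, r2, r3] \<longrightarrow> distinct [g1, g2, g3] \<longrightarrow> col r2 = col r1 \<longrightarrow> col r3 = col r1 \<longrightarrow>
     col g1 \<noteq> col r1 \<longrightarrow> col g2 \<noteq> col r1 \<longrightarrow> col g3 \<noteq> col r1 \<longrightarrow>
     (\<exists>E. ham_cycle (Q - {r1, r2, r3, g1, g2, g3}) E))"

lemma six_okD:
  assumes "six_ok n" "subcube n Q" "{r1, r2, r3, g1, g2, g3} \<subseteq> Q"
    "distinct [r1, r2, r3]" "distinct [g1, g2, g3]" "col r2 = col r1" "col r3 = col r1"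
    "col g1 \<noteq> col r1" "col g2 \<noteq> col r1" "col g3 \<noteq> col r1"
  shows "\<exists>E. ham_cycle (Q - {r1, r2, r3, g1, g2, g3}) E"
  using assms unfolding six_ok_def by blast

text \<open>If a property holds for one or two of three elements, one element is the odd one out. It
  is put first, and \<open>m\<close> tells on which side it is.\<close>

lemma isolated:
  assumes "length (filter P [a, b, c]) = m" "m \<in> {1, 2}" "distinct [a, b, c]"
  shows "\<exists>x y z. {x, y, z} = {a, b, c} \<and> distinct [x, y, z] \<and> P x = (m = 1) \<and> P y = (m \<noteq> 1) \<and> P z =
      (m \<noteq> 1)"
proof -
  have "(P a = (m = 1) \<and> P b = (m \<noteq> 1) \<and> P c = (m \<noteq> 1)) \<or> (P b = (m = 1) \<and> P a = (m \<noteq> 1) \<and> P c = (m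
      \<noteq> 1))
    \<or> (P c = (m = 1) \<and> P b = (m \<noteq> 1) \<and> P a = (m \<noteq> 1))"
    using assms(1,2) by (auto split: if_splits)
  then show ?thesis
  proof (elim disjE)
    assume "P a = (m = 1) \<and> P b = (m \<noteq> 1) \<and> P c = (m \<noteq> 1)"
    then show ?thesis using assms(3) by (intro exI[of _ a] exI[of _ b] exI[of _ c]) auto
  next
    assume "P b = (m = 1) \<and> P a = (m \<noteq> 1) \<and> P c = (m \<noteq> 1)"
    then show ?thesis using assms(3) by (intro exI[of _ b] exI[of _ a] exI[of _ c]) auto
  next
    assume "P c = (m = 1) \<and> P b = (m \<noteq> 1) \<and> P a = (m \<noteq> 1)"
    then show ?thesis using assms(3) by (intro exI[of _ c] exI[of _ b] exI[of _ a]) auto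
  qed
qed

text \<open>
  Three vertices of one colour are determined up to symmetry by the numbers of directions that isolate
  each of them from the two others. The order of directions \<open>D1, D2, D3, D0\<close> below brings the three red
  faults into one of three normal positions.
\<close>

definition iso :: "vertex set \<Rightarrow> vertex \<Rightarrow> vertex \<Rightarrow> vertex \<Rightarrow> nat set" where
  "iso Q x y z = {i. dir Q i \<and> (i \<in> supp y) \<noteq> (i \<in> supp x) \<and> (i \<in> supp z) \<noteq> (i \<in> supp x)}"

lemma iso_commute: "iso Q x y z = iso Q x z y"
  by (auto simp: iso_def)

lemma balancedD:
  "balanced d R G \<Longrightarrow> \<exists>k m. k < d \<and> m \<in> {1, 2} \<and>
     length (filter (\<lambda>c. c ! k) R) = m \<and> length (filter (\<lambda>c. c ! k) G) = m"
  by (auto simp: balanced_def Let_def)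

text \<open>Here \<open>a\<close>, \<open>b\<close>, \<open>c\<close> count the directions isolating
  each of three vertices and \<open>d\<close> the rest. Equal colours give \<open>a\<close>,
  \<open>b\<close>, \<open>c\<close> the same parity: if odd they are 1,1,1 or 3,1,1; if even, 2,2,2
  exceeds 5, and \<open>b = c = 0\<close> would make two of the vertices equal.\<close>

lemma isolation_profile:
  fixes a b c d :: nat
  assumes "a + b + c + d = 5" "even (a + b)" "even (a + c)" "0 < b + c" "c \<le> b" "b \<le> a"
  shows "a = 1 \<and> b = 1 \<and> c = 1 \<and> d = 2 \<or> a = 2 \<and> b = 2 \<and> c = 0 \<and> d = 1 \<or> a = 3 \<and> b = 1 \<and> c = 1 \<and> d =
      0"
proof -
  have "c = 0 \<or> c = 1" "b = 0 \<or> b = 1 \<or> b = 2" "a = 0 \<or> a = 1 \<or> a = 2 \<or> a = 3 \<or> a = 4 \<or> a = 5"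
    using assms by linarith+
  then show ?thesis using assms by (elim disjE) simp_all
qed

text \<open>With base vertex \<open>r1\<close> and the directions grouped by the red fault they
  isolate, the codes of the red faults depend on the sizes of the groups only.\<close>

lemma six_faults_5_sorted:
  assumes Q: "subcube 5 Q" "{r1, r2, r3, g1, g2, g3} \<subseteq> Q"
    "distinct [r1, r2, r3]" "distinct [g1, g2, g3]" and c: "col r2 = col r1" "col r3 = col r1"
    "col g1 \<noteq> col r1" "col g2 \<noteq> col r1" "col g3 \<noteq> col r1"
    and le: "card (iso Q r3 r1 r2) \<le> card (iso Q r2 r1 r3)"
      "card (iso Q r2 r1 r3) \<le> card (iso Q r1 r2 r3)"
  shows "\<exists>E. ham_cycle (Q - {r1, r2, r3, g1, g2, g3}) E"
proof -
  define D1 where "D1 = iso Q r1 r2 r3"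
  define D2 where "D2 = iso Q r2 r1 r3"
  define D3 where "D3 = iso Q r3 r1 r2"
  define D0 where "D0 = {i. dir Q i} - (D1 \<union> D2 \<union> D3)"
  note Ds = D1_def D2_def D3_def iso_def
  have I: "finite {i. dir Q i}" "card {i. dir Q i} = 5" using subcube_dirs[OF Q(1)] by auto
  have "D1 \<subseteq> {i. dir Q i}" "D2 \<subseteq> {i. dir Q i}" "D3 \<subseteq> {i. dir Q i}" "D0 \<subseteq> {i. dir Q i}"
    by (auto simp: Ds D0_def)
  then have fin: "finite D1" "finite D2" "finite D3" "finite D0"
    using finite_subset[OF _ I(1)] by blast+
  have un: "D1 \<union> D2 \<union> D3 \<union> D0 = {i. dir Q i}" by (auto simp: Ds D0_def)
  have disj: "D1 \<inter> D2 = {}" "D1 \<inter> D3 = {}" "D2 \<inter> D3 = {}" "(D1 \<union> D2 \<union> D3) \<inter> D0 = {}"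
    by (auto simp: Ds D0_def)
  obtain l1 l2 l3 l0 where l: "set l1 = D1" "distinct l1" "set l2 = D2" "distinct l2"
    "set l3 = D3" "distinct l3" "set l0 = D0" "distinct l0"
    using fin finite_distinct_list by metis
  define ds where "ds = l1 @ l2 @ l3 @ l0"
  have ds: "distinct ds" "set ds = {i. dir Q i}" using l un disj by (auto simp: ds_def)
  have len: "length l1 + length l2 + length l3 + length l0 = 5"
    using I(2) ds distinct_card[OF ds(1)] by (simp add: ds_def)
  have lc: "length l1 = card D1" "length l2 = card D2" "length l3 = card D3"
    using l distinct_card by metis+
  have r: "r1 \<in> Q" "r2 \<in> Q" "r3 \<in> Q" using Q(2) by auto
  have m12: "i \<in> D1 \<union> D2 \<longleftrightarrow> (i \<in> supp r2) \<noteq> (i \<in> supp r1)" for i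
    using subcube_sep[OF Q(1) r(2,1), of i] by (auto simp: Ds)
  have m13: "i \<in> D1 \<union> D3 \<longleftrightarrow> (i \<in> supp r3) \<noteq> (i \<in> supp r1)" for i
    using subcube_sep[OF Q(1) r(3,1), of i] by (auto simp: Ds)
  have m23: "i \<in> D2 \<union> D3 \<longleftrightarrow> (i \<in> supp r3) \<noteq> (i \<in> supp r2)" for i
    using subcube_sep[OF Q(1) r(3,2), of i] by (auto simp: Ds)
  have ev: "even (length l1 + length l2)" "even (length l1 + length l3)"
  proof -
    have "card (D1 \<union> D2) = length l1 + length l2" "card (D1 \<union> D3) = length l1 + length l3"
      using card_Un_disjoint fin disj lc by metis+
    moreover have "finite (D1 \<union> D2)" "finite (D1 \<union> D3)" using fin by auto
    ultimately show "even (length l1 + length l2)" "even (length l1 + length l3)"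
      using col_symdiff[OF _ m12] col_symdiff[OF _ m13] c(1,2) by metis+
  qed
  have "D2 \<union> D3 \<noteq> {}"
    using subcube_eqI[of r2 r3, OF _ Q(1) r(2,3)] Q(3) m23 by auto
  then have "0 < length l2 + length l3" using lc fin by (auto simp: card_gt_0_iff)
  with isolation_profile[OF len ev] le[folded D1_def D2_def D3_def, folded lc]
  have cases: "length l1 = 1 \<and> length l2 = 1 \<and> length l3 = 1 \<and> length l0 = 2 \<or>
    length l1 = 2 \<and> length l2 = 2 \<and> length l3 = 0 \<and> length l0 = 1 \<or>
    length l1 = 3 \<and> length l2 = 1 \<and> length l3 = 1 \<and> length l0 = 0"
    by blast
  have cr1: "code r1 ds r1 = replicate 5 False"
    using code_replicate[of ds r1 r1 False] len by (simp add: ds_def)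
  have cr2: "code r1 ds r2 = replicate (length l1) True @ replicate (length l2) True @
      replicate (length l3) False @ replicate (length l0) False"
    unfolding ds_def code_append
    by (intro arg_cong2[of _ _ _ _ "(@)"] code_replicate) (auto simp: l Ds D0_def)
  have cr3: "code r1 ds r3 = replicate (length l1) True @ replicate (length l2) False @
      replicate (length l3) True @ replicate (length l0) False"
    unfolding ds_def code_append
    by (intro arg_cong2[of _ _ _ _ "(@)"] code_replicate) (auto simp: l Ds D0_def)
  have "\<exists>hs. set hs = {g1, g2, g3} \<and> length hs = card {g1, g2, g3} \<and>
    map (code r1 ds) hs \<in> set (combs (card {g1, g2, g3}) (odd_codes 5))"
    by (rule code_combs[OF Q(1) ds]) (use Q c in auto)
  moreover have c3: "card {g1, g2, g3} = 3" using Q(4) by simp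
  ultimately obtain hs where hs: "set hs = {g1, g2, g3}" "length hs = 3"
    "map (code r1 ds) hs \<in> set (combs 3 (odd_codes 5))"
    by auto
  show ?thesis
  proof (cases "balanced 5 (map (code r1 ds) [r1, r2, r3]) (map (code r1 ds) hs)")
    case True
    then obtain k m where k: "k < 5" "m \<in> {1, 2}"
      "length (filter (\<lambda>c. c ! k) (map (code r1 ds) [r1, r2, r3])) = m"
      "length (filter (\<lambda>c. c ! k) (map (code r1 ds) hs)) = m"
      using balancedD by blast
    define P where "P = (\<lambda>x. code r1 ds x ! k)"
    have "length ds = 5" using ds I(2) by (metis distinct_card)
    then have i: "dir Q (ds ! k)" using k(1) ds(2) by (metis mem_Collect_eq nth_mem)
    have P: "P x = ((ds ! k \<in> supp x) \<noteq> (ds ! k \<in> supp r1))" for x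
      using k(1) \<open>length ds = 5\<close> by (simp add: P_def code_def)
    obtain h1 h2 h3 where h: "hs = [h1, h2, h3]" using hs(2)
      by (auto simp: numeral_eq_Suc length_Suc_conv)
    have dh: "distinct [h1, h2, h3]" using c3 hs(1,2) h card_distinct by metis
    have len: "length (filter P [r1, r2, r3]) = m" "length (filter P [h1, h2, h3]) = m"
      using k(3,4) unfolding filter_map length_map h P_def comp_def by simp_all
    \<comment> \<open>\<open>P\<close> describes the side not containing \<open>r1\<close>. Since
      \<open>m\<close> is the same for both colours, the isolated red \<open>s1\<close> and the
      isolated green \<open>t1\<close> are on the same side.\<close>
    obtain s1 s2 s3 where s: "{s1, s2, s3} = {r1, r2, r3}" "distinct [s1, s2, s3]"
      "P s1 = (m = 1)" "P s2 = (m \<noteq> 1)" "P s3 = (m \<noteq> 1)"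
      using isolated[OF len(1) k(2) Q(3)] by blast
    obtain t1 t2 t3 where t: "{t1, t2, t3} = {h1, h2, h3}" "distinct [t1, t2, t3]"
      "P t1 = (m = 1)" "P t2 = (m \<noteq> 1)" "P t3 = (m \<noteq> 1)"
      using isolated[OF len(2) k(2) dh] by blast
    have t': "{t1, t2, t3} = {g1, g2, g3}" using t(1) hs(1) h by simp
    have sc: "s1 \<in> Q" "s2 \<in> Q" "s3 \<in> Q" "col s1 = col r1" "col s2 = col r1" "col s3 = col r1"
      using s(1) r c(1,2) by (metis insertCI insertE singletonD)+
    have tc: "t1 \<in> Q" "t2 \<in> Q" "t3 \<in> Q" "col t1 \<noteq> col r1" "col t2 \<noteq> col r1" "col t3 \<noteq> col r1"
      using t' Q(2) c(3-5) by (metis insertCI insertE insert_subset singletonD)+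
    have "\<exists>E. ham_cycle (Q - {s1, s2, s3, t1, t2, t3}) E"
      by (rule six_faults_balanced[of 4 Q s1 s2 s3 t1 t2 t3 "ds ! k"])
        (use Q(1) sc tc s t i in \<open>auto simp: P\<close>)
    moreover have "{s1, s2, s3, t1, t2, t3} = {s1, s2, s3} \<union> {t1, t2, t3}" by auto
    then have "{s1, s2, s3, t1, t2, t3} = {r1, r2, r3, g1, g2, g3}" unfolding s(1) t' by auto
    ultimately show ?thesis by simp
  next
    case False
    have "\<exists>c ks. length c = 5 \<and> cycle_cert 5 (map (code r1 ds) [r1, r2, r3] @ map (code r1 ds) hs) c
        ks"
      using cases
    proof (elim disjE)
      assume "length l1 = 1 \<and> length l2 = 1 \<and> length l3 = 1 \<and> length l0 = 2"
      then have R: "map (code r1 ds) [r1, r2, r3] = [[False, False, False, False, False],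
        [True, True, False, False, False], [True, False, True, False, False]]"
        using cr1 cr2 cr3 by (simp add: numeral_eq_Suc)
      then have "map (code r1 ds) hs \<in> set (filter (\<lambda>G. \<not> balanced 5 [[False, False, False, False,
          False],
        [True, True, False, False, False], [True, False, True, False, False]] G) (combs 3 (odd_codes
          5)))"
        using hs(3) False by simp
      from list_all2_cert[OF six_fault_certs_3_5 this] show ?thesis
        unfolding R by (intro exI[of _ "[False, True, True, False, False]"]) simp
    next
      assume "length l1 = 2 \<and> length l2 = 2 \<and> length l3 = 0 \<and> length l0 = 1"
      then have R: "map (code r1 ds) [r1, r2, r3] = [[False, False, False, False, False],
        [True, True, True, True, False], [True, True, False, False, False]]"
        using cr1 cr2 cr3 by (simp add: numeral_eq_Suc)
      then have "map (code r1 ds) hs \<in> set (filter (\<lambda>G. \<not> balanced 5 [[False, False, False, False,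
          False],
        [True, True, True, True, False], [True, True, False, False, False]] G) (combs 3 (odd_codes
          5)))"
        using hs(3) False by simp
      from list_all2_cert[OF six_fault_certs_15_3 this] show ?thesis
        unfolding R by (intro exI[of _ "[True, False, True, False, False]"]) simp
    next
      assume "length l1 = 3 \<and> length l2 = 1 \<and> length l3 = 1 \<and> length l0 = 0"
      then have R: "map (code r1 ds) [r1, r2, r3] = [[False, False, False, False, False],
        [True, True, True, True, False], [True, True, True, False, True]]"
        using cr1 cr2 cr3 by (simp add: numeral_eq_Suc)
      then have "map (code r1 ds) hs \<in> set (filter (\<lambda>G. \<not> balanced 5 [[False, False, False, False,
          False],
        [True, True, True, True, False], [True, True, True, False, True]] G) (combs 3 (odd_codes
          5)))"
        using hs(3) False by simp
      from list_all2_cert[OF six_fault_certs_15_23 this] show ?thesis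
        unfolding R by (intro exI[of _ "[True, True, False, False, False]"]) simp
    qed
    then have "\<exists>E. ham_cycle (Q - set ([r1, r2, r3] @ hs)) E"
      using cycle_cert_sound[OF Q(1) ds, of "[r1, r2, r3] @ hs"] r hs(1) Q(2) by auto
    moreover have "set ([r1, r2, r3] @ hs) = {r1, r2, r3, g1, g2, g3}" using hs(1) by auto
    ultimately show ?thesis by simp
  qed
qed

lemma six_ok_5: "six_ok 5"
  unfolding six_ok_def
proof (intro allI impI)
  fix Q r1 r2 r3 g1 g2 g3
  assume Q: "subcube 5 Q" "{r1, r2, r3, g1, g2, g3} \<subseteq> Q"
    "distinct [r1, r2, r3]" "distinct [g1, g2, g3]" and c: "col r2 = col r1" "col r3 = col r1"
    "col g1 \<noteq> col r1" "col g2 \<noteq> col r1" "col g3 \<noteq> col r1"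
  \<comment> \<open>The claim is symmetric in the red faults, so they may be sorted by their numbers
    of isolating directions.\<close>
  have main: "\<exists>E. ham_cycle (Q - {r1, r2, r3, g1, g2, g3}) E"
    if s: "{s1, s2, s3} = {r1, r2, r3}" "distinct [s1, s2, s3]"
      "card (iso Q s3 s1 s2) \<le> card (iso Q s2 s1 s3)"
        "card (iso Q s2 s1 s3) \<le> card (iso Q s1 s2 s3)"
    for s1 s2 s3
  proof -
    have sc: "s1 \<in> Q" "s2 \<in> Q" "s3 \<in> Q" "col s1 = col r1" "col s2 = col r1" "col s3 = col r1"
      using s(1) Q(2) c(1,2) by (metis insertCI insertE insert_subset singletonD)+
    have "\<exists>E. ham_cycle (Q - {s1, s2, s3, g1, g2, g3}) E"
      by (rule six_faults_5_sorted) (use Q c sc s in auto)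
    moreover have "{s1, s2, s3, g1, g2, g3} = {s1, s2, s3} \<union> {g1, g2, g3}" by auto
    then have "{s1, s2, s3, g1, g2, g3} = {r1, r2, r3, g1, g2, g3}" unfolding s(1) by auto
    ultimately show ?thesis by simp
  qed
  define p1 p2 p3 where "p1 = card (iso Q r1 r2 r3)" and "p2 = card (iso Q r2 r1 r3)"
    and "p3 = card (iso Q r3 r1 r2)"
  note ps = p1_def p2_def p3_def
  have comm: "iso Q r1 r3 r2 = iso Q r1 r2 r3" "iso Q r2 r3 r1 = iso Q r2 r1 r3"
    "iso Q r3 r2 r1 = iso Q r3 r1 r2"
    using iso_commute by blast+
  consider "p3 \<le> p2" "p2 \<le> p1" | "p2 \<le> p3" "p3 \<le> p1" | "p3 \<le> p1" "p1 \<le> p2"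
    | "p1 \<le> p3" "p3 \<le> p2" | "p2 \<le> p1" "p1 \<le> p3" | "p1 \<le> p2" "p2 \<le> p3"
    by linarith
  then show "\<exists>E. ham_cycle (Q - {r1, r2, r3, g1, g2, g3}) E"
  proof cases
    case 1
    then show ?thesis using main[of r1 r2 r3] Q(3) by (simp add: ps comm)
  next
    case 2
    then show ?thesis using main[of r1 r3 r2] Q(3) by (auto simp: ps comm)
  next
    case 3
    then show ?thesis using main[of r2 r1 r3] Q(3) by (auto simp: ps comm)
  next
    case 4
    then show ?thesis using main[of r2 r3 r1] Q(3) by (auto simp: ps comm)
  next
    case 5
    then show ?thesis using main[of r3 r1 r2] Q(3) by (auto simp: ps comm)
  next
    case 6
    then show ?thesis using main[of r3 r2 r1] Q(3) by (auto simp: ps comm)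
  qed
qed

text \<open>The larger part consists of two red and three green faults; one more deletion
  \<open>x\<close> makes it neutral of mass 6, and the half of \<open>r1\<close> is crossed with one
  fault.\<close>

lemma six_faults_5_1:
  assumes ok: "six_ok n"
    and Q: "subcube (Suc n) Q" "5 \<le> n" "{r1, r2, r3, g1, g2, g3} \<subseteq> Q" "r2 \<noteq> r3"
      "distinct [g1, g2, g3]"
    and c: "col r2 = col r1" "col r3 = col r1" "col g1 \<noteq> col r1" "col g2 \<noteq> col r1" "col g3 \<noteq> col r1"
    and i: "dir Q i" "(i \<in> supp r2) \<noteq> (i \<in> supp r1)" "(i \<in> supp r3) \<noteq> (i \<in> supp r1)"
      "(i \<in> supp g1) \<noteq> (i \<in> supp r1)" "(i \<in> supp g2) \<noteq> (i \<in> supp r1)"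
        "(i \<in> supp g3) \<noteq> (i \<in> supp r1)"
  shows "\<exists>E. ham_cycle (Q - {r1, r2, r3, g1, g2, g3}) E"
proof -
  have n0: "n \<noteq> 0" and p8: "8 \<le> (2::nat) ^ (n - 1)" using pow_ge[of 3 "n - 1"] Q(2) by auto
  define A where "A = half Q i (i \<in> supp r2)"
  define B where "B = half Q i (\<not> (i \<in> supp r2))"
  note AB = halves[OF Q(1) i(1) A_def B_def]
  have mem: "r2 \<in> A" "r3 \<in> A" "g1 \<in> A" "g2 \<in> A" "g3 \<in> A" "r1 \<in> B"
    using AB(7)[of r2] AB(7)[of r3] AB(7)[of g1] AB(7)[of g2] AB(7)[of g3] AB(8)[of r1] Q(3) i
      by auto
  have "card {r2, r3} < 8" using card_length[of "[r2, r3]"] by simp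
  then obtain x where x: "x \<in> A" "col x = col r1" "x \<notin> {r2, r3}"
    using pick_col[OF AB(1), of "{r2, r3}" "col r1"] p8 n0 by auto
  have "card {g1, g2, g3} < n" using card_length[of "[g1, g2, g3]"] Q(2) by simp
  then obtain y where y: "y \<in> A" "y \<notin> {g1, g2, g3}" "adj x y"
    using pick_nbr[OF AB(1) x(1), of "{g1, g2, g3}"] by auto
  obtain E where E: "ham_cycle (A - {x, r2, r3, g1, g2, g3}) E"
    using six_okD[OF ok AB(1), of x r2 r3 g1 g2 g3] mem x Q(4,5) c by auto
  have cy: "col y \<noteq> col r1" using adj_col[OF y(3)] x by auto
  then have "y \<in> A - {x, r2, r3, g1, g2, g3}" using y x(2) c by auto
  then obtain z where z: "{y, z} \<in> E" using ham_cycle_nbrs(1)[OF E] by blast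
  note ed = ham_cycle_edge[OF E z]
  have "col z = col r1" using adj_col[OF ed(1)] cy by simp
  then obtain E' where E': "ham_path (B - {r1}) E' (flip i x) (flip i z)"
    using one_fault[OF AB(2), of "flip i x" "flip i z" r1] AB(5) x ed mem Q(2) by auto
  have "\<exists>E. ham_cycle (A - {x, r2, r3, g1, g2, g3} \<union> insert x (B - {r1})) E"
    using ham_cycle_detour_via[OF E z _ E'] y(3) adj_sym x AB(4) AB(10)
      by (fastforce simp: disjoint_iff)
  moreover have "A - {x, r2, r3, g1, g2, g3} \<union> insert x (B - {r1}) = Q - {r1, r2, r3, g1, g2, g3}"
    using AB(3,4) mem x c by auto
  ultimately show ?thesis by metis
qed

text \<open>The half \<open>B\<close> with one red and three green faults needs two extra deletions.
  The direction \<open>j\<close> gives each quarter of \<open>A\<close> one of \<open>r2\<close>,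
  \<open>r3\<close>, and \<open>x\<close>, \<open>x'\<close> are placed in the quarters of
  \<open>B\<close> facing them.\<close>

lemma six_faults_2_4:
  assumes ok: "six_ok n"
    and Q: "subcube (Suc n) Q" "5 \<le> n" "{r1, r2, r3, g1, g2, g3} \<subseteq> Q" "r2 \<noteq> r3"
      "distinct [g1, g2, g3]"
    and c: "col r2 = col r1" "col r3 = col r1" "col g1 \<noteq> col r1" "col g2 \<noteq> col r1" "col g3 \<noteq> col r1"
    and i: "dir Q i" "(i \<in> supp r2) \<noteq> (i \<in> supp r1)" "(i \<in> supp r3) \<noteq> (i \<in> supp r1)"
      "(i \<in> supp g1) = (i \<in> supp r1)" "(i \<in> supp g2) = (i \<in> supp r1)"
        "(i \<in> supp g3) = (i \<in> supp r1)"
  shows "\<exists>E. ham_cycle (Q - {r1, r2, r3, g1, g2, g3}) E"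
proof -
  obtain m where m: "n = Suc m" "4 \<le> m" using Q(2) by (cases n) auto
  have m0: "m \<noteq> 0" and p8: "8 \<le> (2::nat) ^ (m - 1)" using pow_ge[of 3 "m - 1"] m(2) by auto
  define A where "A = half Q i (i \<in> supp r2)"
  define B where "B = half Q i (\<not> (i \<in> supp r2))"
  note AB = halves[OF Q(1) i(1) A_def B_def]
  have mem: "r2 \<in> A" "r3 \<in> A" "g1 \<in> B" "g2 \<in> B" "g3 \<in> B" "r1 \<in> B"
    using AB(7)[of r2] AB(7)[of r3] AB(8)[of g1] AB(8)[of g2] AB(8)[of g3] AB(8)[of r1] Q(3) i
      by auto
  obtain j where j: "dir Q j" "(j \<in> supp r2) \<noteq> (j \<in> supp r3)"
    using subcube_eqI[OF Q(4,1)] Q(3) by auto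
  have "j \<noteq> i" using j i by auto
  then have dj: "dir A j" "dir B j" using dir_half j(1) by (auto simp: A_def B_def)
  define A0 where "A0 = half A j (j \<in> supp r2)"
  define A1 where "A1 = half A j (\<not> (j \<in> supp r2))"
  note A01 = halves[OF AB(1)[unfolded m] dj(1) A0_def A1_def]
  define B0 where "B0 = half B j (j \<in> supp r2)"
  define B1 where "B1 = half B j (\<not> (j \<in> supp r2))"
  note B01 = halves[OF AB(2)[unfolded m] dj(2) B0_def B1_def]
  \<comment> \<open>Crossing in direction \<open>i\<close> does not change the coordinate
    \<open>j\<close>, so quarters face each other.\<close>
  have cross: "x \<in> B0 \<Longrightarrow> flip i x \<in> A0" "x \<in> B1 \<Longrightarrow> flip i x \<in> A1" for x
    using A01(7,8) B01(7,8) AB(6) \<open>j \<noteq> i\<close> by (auto simp: mem_flip)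
  have mem2: "r2 \<in> A0" "r3 \<in> A1" using A01(7,8) mem j by auto
  obtain x where x: "x \<in> B0" "col x = col r1" "x \<noteq> r1"
    using pick_col[OF B01(1), of "{r1}" "col r1"] p8 m0 by auto
  obtain x' where x': "x' \<in> B1" "col x' = col r1" "x' \<noteq> r1"
    using pick_col[OF B01(2), of "{r1}" "col r1"] p8 m0 by auto
  have cd: "card {g1, g2, g3} < m" using card_length[of "[g1, g2, g3]"] m(2) by simp
  obtain y where y: "y \<in> B0" "y \<notin> {g1, g2, g3}" "adj x y"
    using pick_nbr[OF B01(1) x(1) _ cd] by auto
  obtain y' where y': "y' \<in> B1" "y' \<notin> {g1, g2, g3}" "adj x' y'"
    using pick_nbr[OF B01(2) x'(1) _ cd] by auto
  define S where "S = B - {r1, x, x', g1, g2, g3}"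
  have "x \<noteq> x'" using x x' B01(4) by auto
  then obtain E where E: "ham_cycle S E"
    using six_okD[OF ok AB(2), of r1 x x' g1 g2 g3] mem x x' Q(5) c B01(3) by (auto simp: S_def)
  have cy: "col y \<noteq> col r1" "col y' \<noteq> col r1" using adj_col[OF y(3)] adj_col[OF y'(3)] x x' by auto
  then have yS: "y \<in> S" "y' \<in> S" using y y' x(2) x'(2) B01(3) by (auto simp: S_def)
  obtain z where z: "{y, z} \<in> E" "(j \<in> supp z) = (j \<in> supp y)"
    using ham_cycle_half_nbr[OF E yS(1)] by blast
  obtain z' where z': "{y', z'} \<in> E" "(j \<in> supp z') = (j \<in> supp y')"
    using ham_cycle_half_nbr[OF E yS(2)] by blast
  note ed = ham_cycle_edge[OF E z(1)] and ed' = ham_cycle_edge[OF E z'(1)]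
  have zB: "z \<in> B0" "z' \<in> B1" using z z' ed ed' y y' B01(7,8) by (auto simp: S_def)
  have zc: "col z = col r1" "col z' = col r1" using adj_col[OF ed(1)] adj_col[OF ed'(1)] cy by auto
  have zx: "z \<noteq> x" "z' \<noteq> x'" using ed ed' by (auto simp: S_def)
  obtain E1 where E1: "ham_path (A0 - {r2}) E1 (flip i x) (flip i z)"
    using one_fault[OF A01(1), of "flip i x" "flip i z" r2] cross x zB zc zx mem2 m(2) c by auto
  obtain E2 where E2: "ham_path (A1 - {r3}) E2 (flip i x') (flip i z')"
    using one_fault[OF A01(2), of "flip i x'" "flip i z'" r3] cross x' zB zc zx mem2 m(2) c by auto
  have SB: "S \<subseteq> B" "x \<notin> S" "x' \<notin> S" by (auto simp: S_def)
  have disj: "S \<inter> (A0 - {r2}) = {}" "x \<notin> A0 - {r2}"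
    "x' \<notin> S \<union> insert x (A0 - {r2})" "x' \<notin> A1 - {r3}" "(S \<union> insert x (A0 - {r2})) \<inter> (A1 - {r3}) = {}"
    using SB AB(4) A01(3,4) B01(3) x(1) x'(1) \<open>x \<noteq> x'\<close> by auto
  obtain F where F: "ham_cycle (S \<union> insert x (A0 - {r2})) F" "E - {{y, z}} \<subseteq> F"
    using ham_cycle_detour_via[OF E z(1) _ E1 _ _ SB(2) disj(2,1)] y(3) adj_sym A01(9) by auto
  \<comment> \<open>The edges lie in different quarters, so the second one survives the first
    detour.\<close>
  have "{y', z'} \<noteq> {y, z}" using B01(4) y(1) y'(1) zB by (auto simp: doubleton_eq_iff)
  then have z'F: "{y', z'} \<in> F" using z'(1) F(2) by auto
  have "adj y' x'" "finite (A1 - {r3})" using y'(3) adj_sym A01(10) by auto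
  then have "\<exists>E. ham_cycle (S \<union> insert x (A0 - {r2}) \<union> insert x' (A1 - {r3})) E"
    using ham_cycle_detour_via[OF F(1) z'F _ E2 adj_flip(1) adj_flip(1) disj(3,4,5)] by blast
  moreover have "S \<union> insert x (A0 - {r2}) \<union> insert x' (A1 - {r3}) = Q - {r1, r2, r3, g1, g2, g3}"
  proof -
    have "S \<union> insert x (A0 - {r2}) \<union> insert x' (A1 - {r3}) =
      (S \<union> {x, x'}) \<union> ((A0 - {r2}) \<union> (A1 - {r3}))" by auto
    also have "S \<union> {x, x'} = B - {r1, g1, g2, g3}"
      using x x' B01(3) c by (auto simp: S_def)
    also have "(A0 - {r2}) \<union> (A1 - {r3}) = A - {r2, r3}" using A01(3,4) mem2 by auto
    also have "(B - {r1, g1, g2, g3}) \<union> (A - {r2, r3}) = Q - {r1, r2, r3, g1, g2, g3}"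
      using AB(3,4) mem by auto
    finally show ?thesis .
  qed
  ultimately show ?thesis by metis
qed

text \<open>With \<open>g1\<close> on the side of \<open>r3\<close>, one quarter of \<open>A\<close>
  has the single fault \<open>r2\<close> and is entered through the extra vertex \<open>x\<close>;
  the other has the neutral pair \<open>r3\<close>, \<open>g1\<close> and is crossed by an ordinary
  detour.\<close>

lemma six_faults_3_3:
  assumes Q: "subcube (Suc n) Q" "5 \<le> n" "{r1, r2, r3, g1, g2, g3} \<subseteq> Q" "r2 \<noteq> r3"
    "distinct [g1, g2, g3]"
    and c: "col r2 = col r1" "col r3 = col r1" "col g1 \<noteq> col r1" "col g2 \<noteq> col r1" "col g3 \<noteq> col r1"
    and i: "dir Q i" "(i \<in> supp r2) \<noteq> (i \<in> supp r1)" "(i \<in> supp r3) \<noteq> (i \<in> supp r1)"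
      "(i \<in> supp g1) \<noteq> (i \<in> supp r1)" "(i \<in> supp g2) = (i \<in> supp r1)"
        "(i \<in> supp g3) = (i \<in> supp r1)"
  shows "\<exists>E. ham_cycle (Q - {r1, r2, r3, g1, g2, g3}) E"
proof -
  obtain j where j: "dir Q j" "(j \<in> supp r2) \<noteq> (j \<in> supp r3)"
    using subcube_eqI[OF Q(4,1)] Q(3) by auto
  have main: "\<exists>E. ham_cycle (Q - {r1, r2, r3, g1, g2, g3}) E"
    if Q: "subcube (Suc n) Q" "5 \<le> n" "{r1, r2, r3, g1, g2, g3} \<subseteq> Q" "r2 \<noteq> r3"
      "distinct [g1, g2, g3]"
    and c: "col r2 = col r1" "col r3 = col r1" "col g1 \<noteq> col r1" "col g2 \<noteq> col r1" "col g3 \<noteq> col r1"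
    and i: "dir Q i" "(i \<in> supp r2) \<noteq> (i \<in> supp r1)" "(i \<in> supp r3) \<noteq> (i \<in> supp r1)"
      "(i \<in> supp g1) \<noteq> (i \<in> supp r1)" "(i \<in> supp g2) = (i \<in> supp r1)"
        "(i \<in> supp g3) = (i \<in> supp r1)"
    and j: "dir Q j" "(j \<in> supp r2) \<noteq> (j \<in> supp r3)" "(j \<in> supp g1) = (j \<in> supp r3)"
    for r2 r3
  proof -
    obtain m where m: "n = Suc m" "4 \<le> m" using Q(2) by (cases n) auto
    have m0: "m \<noteq> 0" and p8: "8 \<le> (2::nat) ^ (m - 1)" using pow_ge[of 3 "m - 1"] m(2) by auto
    define A where "A = half Q i (i \<in> supp r2)"
    define B where "B = half Q i (\<not> (i \<in> supp r2))"
    note AB = halves[OF Q(1) i(1) A_def B_def]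
    have mem: "r2 \<in> A" "r3 \<in> A" "g1 \<in> A" "g2 \<in> B" "g3 \<in> B" "r1 \<in> B"
      using AB(7)[of r2] AB(7)[of r3] AB(7)[of g1] AB(8)[of g2] AB(8)[of g3] AB(8)[of r1] Q(3) i
        by auto
    have "j \<noteq> i" using j i by auto
    then have dj: "dir A j" "dir B j" using dir_half j(1) by (auto simp: A_def B_def)
    define A0 where "A0 = half A j (j \<in> supp r2)"
    define A1 where "A1 = half A j (\<not> (j \<in> supp r2))"
    note A01 = halves[OF AB(1)[unfolded m] dj(1) A0_def A1_def]
    define B0 where "B0 = half B j (j \<in> supp r2)"
    define B1 where "B1 = half B j (\<not> (j \<in> supp r2))"
    note B01 = halves[OF AB(2)[unfolded m] dj(2) B0_def B1_def]
    have cross: "x \<in> B0 \<Longrightarrow> flip i x \<in> A0" "x \<in> B1 \<Longrightarrow> flip i x \<in> A1" for x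
      using A01(7,8) B01(7,8) AB(6) \<open>j \<noteq> i\<close> by (auto simp: mem_flip)
    have mem2: "r2 \<in> A0" "r3 \<in> A1" "g1 \<in> A1" using A01(7,8) mem j by auto
    obtain x where x: "x \<in> B0" "col x = col r1" "x \<noteq> r1"
      using pick_col[OF B01(1), of "{r1}" "col r1"] p8 m0 by auto
    have "card {g2, g3} < m" using card_length[of "[g2, g3]"] m(2) by simp
    then obtain y where y: "y \<in> B0" "y \<notin> {g2, g3}" "adj x y"
      using pick_nbr[OF B01(1) x(1), of "{g2, g3}"] by auto
    define S where "S = B - {r1, x, g2, g3}"
    have n4: "4 \<le> n" using Q(2) by simp
    obtain E where E: "ham_cycle S E"
      using four_faults[OF AB(2) n4, of r1 x g2 g3] mem x Q(5) c B01(3) by (auto simp: S_def)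
    have cy: "col y \<noteq> col r1" using adj_col[OF y(3)] x by auto
    then have yS: "y \<in> S" using y x(2) B01(3) by (auto simp: S_def)
    obtain z where z: "{y, z} \<in> E" "(j \<in> supp z) = (j \<in> supp y)"
      using ham_cycle_half_nbr[OF E yS] by blast
    note ed = ham_cycle_edge[OF E z(1)]
    have zB: "z \<in> B0" using z ed y B01(7,8) by (auto simp: S_def)
    have zc: "col z = col r1" using adj_col[OF ed(1)] cy by auto
    have zx: "z \<noteq> x" using ed by (auto simp: S_def)
    \<comment> \<open>Requiring \<open>q\<close> to stay in its quarter uses up the choice between
      two neighbours. To keep \<open>q\<close> from lying opposite \<open>r3\<close>,
      \<open>p\<close> is chosen outside the cycle neighbours of \<open>flip i r3\<close>.\<close>
    obtain u v where uv: "{w. {flip i r3, w} \<in> E} \<subseteq> {u, v}"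
      using ham_cycle_nbrs(2)[OF E] by blast
    have "card {r1, flip i g1, u, v} < 8" using card_length[of "[r1, flip i g1, u, v]"] by simp
    then obtain p where p: "p \<in> B1" "p \<notin> {r1, flip i g1, u, v}" "col p = col r1"
      using pick_col[OF B01(2), of "{r1, flip i g1, u, v}" "col r1"] p8 m0 by auto
    have "p \<noteq> x" using p(1) x(1) B01(4) by auto
    then have "p \<in> S" using p c B01(3) by (auto simp: S_def)
    then obtain q where q: "{p, q} \<in> E" "(j \<in> supp q) = (j \<in> supp p)"
      using ham_cycle_half_nbr[OF E] by blast
    note ed' = ham_cycle_edge[OF E q(1)]
    have qB: "q \<in> B1" using q ed' p B01(7,8) by (auto simp: S_def)
    have qc: "col q \<noteq> col r1" using adj_col[OF ed'(1)] p by auto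
    have "q \<noteq> flip i r3" using q(1) uv p(2) by (auto simp: insert_commute)
    then have pq: "flip i q \<noteq> r3" "flip i p \<noteq> g1" using p(2) by auto
    have pq': "flip i q \<noteq> g1" "flip i p \<noteq> r3" using p(3) qc c by auto
    obtain E1 where E1: "ham_path (A0 - {r2}) E1 (flip i x) (flip i z)"
      using one_fault[OF A01(1), of "flip i x" "flip i z" r2] cross x zB zc zx mem2 m(2) c by auto
    obtain E2 where E2: "ham_path (A1 - {r3, g1}) E2 (flip i p) (flip i q)"
      using two_faults[OF A01(2) m(2), of "flip i p" "flip i q" r3 g1] cross p qB qc mem2 c pq pq'
        by auto
    have SB: "S \<subseteq> B" "x \<notin> S" by (auto simp: S_def)
    have disj: "S \<inter> (A0 - {r2}) = {}" "x \<notin> A0 - {r2}"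
      "(S \<union> insert x (A0 - {r2})) \<inter> (A1 - {r3, g1}) = {}"
      using SB AB(4) A01(3,4) B01(3) x(1) by auto
    obtain F where F: "ham_cycle (S \<union> insert x (A0 - {r2})) F" "E - {{y, z}} \<subseteq> F"
      using ham_cycle_detour_via[OF E z(1) _ E1 _ _ SB(2) disj(2,1)] y(3) adj_sym A01(9) by auto
    have "{p, q} \<noteq> {y, z}" using B01(4) y(1) p(1) zB by (auto simp: doubleton_eq_iff)
    then have pqF: "{p, q} \<in> F" using q(1) F(2) by auto
    have "finite (A1 - {r3, g1})" using A01(10) by simp
    then have "\<exists>E. ham_cycle (S \<union> insert x (A0 - {r2}) \<union> (A1 - {r3, g1})) E"
      using ham_cycle_detour[OF F(1) pqF E2 adj_flip(1) adj_flip(1) disj(3)] by blast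
    moreover have "S \<union> insert x (A0 - {r2}) \<union> (A1 - {r3, g1}) = Q - {r1, r2, r3, g1, g2, g3}"
    proof -
      have "S \<union> insert x (A0 - {r2}) \<union> (A1 - {r3, g1}) =
        (S \<union> {x}) \<union> ((A0 - {r2}) \<union> (A1 - {r3, g1}))" by auto
      also have "S \<union> {x} = B - {r1, g2, g3}"
        using x B01(3) c by (auto simp: S_def)
      also have "(A0 - {r2}) \<union> (A1 - {r3, g1}) = A - {r2, r3, g1}" using A01(3,4) mem2 by auto
      also have "(B - {r1, g2, g3}) \<union> (A - {r2, r3, g1}) = Q - {r1, r2, r3, g1, g2, g3}"
        using AB(3,4) mem by auto
      finally show ?thesis .
    qed
    ultimately show ?thesis by metis
  qed
  show ?thesis
  proof (cases "(j \<in> supp g1) = (j \<in> supp r3)")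
    case True
    then show ?thesis using main[of r2 r3] assms j by blast
  next
    case False
    then have "(j \<in> supp g1) = (j \<in> supp r2)" using j by blast
    then have "\<exists>E. ham_cycle (Q - {r1, r3, r2, g1, g2, g3}) E"
      using main[of r3 r2] Q c i j by (simp add: insert_commute)
    then show ?thesis by (simp add: insert_commute)
  qed
qed

text \<open>A direction separating \<open>r1\<close> from \<open>r2\<close> isolates exactly one red
  fault. Among three green faults two lie in the same half, so four positions remain for this pair
  and the third green fault.\<close>

lemma six_ok_Suc:
  assumes ok: "six_ok n" and n: "5 \<le> n"
  shows "six_ok (Suc n)"
  unfolding six_ok_def
proof (intro allI impI)
  fix Q r1 r2 r3 g1 g2 g3
  assume Q: "subcube (Suc n) Q" "{r1, r2, r3, g1, g2, g3} \<subseteq> Q"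
    "distinct [r1, r2, r3]" "distinct [g1, g2, g3]" and c: "col r2 = col r1" "col r3 = col r1"
    "col g1 \<noteq> col r1" "col g2 \<noteq> col r1" "col g3 \<noteq> col r1"
  obtain i where i: "dir Q i" "(i \<in> supp r1) \<noteq> (i \<in> supp r2)"
    using subcube_eqI[OF _ Q(1), of r1 r2] Q(2,3) by auto
  have main: "\<exists>E. ham_cycle (Q - {s1, s2, s3, g1, g2, g3}) E"
    if s: "{s1, s2, s3} = {r1, r2, r3}" "s2 \<noteq> s3" "(i \<in> supp s2) \<noteq> (i \<in> supp s1)"
      "(i \<in> supp s3) \<noteq> (i \<in> supp s1)"
    for s1 s2 s3
  proof -
    have sc: "s1 \<in> Q" "s2 \<in> Q" "s3 \<in> Q" "col s1 = col r1" "col s2 = col r1" "col s3 = col r1"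
      using s(1) Q(2) c by (metis insertCI insertE insert_subset singletonD)+
    have n4: "4 \<le> n" using n by simp
    have *: "\<exists>E. ham_cycle (Q - {s1, s2, s3, h1, h2, h3}) E"
      if h: "{h1, h2, h3} = {g1, g2, g3}" "distinct [h1, h2, h3]"
        "(i \<in> supp h2) = (i \<in> supp h3)" for h1 h2 h3
    proof -
      have hc: "h1 \<in> Q" "h2 \<in> Q" "h3 \<in> Q" "col h1 \<noteq> col r1" "col h2 \<noteq> col r1" "col h3 \<noteq> col r1"
        using h(1) Q(2) c by (metis insertCI insertE insert_subset singletonD)+
      have sub: "{s1, s2, s3, h1, h2, h3} \<subseteq> Q" using hc sc by simp
      have cc: "col s2 = col s1" "col s3 = col s1" "col h1 \<noteq> col s1" "col h2 \<noteq> col s1"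
        "col h3 \<noteq> col s1"
        "h2 \<noteq> h3"
        using hc sc h(2) by auto
      \<comment> \<open>With \<open>s1\<close> in one half, the other half has mass 2, 4, 3 and 5 in
        the four cases.\<close>
      consider "(i \<in> supp h1) = (i \<in> supp s1)" "(i \<in> supp h2) = (i \<in> supp s1)"
        | "(i \<in> supp h1) = (i \<in> supp s1)" "(i \<in> supp h2) \<noteq> (i \<in> supp s1)"
        | "(i \<in> supp h1) \<noteq> (i \<in> supp s1)" "(i \<in> supp h2) = (i \<in> supp s1)"
        | "(i \<in> supp h1) \<noteq> (i \<in> supp s1)" "(i \<in> supp h2) \<noteq> (i \<in> supp s1)"
        by blast
      then show ?thesis
      proof cases
        case 1
        show ?thesis
          by (rule six_faults_2_4[OF ok Q(1) n sub s(2) h(2) cc(1-5) i(1)]) (use 1 h(3) s in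
            simp_all)
      next
        case 2
        show ?thesis
          by (rule six_faults_balanced[OF Q(1) n4 sub s(2) cc(6) cc(1-5) i(1)]) (use 2 h(3) s in
            simp_all)
      next
        case 3
        show ?thesis
          by (rule six_faults_3_3[OF Q(1) n sub s(2) h(2) cc(1-5) i(1)]) (use 3 h(3) s in simp_all)
      next
        case 4
        show ?thesis
          by (rule six_faults_5_1[OF ok Q(1) n sub s(2) h(2) cc(1-5) i(1)]) (use 4 h(3) s in
            simp_all)
      qed
    qed
    consider "(i \<in> supp g2) = (i \<in> supp g3)" | "(i \<in> supp g1) = (i \<in> supp g3)" | "(i \<in> supp g2) = (i
        \<in> supp g1)"
      by blast
    then show ?thesis
    proof cases
      case 1
      then show ?thesis using *[of g1 g2 g3] Q(4) by simp
    next
      case 2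
      then have "\<exists>E. ham_cycle (Q - {s1, s2, s3, g2, g1, g3}) E"
        using *[of g2 g1 g3] Q(4) by (auto simp: insert_commute)
      then show ?thesis by (simp add: insert_commute)
    next
      case 3
      then have "\<exists>E. ham_cycle (Q - {s1, s2, s3, g3, g2, g1}) E"
        using *[of g3 g2 g1] Q(4) by (auto simp: insert_commute)
      then show ?thesis by (simp add: insert_commute)
    qed
  qed
  show "\<exists>E. ham_cycle (Q - {r1, r2, r3, g1, g2, g3}) E"
  proof (cases "(i \<in> supp r3) = (i \<in> supp r2)")
    case True
    then show ?thesis using main[of r1 r2 r3] i Q(3) by simp
  next
    case False
    then have "\<exists>E. ham_cycle (Q - {r2, r1, r3, g1, g2, g3}) E"
      using main[of r2 r1 r3] i Q(3) by (simp add: insert_commute)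
    then show ?thesis by (simp add: insert_commute)
  qed
qed

theorem six_ok: "5 \<le> n \<Longrightarrow> six_ok n"
  by (induction n rule: dec_induct) (auto intro: six_ok_5 six_ok_Suc)

section \<open>Transfer to the digraph of bit lists\<close>

lemma length_vwalk_arcs: "length (vwalk_arcs p) = length p - 1"
  by (induction p rule: vwalk_arcs.induct) auto

lemma hamiltonianI:
  fixes G :: "('a, 'a \<times> 'a) pre_digraph"
  assumes G: "tail G = fst" "head G = snd" and q: "distinct q" "3 \<le> length q" "set q = verts G"
    and arcs: "successively (\<lambda>x y. (x, y) \<in> arcs G) (q @ [hd q])"
  shows "hamiltonian G"
proof -
  interpret pre_digraph G .
  have cas: "cas u (vwalk_arcs (u # p)) (last (u # p)) \<and> awalk_verts u (vwalk_arcs (u # p)) = u # p"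
    for u p
    by (induction p arbitrary: u) (auto simp: G)
  have sub: "successively (\<lambda>x y. (x, y) \<in> arcs G) p \<Longrightarrow> set (vwalk_arcs p) \<subseteq> arcs G" for p
    by (induction p rule: vwalk_arcs.induct) auto
  obtain u r where ur: "q = u # r" using q(2) by (cases q) auto
  define p where "p = vwalk_arcs (q @ [hd q])"
  have verts: "awalk_verts u p = q @ [u]" "cas u p u"
    using cas[of u "r @ [u]"] by (simp_all add: p_def ur)
  have "awalk u p u"
    unfolding awalk_def using verts sub[OF arcs] q(3) ur by (auto simp: p_def)
  moreover have "length p = length q" by (simp add: p_def length_vwalk_arcs)
  then have "3 \<le> length p" "p \<noteq> []" using q(2) by auto
  moreover have "distinct (tl (awalk_verts u p))" using q(1) ur by (simp add: verts)
  ultimately show ?thesis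
    unfolding hamiltonian_def cycle_def using verts(1) q(3) ur
    by (intro exI[of _ u] exI[of _ p]) auto
qed

text \<open>The list repeats its first vertex at the end; hence distinctness of the tail only, and
  length 4 for a cycle of at least three arcs.\<close>

lemma hamiltonianE:
  fixes G :: "('a, 'a \<times> 'a) pre_digraph"
  assumes "hamiltonian G" "tail G = fst" "head G = snd"
  obtains vs where "distinct (tl vs)" "4 \<le> length vs" "hd vs = last vs" "set vs = verts G"
    "\<And>i. Suc i < length vs \<Longrightarrow> (vs ! i, vs ! Suc i) \<in> arcs G"
proof -
  interpret pre_digraph G .
  obtain u p where p: "awalk u p u" "cycle p" "3 \<le> length p" "set (awalk_verts u p) = verts G"
    using assms(1) unfolding hamiltonian_def by auto
  have cas: "cas u p v \<Longrightarrow> length (awalk_verts u p) = Suc (length p) \<and> hd (awalk_verts u p) = u \<and>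
    last (awalk_verts u p) = v \<and> (\<forall>i < length p. p ! i = (awalk_verts u p ! i, awalk_verts u p ! Suc
      i))" for u v p
  proof (induction p arbitrary: u)
    case (Cons e p)
    then have "cas (snd e) p v" and u: "u = fst e" using assms(2,3) by auto
    note IH = Cons.IH[OF this(1)]
    then have "awalk_verts (snd e) p ! 0 = snd e"
      by (metis hd_conv_nth length_0_conv nat.distinct(1))
    then show ?case
      using IH u assms(2,3) by (auto simp: nth_Cons split: nat.splits)
  qed (use assms in auto)
  note c = cas[OF p(1)[unfolded awalk_def, THEN conjunct2, THEN conjunct2]]
  have "distinct (tl (awalk_verts u p))"
  proof -
    obtain w where w: "awalk w p w" "distinct (tl (awalk_verts w p))" using p(2) unfolding cycle_def
      by auto
    have "p \<noteq> []" using p(3) by auto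
    \<comment> \<open>The start is existentially bound in \<open>cycle\<close>; the tail of the
      first arc identifies it with \<open>u\<close>.\<close>
    then have "w = u" using w(1) p(1) by (cases p) (auto simp: awalk_def)
    then show ?thesis using w by simp
  qed
  moreover have "(awalk_verts u p ! i, awalk_verts u p ! Suc i) \<in> arcs G"
    if "Suc i < length (awalk_verts u p)" for i
    using c that p(1) unfolding awalk_def by (metis Suc_less_SucD nth_mem subsetD)
  ultimately show ?thesis using that[of "awalk_verts u p"] c p(3,4) by auto
qed

lemma hamiltonian_nbrs:
  fixes G :: "('a, 'a \<times> 'a) pre_digraph"
  assumes "hamiltonian G" "tail G = fst" "head G = snd" "w \<in> verts G"
  shows "\<exists>y z. y \<noteq> z \<and> (y, w) \<in> arcs G \<and> (w, z) \<in> arcs G"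
proof -
  obtain vs where vs: "distinct (tl vs)" "4 \<le> length vs" "hd vs = last vs" "set vs = verts G"
    "\<And>i. Suc i < length vs \<Longrightarrow> (vs ! i, vs ! Suc i) \<in> arcs G"
    using hamiltonianE[OF assms(1-3)] by blast
  obtain L where L: "length vs = Suc L" "3 \<le> L" using vs(2) by (cases "length vs") auto
  have wrap: "vs ! 0 = vs ! L" using vs(3) L
    by (metis Zero_not_Suc diff_Suc_1 hd_conv_nth last_conv_nth list.size(3))
  have inj: "vs ! Suc i = vs ! Suc j \<longleftrightarrow> i = j" if "i < L" "j < L" for i j
    using nth_eq_iff_index_eq[OF vs(1), of i j] that L by (simp add: nth_tl)
  obtain i where i: "i < L" "w = vs ! Suc i"
  proof -
    obtain k where k: "k < Suc L" "w = vs ! k" using assms(4) vs(4) L by (metis in_set_conv_nth)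
    show thesis
    proof (cases k)
      case 0
      then show ?thesis using that[of "L - 1"] k wrap L by simp
    next
      case (Suc j)
      then show ?thesis using that k by auto
    qed
  qed
  \<comment> \<open>Vertices are addressed as \<open>vs ! Suc i\<close> with \<open>i < L\<close>,
    since position 0 repeats position \<open>L\<close>. Then \<open>j\<close> and \<open>h\<close>
    are the successor and predecessor of \<open>i\<close> modulo \<open>L\<close>.\<close>
  define j where "j = (if Suc i = L then 0 else Suc i)"
  have j: "j < L" "(w, vs ! Suc j) \<in> arcs G"
    using i L vs(5)[of "Suc i"] vs(5)[of 0] wrap by (auto simp: j_def)
  define h where "h = (if i = 0 then L - 1 else i - 1)"
  have h: "h < L" "(vs ! Suc h, w) \<in> arcs G"
    using i L vs(5)[of i] wrap by (auto simp: h_def)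
  \<comment> \<open>Predecessor and successor modulo \<open>L\<close> differ because
    \<open>L\<close> is at least 3.\<close>
  have "h \<noteq> j" using i L by (auto simp: h_def j_def)
  then show ?thesis using inj[OF h(1) j(1)] h(2) j(2) by blast
qed

lemma faulty_cube_simps:
  "verts (faulty_cube n F) = {x. length x = n} - F"
  "arcs (faulty_cube n F) = {(x, y). length x = n \<and> length y = n \<and> x \<notin> F \<and> y \<notin> F \<and>
     card {i. i < n \<and> x ! i \<noteq> y ! i} = 1}"
  "tail (faulty_cube n F) = fst" "head (faulty_cube n F) = snd"
  by (auto simp: faulty_cube_def hypercube_def with_proj_def)

lemma red_iff: "red x \<longleftrightarrow> even (length (filter id x))"
  by (induction x) (auto simp: red_def)

section \<open>The standard cube and its bit lists\<close>

definition vcube :: "nat \<Rightarrow> vertex set" where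
  "vcube n = {x. supp x \<subseteq> {..<n}}"

abbreviation origin :: vertex where
  "origin \<equiv> Vertex {}"

lemma supp_origin [simp]: "supp origin = {}"
  by (simp add: Vertex_inverse)

lemma subcube_vcube: "subcube n (vcube n)"
  unfolding subcube_def vcube_def by (intro exI[of _ origin] exI[of _ "{..<n}"]) auto

lemma dir_vcube: "{i. dir (vcube n) i} = {..<n}"
proof -
  have "dir (vcube n) i" if "i < n" for i using that by (auto simp: dir_def vcube_def supp_flip)
  moreover have "i < n" if "dir (vcube n) i" for i
  proof -
    have "flip i origin \<in> vcube n" using that unfolding dir_def
      by (rule bspec) (simp add: vcube_def)
    then show ?thesis by (simp add: vcube_def supp_flip)
  qed
  ultimately show ?thesis by auto
qed

lemma faulty_cube_hamiltonian:
  assumes F: "fault n F" "neutral F" "mass F = 6" and n: "5 \<le> n"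
  shows "hamiltonian (faulty_cube n F)"
proof -
  \<comment> \<open>Relative to the origin, in the natural order, a code is the characteristic list
    of the support, so \<open>red\<close> and \<open>col\<close> agree.\<close>
  define f where "f = code origin [0..<n]"
  define Q where "Q = vcube n"
  have Q: "subcube n Q" "distinct [0..<n]" "set [0..<n] = {i. dir Q i}" "origin \<in> Q"
    using subcube_vcube dir_vcube by (auto simp: Q_def vcube_def)
  have bij: "bij_betw f Q {c. length c = n}" unfolding f_def using code_bij[OF Q(1-3)] .
  have col: "red (f x) \<longleftrightarrow> col x" if "x \<in> Q" for x
    using code_col[OF Q(1-3) that Q(4)] by (simp add: red_iff f_def col_def)
  have "F \<subseteq> {c. length c = n}" using F(1) by (simp add: fault_def hypercube_def)
  then have FQ: "F \<subseteq> f ` Q" using bij by (simp add: bij_betw_def)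
  have fin: "finite F" using F(3) card.infinite by fastforce
  have "card {x \<in> F. red x} + card {x \<in> F. green x} = card F"
    using fin by (subst card_Un_disjoint[symmetric]) (auto intro: arg_cong[of _ _ card])
  then have "card {x \<in> F. red x} = 3" "card {x \<in> F. green x} = 3"
    using F(2,3) by (simp_all add: neutral_def charge_def)
  then obtain a1 a2 a3 b1 b2 b3 where ab: "{x \<in> F. red x} = {a1, a2, a3}" "distinct [a1, a2, a3]"
    "{x \<in> F. green x} = {b1, b2, b3}" "distinct [b1, b2, b3]"
    unfolding card_3_iff by auto
  then have mem: "a1 \<in> F" "a2 \<in> F" "a3 \<in> F" "b1 \<in> F" "b2 \<in> F" "b3 \<in> F"
    "red a1" "red a2" "red a3" "green b1" "green b2" "green b3" by blast+
  have pre: "\<exists>x. x \<in> Q \<and> c = f x" if "c \<in> F" for c using FQ that by auto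
  obtain r1 r2 r3 where r: "r1 \<in> Q" "a1 = f r1" "r2 \<in> Q" "a2 = f r2" "r3 \<in> Q" "a3 = f r3"
    using pre[OF mem(1)] pre[OF mem(2)] pre[OF mem(3)] by blast
  obtain g1 g2 g3 where g: "g1 \<in> Q" "b1 = f g1" "g2 \<in> Q" "b2 = f g2" "g3 \<in> Q" "b3 = f g3"
    using pre[OF mem(4)] pre[OF mem(5)] pre[OF mem(6)] by blast
  note rg = r g
  have Feq: "F = f ` {r1, r2, r3, g1, g2, g3}"
  proof -
    have "F = {x \<in> F. red x} \<union> {x \<in> F. green x}" by auto
    also have "\<dots> = f ` {r1, r2, r3, g1, g2, g3}" unfolding ab(1,3) rg by auto
    finally show ?thesis .
  qed
  have "\<exists>E. ham_cycle (Q - {r1, r2, r3, g1, g2, g3}) E"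
    by (rule six_okD[OF six_ok[OF n] Q(1)]) (use ab mem rg col in auto)
  then obtain E a b E' where "ham_path (Q - {r1, r2, r3, g1, g2, g3}) E' a b" "adj a b"
    "3 \<le> card (Q - {r1, r2, r3, g1, g2, g3})"
    unfolding ham_cycle_def by auto
  then obtain p where p: "p \<noteq> []" "distinct p" "set p = Q - {r1, r2, r3, g1, g2, g3}"
    "adj (hd p) (last p)" "successively adj p" "3 \<le> card (set p)"
    unfolding ham_path_def by metis
  have arc: "(f x, f y) \<in> arcs (faulty_cube n F)" if xy: "x \<in> set p" "y \<in> set p" "adj x y" for x y
  proof -
    have xyQ: "x \<in> Q" "y \<in> Q" "x \<notin> {r1, r2, r3, g1, g2, g3}" "y \<notin> {r1, r2, r3, g1, g2, g3}"
      using xy p(3) by auto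
    have notF: "f z \<notin> F" if "z \<in> Q" "z \<notin> {r1, r2, r3, g1, g2, g3}" for z
      unfolding Feq using that rg bij by (auto simp: bij_betw_def dest: inj_onD)
    obtain k where k: "y = flip k x" using xy(3) by (auto simp: adj_def)
    then have "dir Q k" using subcube_sep[OF Q(1) xyQ(1,2), of k] by (simp add: mem_flip)
    then have "k < n" using Q(3) by auto
    then have "{i. i < n \<and> f x ! i \<noteq> f y ! i} = {k}"
      by (auto simp: f_def code_def k mem_flip)
    then show ?thesis
      using notF xyQ by (simp add: faulty_cube_simps f_def code_def)
  qed
  have "inj_on f (set p)" using bij p(3) by (metis Diff_subset bij_betw_def inj_on_subset)
  then have "distinct (map f p)" using p(2) by (simp add: distinct_map)
  moreover have "set (map f p) = verts (faulty_cube n F)"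
  proof -
    have "set (map f p) = f ` Q - f ` {r1, r2, r3, g1, g2, g3}"
      unfolding set_map p(3) using bij rg
        by (intro inj_on_image_set_diff[of f Q]) (auto simp: bij_betw_def)
    then show ?thesis using bij Feq by (simp add: faulty_cube_simps bij_betw_def)
  qed
  moreover have "successively (\<lambda>x y. (x, y) \<in> arcs (faulty_cube n F)) (map f p @ [hd (map f p)])"
  proof -
    have "successively (\<lambda>x y. (f x, f y) \<in> arcs (faulty_cube n F)) p"
      by (rule successively_mono[OF p(5)]) (rule arc)
    moreover have "(f (last p), f (hd p)) \<in> arcs (faulty_cube n F)"
      using arc p(1,4) adj_sym by auto
    ultimately show ?thesis using p(1)
      by (auto simp: successively_append_iff successively_map hd_map last_map)
  qed
  moreover have "3 \<le> length (map f p)" using p(2,6) by (simp add: distinct_card)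
  ultimately show ?thesis by (intro hamiltonianI) (auto simp: faulty_cube_simps)
qed

section \<open>Failure in dimensions 3 and 4\<close>

lemma counterexample_3:
  "\<exists>F. fault 3 F \<and> neutral F \<and> mass F = 6 \<and> \<not> hamiltonian (faulty_cube 3 F)"
proof -
  \<comment> \<open>Only 000 and 001 remain, too few vertices for a cycle.\<close>
  define F where "F = {[True, True, False], [True, False, True], [False, True, True],
    [True, False, False], [False, True, False], [True, True, True]}"
  have red: "{x \<in> F. red x} = {[True, True, False], [True, False, True], [False, True, True]}"
    and green: "{x \<in> F. green x} = {[True, False, False], [False, True, False], [True, True, True]}"
    by (auto simp: F_def red_def)
  have F: "fault 3 F" "mass F = 6" by (auto simp: F_def fault_def hypercube_def)
  have N: "neutral F" unfolding neutral_def charge_def red green by simp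
  have "\<not> hamiltonian (faulty_cube 3 F)"
  proof
    assume "hamiltonian (faulty_cube 3 F)"
    then obtain vs where vs: "distinct (tl vs)" "4 \<le> length vs" "set vs = {x. length x = 3} - F"
      using hamiltonianE[of "faulty_cube 3 F"] by (metis faulty_cube_simps(1,3,4))
    have "card {x :: bool list. length x = 3} = 8"
      using card_lists_length_eq[of "UNIV :: bool set" 3] by simp
    then have c: "card (set vs) = 2"
      using F vs(3) by (subst vs(3), subst card_Diff_subset) (auto simp: F_def)
    have "set (tl vs) \<subseteq> set vs" by (cases vs) auto
    then have "length vs - 1 \<le> card (set vs)"
      using distinct_card[OF vs(1)] card_mono[of "set vs" "set (tl vs)"] by simp
    then show False using c vs(2) by simp
  qed
  then show ?thesis using F N by blast
qed

lemma counterexample_4: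
  "\<exists>F. fault 4 F \<and> neutral F \<and> mass F = 6 \<and> \<not> hamiltonian (faulty_cube 4 F)"
proof -
  define w where "w = [False, False, False, False]"
  \<comment> \<open>Three of the four neighbours of \<open>w\<close> are deleted, which leaves a
    single edge at \<open>w\<close>; three vertices of the colour of \<open>w\<close> make the fault
    neutral.\<close>
  define F where "F = {[True, True, False, False], [True, False, True, False], [False, True, True,
      False],
    [True, False, False, False], [False, True, False, False], [False, False, True, False]}"
  have red: "{x \<in> F. red x} = {[True, True, False, False], [True, False, True, False], [False, True,
      True, False]}"
    and green: "{x \<in> F. green x} = {[True, False, False, False], [False, True, False, False],
        [False, False, True, False]}"
    by (auto simp: F_def red_def)
  have F: "fault 4 F" "mass F = 6" by (auto simp: F_def fault_def hypercube_def)
  have N: "neutral F" unfolding neutral_def charge_def red green by simp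
  have only: "z = [False, False, False, True]"
    if z4: "length z = 4" "z \<notin> F" "card {i. i < 4 \<and> w ! i \<noteq> z ! i} = 1" for z
  proof -
    obtain a b c d where z: "z = [a, b, c, d]" using z4(1)
      by (auto simp: numeral_eq_Suc length_Suc_conv)
    have "{i. i < 4 \<and> w ! i \<noteq> z ! i} = set (filter (\<lambda>i. w ! i \<noteq> z ! i) [0..<4])" by auto
    then have "card {i. i < 4 \<and> w ! i \<noteq> z ! i} = length (filter (\<lambda>i. w ! i \<noteq> z ! i) [0..<4])"
      by (simp only:) (intro distinct_card, simp)
    also have "\<dots> = length (filter id z)"
      unfolding z w_def by (simp add: upt_rec numeral_eq_Suc)
    finally show ?thesis using that(2,3) unfolding z by (auto simp: F_def split: if_splits)
  qed
  have "\<not> hamiltonian (faulty_cube 4 F)"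
  proof
    assume "hamiltonian (faulty_cube 4 F)"
    moreover have "w \<in> verts (faulty_cube 4 F)" by (simp add: faulty_cube_simps w_def F_def)
    ultimately obtain y z where yz: "y \<noteq> z" "(y, w) \<in> arcs (faulty_cube 4 F)"
      "(w, z) \<in> arcs (faulty_cube 4 F)"
      using hamiltonian_nbrs faulty_cube_simps(3,4) by metis
    have "{i. i < 4 \<and> y ! i \<noteq> w ! i} = {i. i < 4 \<and> w ! i \<noteq> y ! i}" by auto
    then show False using yz only[of y] only[of z] by (simp add: faulty_cube_simps)
  qed
  then show ?thesis using F N by blast
qed

theorem lemma4p5:
  shows "bracket 6 = 5
    \<and> (\<forall>n\<ge>5. \<forall>F. fault n F \<and> neutral F \<and> mass F = 6 \<longrightarrow> hamiltonian (faulty_cube n F))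
    \<and> (\<forall>n\<in>{3, 4}. \<exists>F. fault n F \<and> neutral F \<and> mass F = 6 \<and> \<not> hamiltonian (faulty_cube n F))"
proof -
  have "bracket 6 = 5"
    unfolding bracket_def
  proof (rule Least_equality)
    show "0 < (5::nat) \<and> (\<forall>n\<ge>5. \<forall>F. fault n F \<and> neutral F \<and> mass F = 6 \<longrightarrow> hamiltonian (faulty_cube n
        F))"
      using faulty_cube_hamiltonian by simp
  next
    fix m :: nat
    assume "0 < m \<and> (\<forall>n\<ge>m. \<forall>F. fault n F \<and> neutral F \<and> mass F = 6 \<longrightarrow> hamiltonian (faulty_cube n F))"
    then have "\<not> m \<le> 4" using counterexample_4 by blast
    then show "5 \<le> m" by simp
  qed
  then show ?thesis
    using faulty_cube_hamiltonian counterexample_3 counterexample_4 by blast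
qed

end
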